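(* Let $m\neq\pm1$ be a square-free integer, $k$ a positive integer, $p$ a prime with $p\nmid m$, $n=p^k$, $\alpha$ a root of $X^n-m$, $r$ the remainder of $m$ modulo $p^{k+1}$, $s:=v_p(m^p-m)-1$, and for $t\in\mathbb{N}$ let $h^{(r)}_t(X)=\frac{X^{p^k}-r^{p^t}}{X^{p^{k-t}}-r}=\sum_{i=0}^{p^t-1} r^{i}X^{p^k-(i+1)p^{k-t}}\in\mathbb{Z}[X]$. (i) If $s<k$, then the elements $\alpha^j\frac{h^{(r)}_t(\alpha)}{p^t}$ ($0\leq t\leq s-1$, $0\leq j\leq p^{k-t}-p^{k-t-1}-1$) together with $\alpha^j\frac{h^{(r)}_s(\alpha)}{p^s}$ ($0\leq j\leq p^{k-s}-1$) form an integral basis of $\mathbb{Q}(\alpha)$. (ii) If $s\geq k$, then the elements $\alpha^j\frac{h^{(r)}_t(\alpha)}{p^t}$ ($0\leq t\leq k-1$, $0\leq j\leq p^{k-t}-p^{k-t-1}-1$) together with $\frac{h^{(r)}_k(\alpha)}{p^k}$ form an integral basis of $\mathbb{Q}(\alpha)$.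
   Context: $v_p$ denotes the $p$-adic valuation on $\mathbb{Q}$. An integral basis of a number field is a $\mathbb{Z}$-basis of its ring of integers. *)

theory Defs
  imports Complex_Main "HOL-Computational_Algebra.Computational_Algebra"
begin

definition simple_ext :: "complex \<Rightarrow> complex set" where
  "simple_ext \<alpha> = {poly (map_poly of_rat q) \<alpha> | q :: rat poly. True}"

definition ring_of_integers :: "complex set \<Rightarrow> complex set" where
  "ring_of_integers K = {x \<in> K. algebraic_int x}"

definition integral_basis :: "complex set \<Rightarrow> ('i \<Rightarrow> complex) \<Rightarrow> 'i set \<Rightarrow> bool" where
  "integral_basis K b I \<longleftrightarrow>
     finite I \<and> (\<forall>i\<in>I. b i \<in> ring_of_integers K) \<and>
     (\<forall>x \<in> ring_of_integers K. \<exists>!c :: 'i \<Rightarrow> int.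
         (\<forall>i. i \<notin> I \<longrightarrow> c i = 0) \<and> x = (\<Sum>i\<in>I. of_int (c i) * b i))"

definition hpoly :: "int \<Rightarrow> nat \<Rightarrow> nat \<Rightarrow> nat \<Rightarrow> complex \<Rightarrow> complex" where
  "hpoly r p k t x = (\<Sum>i<p^t. of_int r ^ i * x ^ (p^k - (i+1) * p^(k-t)))"

end

theory Submission
  imports Defs "HOL-Number_Theory.Residue_Primitive_Roots" "Jordan_Normal_Form.Char_Poly"
begin

text \<open>
  The proposed elements are polynomials in \<open>\<alpha>\<close> of the degrees \<open>0, \<dots>, p\<^sup>k - 1\<close>, so everything
  reduces to their integrality and to a bound for the denominator of the leading coefficient of an
  arbitrary integral \<open>P(\<alpha>)\<close>. Taking traces and using that \<open>X\<^sup>n - m\<close> is Eisenstein at the primes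
  dividing \<open>m\<close>, only powers of \<open>p\<close> can occur in denominators. Let \<open>s' = min s k\<close>. If \<open>c\<close> is an
  algebraic integer for which \<open>c ^ p ^ s'\<close> is \<open>p\<close>-adically very close to \<open>m\<close>, then \<open>P\<close> also takes
  integral values at the \<open>n\<close>-th roots of \<open>c ^ p ^ s'\<close>. The polynomial \<open>X\<^sup>n - c ^ p ^ s'\<close> splits
  explicitly into homogenised cyclotomic factors, and a root of any of them, suitably translated, is
  a uniformizer and generates a \<open>p\<close>-maximal order. Dividing \<open>P\<close> successively by these factors costs
  one power of \<open>p\<close> per factor, since each factor takes the value \<open>p\<close> times a unit at the roots of the
  lower ones. For \<open>p = 2\<close> and \<open>1 \<le> s \<le> k\<close> the last square root only exists in the unramified
  quadratic extension, which is why \<open>c\<close> ranges over a coefficient ring \<open>D\<close> that may be larger than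
  the integers.
\<close>

text \<open>The \<open>p\<close>-adic numbers are never formed. For odd \<open>p\<close> the
  condition \<open>v_p(m ^ p - m) = s + 1\<close> says that \<open>m\<close> is a
  \<open>p ^ s\<close>-th but not a \<open>p ^ (s + 1)\<close>-th power there; here an exact root is
  replaced by a congruence modulo \<open>p ^ l\<close>. The exponent \<open>l\<close> depends on
  \<open>P\<close>, so a new \<open>c\<close> and new roots are chosen for each \<open>P\<close>.
  Likewise no prime ideal is chosen: smallness and invertibility are stated as integrality of
  \<open>x ^ L / p\<close> and \<open>(u * v - 1) / p\<close>, which covers all places above
  \<open>p\<close> at once.

  The blocks of the basis mirror the factorization. Block \<open>t\<close> below the last has
  \<open>p ^ (k - t) - p ^ (k - t - 1)\<close> elements, the degree of the cyclotomic factor with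
  \<open>j = s' - t - 1\<close>, and the last block has the degree of \<open>X ^ e - c\<close> with
  \<open>e = p ^ (k - s')\<close>. An element in block \<open>t\<close> lies above the degrees of
  \<open>t\<close> factors, which gives its leading coefficient \<open>1 / p ^ t\<close>.

  The exception at 2 comes from the unit group: 5 generates only the residues 1 modulo 4, and
  \<open>v_2(5 ^ a - 1) = v_2(a) + 2\<close>. This shift by one costs one square root.\<close>

hide_const (open) UnivPoly.coeff UnivPoly.monom Module.smult

section \<open>The ring of algebraic integers\<close>

text \<open>The characteristic polynomial of an integer matrix is monic with integer coefficients,
  and \<open>x\<close> is one of its roots.\<close>

lemma algebraic_int_if_int_matrix_eigenvalue:
  fixes x :: complex and v :: "nat \<Rightarrow> complex" and A :: "nat \<Rightarrow> nat \<Rightarrow> int"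
  assumes ev: "\<And>i. i < N \<Longrightarrow> x * v i = (\<Sum>j<N. of_int (A i j) * v j)"
    and "i0 < N" "v i0 \<noteq> 0"
  shows "algebraic_int x"
proof -
  define B where "B = mat N N (\<lambda>(i, j). A i j)"
  have B: "B \<in> carrier_mat N N" by (simp add: B_def)
  define C where "C = map_mat (of_int :: int \<Rightarrow> complex) B"
  have C: "C \<in> carrier_mat N N" using B by (simp add: C_def)
  have "C *\<^sub>v vec N v = x \<cdot>\<^sub>v vec N v"
  proof (rule eq_vecI)
    fix i assume "i < dim_vec (x \<cdot>\<^sub>v vec N v)"
    then have i: "i < N" by simp
    have "(C *\<^sub>v vec N v) $ i = (\<Sum>j = 0..<N. of_int (A i j) * v j)"
      using i C by (simp add: scalar_prod_def C_def B_def)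
    then show "(C *\<^sub>v vec N v) $ i = (x \<cdot>\<^sub>v vec N v) $ i"
      using ev[OF i] i by (simp add: lessThan_atLeast0)
  qed (use C in simp)
  moreover have "vec N v \<noteq> 0\<^sub>v N"
    using assms(2,3) by (metis index_vec index_zero_vec(1))
  ultimately have "eigenvalue C x"
    unfolding eigenvalue_def eigenvector_def using C by (intro exI[of _ "vec N v"]) auto
  then have "poly (char_poly C) x = 0"
    using eigenvalue_root_char_poly[OF C] by simp
  moreover have "char_poly C = map_poly of_int (char_poly B)"
    unfolding C_def by (rule of_int_hom.char_poly_hom[OF B])
  ultimately show ?thesis
    using degree_monic_char_poly[OF B] unfolding algebraic_int_altdef_ipoly by auto
qed

definition int_span :: "nat \<Rightarrow> (nat \<Rightarrow> complex) \<Rightarrow> complex set" where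
  "int_span N v = {\<Sum>l<N. of_int (c l) * v l | c. True}"

lemma int_span_add: "x \<in> int_span N v \<Longrightarrow> y \<in> int_span N v \<Longrightarrow> x + y \<in> int_span N v"
proof -
  assume "x \<in> int_span N v" "y \<in> int_span N v"
  then obtain c d where "x = (\<Sum>l<N. of_int (c l) * v l)" "y = (\<Sum>l<N. of_int (d l) * v l)"
    unfolding int_span_def by auto
  then have "x + y = (\<Sum>l<N. of_int (c l + d l) * v l)"
    by (simp add: sum.distrib algebra_simps)
  then show ?thesis unfolding int_span_def by (intro CollectI exI[of _ "\<lambda>l. c l + d l"]) simp
qed

lemma int_span_mult_int: "x \<in> int_span N v \<Longrightarrow> of_int k * x \<in> int_span N v"
proof -
  assume "x \<in> int_span N v"
  then obtain c where "x = (\<Sum>l<N. of_int (c l) * v l)"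
    unfolding int_span_def by auto
  then have "of_int k * x = (\<Sum>l<N. of_int (k * c l) * v l)"
    by (simp add: sum_distrib_left algebra_simps)
  then show ?thesis unfolding int_span_def by (intro CollectI exI[of _ "\<lambda>l. k * c l"]) simp
qed

lemma int_span_base: "l < N \<Longrightarrow> v l \<in> int_span N v"
proof -
  assume l: "l < N"
  have "v l = (\<Sum>i<N. of_int (if i = l then 1 else 0) * v i)"
    using l by (simp add: if_distrib if_distribR cong: if_cong)
  then show ?thesis unfolding int_span_def by (intro CollectI exI[of _ "\<lambda>i. if i = l then 1 else 0"]) simp
qed

lemma int_span_0: "0 \<in> int_span N v"
  unfolding int_span_def by (intro CollectI exI[of _ "\<lambda>_. 0"]) simp

lemma int_span_sum:
  "(\<And>i. i \<in> I \<Longrightarrow> f i \<in> int_span N v) \<Longrightarrow> sum f I \<in> int_span N v"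
  by (induction I rule: infinite_finite_induct) (auto intro: int_span_add int_span_0)

text \<open>The determinant trick: multiplication by \<open>x\<close> acts on the generators through
  an integer matrix, for which they form a nonzero eigenvector.\<close>

lemma algebraic_int_if_int_span_closed:
  assumes "\<And>i. i < N \<Longrightarrow> x * v i \<in> int_span N v" "i0 < N" "v i0 \<noteq> 0"
  shows "algebraic_int x"
proof -
  have "\<forall>i. \<exists>c. i < N \<longrightarrow> x * v i = (\<Sum>l<N. of_int (c l) * v l)"
    using assms(1) unfolding int_span_def by blast
  then obtain A :: "nat \<Rightarrow> nat \<Rightarrow> int" where "\<And>i. i < N \<Longrightarrow> x * v i = (\<Sum>l<N. of_int (A i l) * v l)"
    by metis
  then show ?thesis using algebraic_int_if_int_matrix_eigenvalue assms(2,3) by blast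
qed

lemma algebraic_int_power_in_int_span:
  assumes "algebraic_int (x :: complex)"
  obtains a where "a > 0" "\<And>i. x ^ i \<in> int_span a (\<lambda>l. x ^ l)"
proof -
  obtain q where q: "poly (map_poly of_int q) x = 0" "lead_coeff q = 1"
    using assms unfolding algebraic_int_altdef_ipoly by blast
  define a where "a = degree q"
  have a: "a > 0"
  proof (rule Nat.gr0I)
    assume "a = 0"
    then obtain u where "q = [:u:]" unfolding a_def by (elim degree_eq_zeroE)
    with q show False by simp
  qed
  have "(\<Sum>l\<le>a. of_int (coeff q l) * x ^ l) = 0"
    using q(1) by (simp add: poly_altdef a_def coeff_map_poly degree_map_poly)
  then have xa: "x ^ a = (\<Sum>l<a. of_int (- coeff q l) * x ^ l)"
    using q(2) by (simp add: lessThan_Suc_atMost[symmetric] a_def[symmetric] sum_negf add_eq_0_iff)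
  have "x ^ i \<in> int_span a (\<lambda>l. x ^ l)" for i
  proof (induction i rule: less_induct)
    case (less i)
    show ?case
    proof (cases "i < a")
      case False
      then have "x ^ i = x ^ (i - a) * x ^ a" by (simp flip: power_add)
      also have "\<dots> = (\<Sum>l<a. of_int (- coeff q l) * x ^ (i - a + l))"
        by (simp add: xa sum_distrib_left power_add algebra_simps sum_negf)
      also have "\<dots> \<in> int_span a (\<lambda>l. x ^ l)"
        by (rule int_span_sum, rule int_span_mult_int, rule less) (use False in auto)
      finally show ?thesis .
    qed (use int_span_base[of i a "\<lambda>l. x ^ l"] in simp)
  qed
  with a show ?thesis using that by blast
qed

text \<open>The products \<open>x ^ u * y ^ w\<close> with \<open>u < a\<close> and
  \<open>w < b\<close> span a module closed under multiplication by \<open>x\<close> and by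
  \<open>y\<close>. The pair \<open>(u, w)\<close> is coded as the index
  \<open>u * b + w\<close>.\<close>

lemma algebraic_int_plus_times:
  assumes "algebraic_int (x :: complex)" "algebraic_int y"
  shows "algebraic_int (x + y)" and "algebraic_int (x * y)"
proof -
  obtain a where a: "a > 0" "\<And>i. x ^ i \<in> int_span a (\<lambda>l. x ^ l)"
    using algebraic_int_power_in_int_span[OF assms(1)] by blast
  obtain b where b: "b > 0" "\<And>i. y ^ i \<in> int_span b (\<lambda>l. y ^ l)"
    using algebraic_int_power_in_int_span[OF assms(2)] by blast
  define v where "v = (\<lambda>l. x ^ (l div b) * y ^ (l mod b))"
  have mem: "x ^ i * y ^ j \<in> int_span (a * b) v" for i j
  proof -
    obtain c where c: "x ^ i = (\<Sum>u<a. of_int (c u) * x ^ u)"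
      using a(2)[of i] unfolding int_span_def by blast
    obtain d where d: "y ^ j = (\<Sum>w<b. of_int (d w) * y ^ w)"
      using b(2)[of j] unfolding int_span_def by blast
    have "x ^ i * y ^ j = (\<Sum>u<a. \<Sum>w<b. of_int (c u * d w) * v (u * b + w))"
      unfolding c d sum_product v_def by (intro sum.cong refl) (auto simp: algebra_simps)
    also have "\<dots> \<in> int_span (a * b) v"
    proof (intro int_span_sum int_span_mult_int int_span_base)
      fix u w assume "u \<in> {..<a}" "w \<in> {..<b}"
      then have "u * b + w < Suc u * b" "Suc u * b \<le> a * b"
        by (simp, intro mult_le_mono1, simp)
      then show "u * b + w < a * b" by linarith
    qed
    finally show ?thesis .
  qed
  have 0: "0 < a * b" "v 0 \<noteq> 0" using a b by (auto simp: v_def)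
  show "algebraic_int (x + y)"
  proof (rule algebraic_int_if_int_span_closed[where v = v, OF _ 0])
    fix l
    have "(x + y) * v l = x ^ Suc (l div b) * y ^ (l mod b) + x ^ (l div b) * y ^ Suc (l mod b)"
      by (simp add: v_def algebra_simps)
    then show "(x + y) * v l \<in> int_span (a * b) v"
      using mem int_span_add by presburger
  qed
  show "algebraic_int (x * y)"
  proof (rule algebraic_int_if_int_span_closed[where v = v, OF _ 0])
    fix l
    have "(x * y) * v l = x ^ Suc (l div b) * y ^ Suc (l mod b)"
      by (simp add: v_def algebra_simps)
    then show "(x * y) * v l \<in> int_span (a * b) v"
      using mem by presburger
  qed
qed

lemma algebraic_int_diff:
  "algebraic_int (x :: complex) \<Longrightarrow> algebraic_int y \<Longrightarrow> algebraic_int (x - y)"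
  using algebraic_int_plus_times(1)[of x "- y"] by auto

lemma algebraic_int_power: "algebraic_int (x :: complex) \<Longrightarrow> algebraic_int (x ^ i)"
  by (induction i) (auto intro: algebraic_int_plus_times)

lemma algebraic_int_sum:
  "(\<And>i. i \<in> I \<Longrightarrow> algebraic_int (f i :: complex)) \<Longrightarrow> algebraic_int (sum f I)"
  by (induction I rule: infinite_finite_induct) (auto intro: algebraic_int_plus_times)

lemmas algebraic_int_closed = algebraic_int_plus_times algebraic_int_diff algebraic_int_power
  algebraic_int_sum algebraic_int_minus

section \<open>Polynomials over subrings of the complex numbers\<close>

definition is_subring :: "complex set \<Rightarrow> bool" where
  "is_subring S \<longleftrightarrow> 0 \<in> S \<and> 1 \<in> S \<and> (\<forall>x\<in>S. - x \<in> S) \<and>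
     (\<forall>x\<in>S. \<forall>y\<in>S. x + y \<in> S) \<and> (\<forall>x\<in>S. \<forall>y\<in>S. x * y \<in> S)"

lemma is_subringD:
  assumes "is_subring S"
  shows "0 \<in> S" "1 \<in> S" "x \<in> S \<Longrightarrow> - x \<in> S" "x \<in> S \<Longrightarrow> y \<in> S \<Longrightarrow> x + y \<in> S"
    "x \<in> S \<Longrightarrow> y \<in> S \<Longrightarrow> x * y \<in> S" "x \<in> S \<Longrightarrow> y \<in> S \<Longrightarrow> x - y \<in> S" "x \<in> S \<Longrightarrow> x ^ i \<in> S"
    "(\<And>i. i \<in> I \<Longrightarrow> f i \<in> S) \<Longrightarrow> sum f I \<in> S" "of_nat a \<in> S" "of_int b \<in> S"
proof -
  show 1: "0 \<in> S" "1 \<in> S" and 2: "\<And>x. x \<in> S \<Longrightarrow> - x \<in> S"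
    and 3: "\<And>x y. x \<in> S \<Longrightarrow> y \<in> S \<Longrightarrow> x + y \<in> S"
    and 4: "\<And>x y. x \<in> S \<Longrightarrow> y \<in> S \<Longrightarrow> x * y \<in> S"
    using assms unfolding is_subring_def by auto
  show "x \<in> S \<Longrightarrow> y \<in> S \<Longrightarrow> x - y \<in> S" using 2 3[of x "- y"] by simp
  show "x \<in> S \<Longrightarrow> x ^ i \<in> S" by (induction i) (auto intro: 1 4)
  show "(\<And>i. i \<in> I \<Longrightarrow> f i \<in> S) \<Longrightarrow> sum f I \<in> S"
    by (induction I rule: infinite_finite_induct) (auto intro: 1 3)
  have nat: "of_nat c \<in> S" for c by (induction c) (auto intro: 1 3)
  then show "of_nat a \<in> S" .
  show "of_int b \<in> S"
    using nat[of "nat b"] 2[OF nat[of "nat (- b)"]] by (cases "b \<ge> 0") auto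
qed

lemma is_subring_Ints: "is_subring \<int>" and is_subring_Rats: "is_subring \<rat>"
  unfolding is_subring_def by auto

text \<open>For \<open>N > 0\<close> this is \<open>S[1/N]\<close> inside the complex numbers. It
  holds the coefficients of a polynomial whose denominators are already known to be powers of
  \<open>N\<close>.\<close>

definition localize :: "nat \<Rightarrow> complex set \<Rightarrow> complex set" where
  "localize N S = {x. \<exists>l. of_nat N ^ l * x \<in> S}"

lemma localize_mono:
  assumes "is_subring S" "of_nat N ^ l * x \<in> S" "l \<le> l'"
  shows "of_nat N ^ l' * x \<in> S"
proof -
  have "of_nat N ^ l' * x = of_nat (N ^ (l' - l)) * (of_nat N ^ l * x)"
    using assms(3) by (simp flip: power_add mult.assoc)
  then show ?thesis using is_subringD(5)[OF assms(1) is_subringD(9)[OF assms(1)] assms(2)] by (simp only:)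
qed

lemma is_subring_localize:
  assumes S: "is_subring S"
  shows "is_subring (localize N S)"
  unfolding is_subring_def
proof (intro conjI ballI)
  show "0 \<in> localize N S" "1 \<in> localize N S"
    using is_subringD[OF S] unfolding localize_def by (auto intro!: exI[of _ 0])
next
  fix x assume "x \<in> localize N S"
  then show "- x \<in> localize N S"
    using is_subringD(3)[OF S] unfolding localize_def by fastforce
next
  fix x y assume "x \<in> localize N S" "y \<in> localize N S"
  then obtain a b where ab: "of_nat N ^ a * x \<in> S" "of_nat N ^ b * y \<in> S"
    unfolding localize_def by auto
  have "of_nat N ^ (a + b) * x \<in> S" "of_nat N ^ (a + b) * y \<in> S"
    using localize_mono[OF S ab(1)] localize_mono[OF S ab(2)] by auto
  then have "of_nat N ^ (a + b) * (x + y) \<in> S"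
    using is_subringD(4)[OF S] by (simp add: distrib_left)
  then show "x + y \<in> localize N S" unfolding localize_def by blast
  have "of_nat N ^ (a + b) * (x * y) = (of_nat N ^ a * x) * (of_nat N ^ b * y)"
    by (simp add: power_add algebra_simps)
  then have "of_nat N ^ (a + b) * (x * y) \<in> S" using is_subringD(5)[OF S ab] by (simp only:)
  then show "x * y \<in> localize N S" unfolding localize_def by blast
qed

lemma subset_localize: "S \<subseteq> localize N S"
  unfolding localize_def by (auto intro!: exI[of _ 0])

section \<open>Polynomials with coefficients in a subring, and their denominators\<close>

definition coeffs_in :: "complex set \<Rightarrow> complex poly \<Rightarrow> bool" where
  "coeffs_in S P \<longleftrightarrow> (\<forall>i. coeff P i \<in> S)"

lemma coeffs_inD: "coeffs_in S P \<Longrightarrow> coeff P i \<in> S"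
  unfolding coeffs_in_def by auto

lemma coeffs_in_mono: "coeffs_in S P \<Longrightarrow> S \<subseteq> T \<Longrightarrow> coeffs_in T P"
  unfolding coeffs_in_def by auto

lemma coeffs_in_closed:
  assumes S: "is_subring S"
  shows "coeffs_in S P \<Longrightarrow> coeffs_in S Q \<Longrightarrow> coeffs_in S (P + Q)"
    "coeffs_in S P \<Longrightarrow> coeffs_in S Q \<Longrightarrow> coeffs_in S (P - Q)"
    "coeffs_in S P \<Longrightarrow> coeffs_in S Q \<Longrightarrow> coeffs_in S (P * Q)"
    "coeffs_in S P \<Longrightarrow> coeffs_in S Q \<Longrightarrow> coeffs_in S (pcompose P Q)"
    "a \<in> S \<Longrightarrow> coeffs_in S (monom a d)" "a \<in> S \<Longrightarrow> coeffs_in S [:a:]"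
    "a \<in> S \<Longrightarrow> coeffs_in S P \<Longrightarrow> coeffs_in S (smult a P)"
    "coeffs_in S 0"
  using is_subringD[OF S] unfolding coeffs_in_def
  by (auto intro: coeff_mult_semiring_closed coeff_pcompose_semiring_closed
      simp: coeff_pCons split: nat.split)

lemma coeffs_in_sum:
  assumes "is_subring S" "\<And>i. i \<in> I \<Longrightarrow> coeffs_in S (f i)"
  shows "coeffs_in S (sum f I)"
  using assms(2) by (induction I rule: infinite_finite_induct)
    (auto intro: coeffs_in_closed[OF assms(1)])

lemma poly_eq_sum_lessThan:
  fixes P :: "complex poly"
  assumes "degree P < n"
  shows "poly P x = (\<Sum>i<n. coeff P i * x ^ i)"
  unfolding poly_altdef
  by (rule sum.mono_neutral_left) (use assms in \<open>auto simp: coeff_eq_0\<close>)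

text \<open>Because \<open>G\<close> is monic, long division never divides by a coefficient and
  stays inside \<open>S\<close>. The induction removes the leading term of \<open>P\<close>.\<close>

lemma coeffs_in_division:
  assumes S: "is_subring S" and G: "coeffs_in S G" "lead_coeff G = 1" "degree G > 0"
    and P: "coeffs_in S P"
  obtains Q R where "coeffs_in S Q" "coeffs_in S R" "P = Q * G + R" "degree R < degree G"
proof -
  have "\<exists>Q R. coeffs_in S Q \<and> coeffs_in S R \<and> P = Q * G + R \<and> degree R < degree G"
    using P
  proof (induction "degree P" arbitrary: P rule: less_induct)
    case less
    show ?case
    proof (cases "degree P < degree G")
      case True
      then show ?thesis using less(2) coeffs_in_closed(8)[OF S]
        by (intro exI[of _ 0] exI[of _ P]) auto
    next
      case False
      define d where "d = degree P - degree G"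
      define M where "M = monom (lead_coeff P) d"
      define P' where "P' = P - M * G"
      have M: "coeffs_in S M"
        unfolding M_def using less(2) by (intro coeffs_in_closed[OF S] coeffs_inD)
      have P'S: "coeffs_in S P'"
        unfolding P'_def by (intro coeffs_in_closed[OF S] less(2) G M)
      have "coeff P' i = 0" if "i \<ge> degree P" for i
      proof (cases "i = degree P")
        case True
        then show ?thesis using False G(2) by (simp add: P'_def M_def coeff_monom_mult d_def)
      next
        case neq: False
        then have "i > degree P" "i - d > degree G" using that False d_def by auto
        then show ?thesis by (simp add: P'_def M_def coeff_monom_mult coeff_eq_0)
      qed
      moreover have "degree P > 0" using False G(3) by simp
      ultimately have "degree P' < degree P"
        by (metis degree_0 leading_coeff_0_iff not_le)
      from less(1)[OF this P'S] obtain Q R where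
        QR: "coeffs_in S Q" "coeffs_in S R" "P' = Q * G + R" "degree R < degree G" by blast
      then have "P = (Q + M) * G + R" unfolding P'_def by (simp add: algebra_simps)
      then show ?thesis using QR M coeffs_in_closed(1)[OF S] by blast
    qed
  qed
  then show ?thesis using that by blast
qed

lemma coeffs_in_localize_common:
  assumes S: "is_subring S" and P: "coeffs_in (localize N S) P"
  obtains l where "coeffs_in S (smult (of_nat N ^ l) P)"
proof -
  have "\<exists>l. coeffs_in S (smult (of_nat N ^ l) P)"
    using P
  proof (induction P)
    case 0
    then show ?case using coeffs_in_closed(8)[OF S] by simp
  next
    case (pCons a P)
    have "a \<in> localize N S" "coeffs_in (localize N S) P"
      using pCons(3) unfolding coeffs_in_def
      by (metis coeff_pCons_0) (metis coeff_pCons_Suc pCons(3) coeffs_in_def)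
    with pCons obtain l l' where l: "of_nat N ^ l * a \<in> S" "coeffs_in S (smult (of_nat N ^ l') P)"
      unfolding localize_def by auto
    have "of_nat N ^ (l + l') * coeff (pCons a P) i \<in> S" for i
      using localize_mono[OF S l(1)] localize_mono[OF S, of _ l' "coeff P (i - 1)" "l + l'"] l(2)
      by (auto simp: coeff_pCons coeffs_in_def split: nat.splits)
    then show ?case unfolding coeffs_in_def coeff_smult by blast
  qed
  then show ?thesis using that by blast
qed

lemma coeffs_in_Rats_common_denominator:
  assumes "coeffs_in \<rat> P"
  obtains N where "N > 0" "coeffs_in \<int> (smult (of_nat N) P)"
proof -
  have "\<exists>N>0. coeffs_in \<int> (smult (of_nat N) P)"
    using assms
  proof (induction P)
    case 0
    then show ?case by (intro exI[of _ 1]) (auto simp: coeffs_in_def)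
  next
    case (pCons a P)
    have a: "a \<in> \<rat>" and "coeffs_in \<rat> P"
      using pCons(3) unfolding coeffs_in_def
      by (metis coeff_pCons_0) (metis coeff_pCons_Suc pCons(3) coeffs_in_def)
    with pCons obtain N where N: "N > 0" "coeffs_in \<int> (smult (of_nat N) P)" by auto
    from a obtain u v where uv: "v > 0" "a = of_int u / of_int v" by (elim Rats_cases')
    have "of_nat (N * nat v) * coeff (pCons a P) i \<in> \<int>" for i
    proof (cases i)
      case 0
      have "of_nat (N * nat v) * a = of_int (int N * u)" using uv by (simp add: field_simps)
      then show ?thesis using 0 by (metis Ints_of_int coeff_pCons_0)
    next
      case (Suc j)
      have "of_nat (N * nat v) * coeff P j = of_nat (nat v) * (of_nat N * coeff P j)" by simp
      also have "\<dots> \<in> \<int>"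
        using Ints_mult[OF Ints_of_nat coeffs_inD[OF N(2), of j]] by (simp only: coeff_smult)
      finally show ?thesis using Suc by simp
    qed
    then have "coeffs_in \<int> (smult (of_nat (N * nat v)) (pCons a P))"
      unfolding coeffs_in_def coeff_smult by blast
    then show ?case using N uv by (intro exI[of _ "N * nat v"]) simp
  qed
  then show ?thesis using that by blast
qed

lemma algebraic_int_poly:
  assumes "coeffs_in S P" "S \<subseteq> {x. algebraic_int x}" "algebraic_int x"
  shows "algebraic_int (poly P x)"
  unfolding poly_altdef
  using assms unfolding coeffs_in_def by (intro algebraic_int_closed) auto

lemma Ints_subset_algebraic_int: "\<int> \<subseteq> {x :: complex. algebraic_int x}"
  using int_imp_algebraic_int by auto

lemma of_int_div_algebraic_int:
  assumes "algebraic_int (of_int a / of_int b :: complex)"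
  shows "of_int a / of_int b \<in> (\<int> :: complex set)" "b \<noteq> 0 \<Longrightarrow> b dvd a"
proof -
  show *: "of_int a / of_int b \<in> (\<int> :: complex set)"
    using rational_algebraic_int_is_int[OF assms] by simp
  assume "b \<noteq> 0"
  from * obtain c where "of_int a / of_int b = (of_int c :: complex)" by (elim Ints_cases)
  with \<open>b \<noteq> 0\<close> have "of_int a = (of_int (b * c) :: complex)" by (simp add: field_simps)
  then show "b dvd a" by (metis dvd_triv_left of_int_eq_iff)
qed

text \<open>Multiplication by \<open>\<pi> ^ (E - 1 - i0)\<close> pushes all terms above \<open>i0\<close> into multiples of \<open>\<pi> ^ E\<close>,
  which is divisible by \<open>q\<close>.\<close>
lemma isolate_coefficient:
  fixes \<pi> q :: complex
  assumes "q \<noteq> 0" "algebraic_int \<pi>" "algebraic_int (\<pi> ^ E / q)"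
    and b: "\<And>i. i < E \<Longrightarrow> algebraic_int (b i)"
    and sum: "algebraic_int ((\<Sum>i<E. b i * \<pi> ^ i) / q)"
    and i0: "i0 < E" and small: "\<And>i. i < i0 \<Longrightarrow> algebraic_int (b i / q)"
  shows "algebraic_int (b i0 * \<pi> ^ (E - 1) / q)"
proof -
  define f where "f i = b i * \<pi> ^ i * \<pi> ^ (E - 1 - i0) / q" for i
  have "f i0 = b i0 * \<pi> ^ (i0 + (E - 1 - i0)) / q" unfolding f_def by (simp add: power_add)
  then have f0: "f i0 = b i0 * \<pi> ^ (E - 1) / q" using i0 by simp
  have "(\<Sum>i<E. b i * \<pi> ^ i) / q * \<pi> ^ (E - 1 - i0) = (\<Sum>i<E. f i)"
    unfolding f_def by (simp add: sum_distrib_right sum_divide_distrib)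
  moreover have "(\<Sum>i<E. f i) = f i0 + (\<Sum>i\<in>{..<E} - {i0}. f i)"
    by (rule sum.remove) (use i0 in auto)
  ultimately have "f i0 = (\<Sum>i<E. b i * \<pi> ^ i) / q * \<pi> ^ (E - 1 - i0) - (\<Sum>i\<in>{..<E} - {i0}. f i)"
    by simp
  moreover have "algebraic_int (f i)" if i: "i \<in> {..<E} - {i0}" for i
  proof (cases "i < i0")
    case True
    have "f i = b i / q * \<pi> ^ i * \<pi> ^ (E - 1 - i0)" unfolding f_def by simp
    moreover have "algebraic_int (b i / q * \<pi> ^ i * \<pi> ^ (E - 1 - i0))"
      using small[OF True] assms(2) by (intro algebraic_int_closed)
    ultimately show ?thesis by simp
  next
    case False
    then have "i + (E - 1 - i0) = E + (i - i0 - 1)" using i i0 by auto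
    then have "\<pi> ^ i * \<pi> ^ (E - 1 - i0) = \<pi> ^ E * \<pi> ^ (i - i0 - 1)" by (simp flip: power_add)
    then have "f i = b i * (\<pi> ^ E / q) * \<pi> ^ (i - i0 - 1)" unfolding f_def by simp
    moreover have "algebraic_int (b i * (\<pi> ^ E / q) * \<pi> ^ (i - i0 - 1))"
      using b[of i] i assms(2,3) by (intro algebraic_int_closed) auto
    ultimately show ?thesis by simp
  qed
  moreover have "algebraic_int ((\<Sum>i<E. b i * \<pi> ^ i) / q * \<pi> ^ (E - 1 - i0))"
    using assms(2) sum by (intro algebraic_int_closed)
  ultimately have "algebraic_int (f i0)"
    by (auto intro!: algebraic_int_closed(3,5) simp del: times_divide_eq_left)
  then show ?thesis using f0 by simp
qed

text \<open>Each prime divides \<open>m\<close> at most once, so it suffices that it divides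
  \<open>b\<close> at all.\<close>

lemma squarefree_dvd_power_imp_dvd:
  fixes m b :: int
  assumes "squarefree m" "m dvd b ^ n"
  shows "m dvd b"
proof (cases "b = 0 \<or> n = 0")
  case True
  then show ?thesis using assms(2) by (auto simp: unit_imp_dvd)
next
  case False
  have m0: "m \<noteq> 0" using assms(1) by auto
  show ?thesis
  proof (rule multiplicity_le_imp_dvd)
    fix q :: int assume q: "prime q"
    show "multiplicity q m \<le> multiplicity q b"
    proof (cases "q dvd m")
      case True
      then have "q dvd b ^ n" using assms(2) dvd_trans by blast
      then have "q dvd b" using q prime_dvd_power by blast
      then have qb: "multiplicity q b \<ge> 1"
        using False q by (intro multiplicity_geI) auto
      have "\<not> q ^ 2 dvd m" using squarefreeD[OF assms(1), of q] q by auto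
      then have "multiplicity q m < 2" by (intro multiplicity_lessI) (use m0 q in auto)
      with qb show ?thesis by simp
    qed (simp add: not_dvd_imp_multiplicity_0)
  qed (use m0 in auto)
qed

section \<open>Radical extensions and their denominators\<close>

locale radical_root =
  fixes m :: int and n :: nat and \<alpha> :: complex
  assumes sqf: "squarefree m" and m_neq: "m \<noteq> 1" "m \<noteq> -1" and n_pos: "n > 0"
    and root: "\<alpha> ^ n = of_int m"
begin

lemma m_nonzero: "m \<noteq> 0"
  using sqf by auto

lemma algebraic_int_alpha: "algebraic_int \<alpha>"
proof (rule algebraic_int_root[where p = "monom 1 n" and y = "of_int m"])
qed (use root n_pos in \<open>auto simp: poly_monom degree_monom_eq\<close>)

text \<open>The Eisenstein argument, run at all primes dividing \<open>m\<close> together with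
  \<alpha> as uniformizer. Isolating the index \<open>i\<close> shows that
  \<open>b i * \<alpha> ^ (n - 1) / m\<close> is integral. Its \<open>n\<close>-th power is the
  rational number \<open>b i ^ n / m\<close>, so \<open>m\<close> divides \<open>b i ^ n\<close>,
  and square-freeness finishes.\<close>

lemma dvd_coefficients:
  assumes "algebraic_int ((\<Sum>i<n. of_int (b i) * \<alpha> ^ i) / of_int m)" "i < n"
  shows "m dvd b i"
  using assms(2)
proof (induction i rule: less_induct)
  case (less i)
  have "algebraic_int (of_int (b i) * \<alpha> ^ (n - 1) / of_int m)"
  proof (rule isolate_coefficient[OF _ algebraic_int_alpha _ _ assms(1) less(2)])
    show "algebraic_int (of_int (b j) / of_int m :: complex)" if "j < i" for j
    proof -
      have "m dvd b j" using less that by auto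
      then obtain c where "b j = m * c" ..
      then show ?thesis using m_nonzero by simp
    qed
  qed (use m_nonzero root in auto)
  then have "algebraic_int ((of_int (b i) * \<alpha> ^ (n - 1) / of_int m) ^ n)"
    by (rule algebraic_int_closed)
  moreover have "(of_int (b i) * \<alpha> ^ (n - 1) / of_int m) ^ n
    = (of_int (b i ^ n) / of_int m :: complex)"
  proof -
    have "(\<alpha> ^ (n - 1)) ^ n = of_int m ^ (n - 1)" by (metis power_mult mult.commute root)
    moreover have "(of_int m :: complex) ^ n = of_int m ^ (n - 1) * of_int m"
      using n_pos by (metis power_minus_mult)
    ultimately show ?thesis using m_nonzero by (simp add: power_mult_distrib power_divide)
  qed
  ultimately have "algebraic_int (of_int (b i ^ n) / of_int m :: complex)" by simp
  then have "m dvd b i ^ n" using of_int_div_algebraic_int(2) m_nonzero by blast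
  then show ?case using sqf squarefree_dvd_power_imp_dvd by blast
qed

text \<open>Descent: \<open>dvd_coefficients\<close> allows all coefficients of a relation to be
  divided by \<open>m\<close>, so every power of the non-unit \<open>m\<close> divides each of them.
  This is where the irreducibility of \<open>X ^ n - m\<close> comes from.\<close>

lemma linear_independence_int:
  assumes "(\<Sum>i<n. of_int (b i) * \<alpha> ^ i) = 0" "i < n"
  shows "b i = 0"
proof -
  have "m ^ j dvd b i" for j
    using assms
  proof (induction j arbitrary: b)
    case (Suc j)
    have dvd: "m dvd b l" if "l < n" for l
      using dvd_coefficients[OF _ that, of b] Suc(2) by simp
    then have "(\<Sum>l<n. of_int (b l) * \<alpha> ^ l) = of_int m * (\<Sum>l<n. of_int (b l div m) * \<alpha> ^ l)"
      by (auto simp: sum_distrib_left mult.assoc[symmetric] simp flip: of_int_mult intro!: sum.cong)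
    then have "(\<Sum>l<n. of_int (b l div m) * \<alpha> ^ l) = 0" using Suc(2) m_nonzero by simp
    from Suc(1)[OF this assms(2)] have "m ^ j dvd b i div m" .
    then have "m * m ^ j dvd m * (b i div m)" by (rule mult_dvd_mono[OF dvd_refl])
    then show ?case using dvd[OF assms(2)] by simp
  qed simp
  then have "m ^ Suc (multiplicity m (b i)) dvd b i" .
  moreover have "\<not> is_unit m" using m_neq by (auto simp: zdvd1_eq)
  ultimately show ?thesis
    using multiplicity_geI[of "b i" m "Suc (multiplicity m (b i))"] by auto
qed

lemma poly_alpha_eq_0:
  assumes "coeffs_in \<rat> P" "degree P < n" "poly P \<alpha> = 0"
  shows "P = 0"
proof -
  obtain N where N: "N > 0" "coeffs_in \<int> (smult (of_nat N) P)"
    using coeffs_in_Rats_common_denominator[OF assms(1)] by blast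
  then have "\<forall>i. \<exists>c. of_nat N * coeff P i = of_int c"
    unfolding coeffs_in_def by (auto elim!: Ints_cases)
  then obtain c where c: "\<And>i. of_nat N * coeff P i = of_int (c i)" by metis
  have "(\<Sum>i<n. of_int (c i) * \<alpha> ^ i) = of_nat N * poly P \<alpha>"
    unfolding poly_eq_sum_lessThan[OF assms(2)] by (simp flip: c add: sum_distrib_left mult.assoc)
  then have "c i = 0" if "i < n" for i using linear_independence_int[of c] that assms(3) by simp
  then have "coeff P i = 0" if "i < n" for i using c[of i] N(1) that by simp
  then show ?thesis using assms(2) by (metis leading_coeff_0_iff)
qed

lemma degree_radical_poly: "degree (monom 1 n - [:of_int m:] :: complex poly) = n"
  and lead_coeff_radical_poly: "coeff (monom 1 n - [:of_int m:] :: complex poly) n = 1"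
proof -
  show 1: "coeff (monom 1 n - [:of_int m:] :: complex poly) n = 1"
    using n_pos by (simp add: coeff_pCons split: nat.split)
  show "degree (monom 1 n - [:of_int m:] :: complex poly) = n"
  proof (rule antisym)
    show "degree (monom 1 n - [:of_int m:] :: complex poly) \<le> n"
      by (rule degree_diff_le) (simp_all add: degree_monom_le)
  qed (use 1 in \<open>auto intro: le_degree\<close>)
qed

text \<open>This replaces both Galois conjugation and continuity of roots. If \<open>g\<close> is
  monic over the integers with \<open>g (P \<alpha>) = 0\<close>, then \<open>X ^ n - m\<close>
  divides \<open>g \<circ> P\<close>, since the remainder has degree below \<open>n\<close> and
  vanishes at \<alpha>. The quotient has coefficients in \<open>Z[1/N]\<close>, and \<open>l\<close>
  is the exponent that clears its denominators; then \<open>g (P \<beta>)\<close> is integral, hence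
  so is \<open>P \<beta>\<close>.\<close>

lemma algebraic_int_transfer:
  assumes N: "N > 0" and P: "coeffs_in (localize N \<int>) P" and int: "algebraic_int (poly P \<alpha>)"
  obtains l where "\<And>\<beta> :: complex. algebraic_int \<beta> \<Longrightarrow> algebraic_int ((\<beta> ^ n - of_int m) / of_nat N ^ l)
    \<Longrightarrow> algebraic_int (poly P \<beta>)"
proof -
  define S where "S = localize N \<int>"
  have S: "is_subring S" unfolding S_def by (intro is_subring_localize is_subring_Ints)
  have ZS: "\<int> \<subseteq> S" unfolding S_def by (rule subset_localize)
  have SQ: "S \<subseteq> \<rat>"
  proof
    fix x assume "x \<in> S"
    then obtain l where "of_nat N ^ l * x \<in> \<int>" unfolding S_def localize_def by auto
    moreover have "x = (of_nat N ^ l * x) / of_nat (N ^ l)" using N by simp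
    ultimately show "x \<in> \<rat>" by (metis Ints_subset_Rats Rats_divide Rats_of_nat subsetD)
  qed
  obtain g :: "complex poly" where g: "lead_coeff g = 1" "coeffs_in \<int> g" "poly g (poly P \<alpha>) = 0"
    using int by (auto simp: algebraic_int.simps coeffs_in_def)
  have g0: "degree g > 0"
  proof (rule Nat.gr0I)
    assume "degree g = 0"
    then obtain u where "g = [:u:]" by (elim degree_eq_zeroE)
    with g show False by simp
  qed
  define G where "G = (monom 1 n - [:of_int m:] :: complex poly)"
  have "coeffs_in S (pcompose g P)"
    using g(2) P ZS by (intro coeffs_in_closed(4)[OF S]) (auto simp: S_def intro: coeffs_in_mono)
  moreover have "coeffs_in S G"
    unfolding G_def using is_subringD[OF S] by (intro coeffs_in_closed[OF S])
  moreover have "degree G = n" "lead_coeff G = 1"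
    unfolding G_def degree_radical_poly by (rule refl lead_coeff_radical_poly)+
  ultimately obtain Q R where QR: "coeffs_in S Q" "coeffs_in S R" "pcompose g P = Q * G + R"
    "degree R < n"
    using coeffs_in_division[OF S, of G "pcompose g P"] n_pos by auto
  have Gval: "poly G x = x ^ n - of_int m" for x by (simp add: G_def poly_monom)
  have "poly R \<alpha> = poly (pcompose g P) \<alpha> - poly Q \<alpha> * poly G \<alpha>" by (simp add: QR(3))
  then have "poly R \<alpha> = 0" using g(3) by (simp add: poly_pcompose Gval root)
  then have "R = 0"
    using poly_alpha_eq_0[OF coeffs_in_mono[OF QR(2) SQ] QR(4)] by simp
  obtain l where l: "coeffs_in \<int> (smult (of_nat N ^ l) Q)"
    using coeffs_in_localize_common[OF is_subring_Ints] QR(1) unfolding S_def by blast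
  show ?thesis
  proof (rule that[of l])
    fix \<beta> :: complex assume \<beta>: "algebraic_int \<beta>" "algebraic_int ((\<beta> ^ n - of_int m) / of_nat N ^ l)"
    have "poly g (poly P \<beta>) = poly (smult (of_nat N ^ l) Q) \<beta> * ((\<beta> ^ n - of_int m) / of_nat N ^ l)"
      using N QR(3) \<open>R = 0\<close> by (simp flip: poly_pcompose add: Gval)
    moreover have "algebraic_int (poly (smult (of_nat N ^ l) Q) \<beta>)"
      using l Ints_subset_algebraic_int \<beta>(1) by (rule algebraic_int_poly)
    ultimately have "algebraic_int (poly g (poly P \<beta>))" using \<beta>(2) algebraic_int_closed(2) by metis
    then show "algebraic_int (poly P \<beta>)"
      by (rule algebraic_int_root[OF _ refl]) (use g g0 in \<open>auto simp: coeffs_in_def\<close>)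
  qed
qed

end

section \<open>Traces and the denominators of integral elements\<close>

text \<open>A geometric sum. The range \<open>d < 2 * n\<close> fits the exponents
  \<open>n - i + j\<close> with \<open>i, j < n\<close>, among which \<open>n\<close> is the only
  multiple of \<open>n\<close>.\<close>

lemma sum_powers_root_of_unity:
  assumes "n > 0" "0 < d" "d < 2 * n" "d \<noteq> n"
  shows "(\<Sum>l<n. (cis (2 * pi / real n) ^ l) ^ d) = 0"
proof -
  define \<zeta> where "\<zeta> = cis (2 * pi / real n)"
  have \<zeta>: "\<zeta> ^ l = cis (2 * pi * real l / real n)" for l
    unfolding \<zeta>_def DeMoivre by (simp add: mult_ac)
  have inj: "inj_on (\<lambda>k. cis (2 * pi * real k / real n)) {..<n}"
    using bij_betw_roots_unity[OF assms(1)] by (simp add: bij_betw_def)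
  have \<zeta>n: "\<zeta> ^ n = 1" using \<zeta>[of n] assms(1) by (simp add: complex_eq_iff)
  have "\<zeta> ^ d = \<zeta> ^ (d mod n)"
  proof -
    have "\<zeta> ^ d = \<zeta> ^ (n * (d div n) + d mod n)" by simp
    also have "\<dots> = (\<zeta> ^ n) ^ (d div n) * \<zeta> ^ (d mod n)" by (simp only: power_add power_mult)
    finally show ?thesis using \<zeta>n by simp
  qed
  moreover have "d mod n \<noteq> 0"
  proof
    assume "d mod n = 0"
    then obtain q where "d = n * q" by (metis mod_0_imp_dvd dvdE)
    then have "q < 2" "q \<noteq> 0" "q \<noteq> 1" using assms by auto
    then show False by linarith
  qed
  then have "\<zeta> ^ (d mod n) \<noteq> \<zeta> ^ 0"
    unfolding \<zeta> using inj_onD[OF inj, of "d mod n" 0] assms(1) by auto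
  ultimately have ne: "\<zeta> ^ d \<noteq> 1" by simp
  have "(1 - \<zeta> ^ d) * (\<Sum>l<n. (\<zeta> ^ d) ^ l) = 1 - (\<zeta> ^ d) ^ n"
    by (simp add: one_diff_power_eq)
  also have "(\<zeta> ^ d) ^ n = 1" by (metis \<zeta>n power_mult mult.commute power_one)
  finally have "(\<Sum>l<n. (\<zeta> ^ d) ^ l) = 0" using ne by simp
  then show ?thesis by (simp add: \<zeta>_def flip: power_mult add: mult.commute)
qed

context radical_root
begin

text \<open>The trace of \<open>\<alpha> ^ (n - i) * poly P \<alpha>\<close> is \<open>n * m * coeff P i\<close>.\<close>
lemma trace_integral:
  assumes P: "coeffs_in \<rat> P" "degree P < n" "algebraic_int (poly P \<alpha>)" and i: "i < n"
  shows "of_nat n * of_int m * coeff P i \<in> \<int>"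
proof -
  define \<zeta> where "\<zeta> = cis (2 * pi / real n)"
  have \<zeta>n: "\<zeta> ^ n = 1"
    unfolding \<zeta>_def DeMoivre using n_pos by (simp add: complex_eq_iff)
  obtain N where N: "N > 0" "coeffs_in \<int> (smult (of_nat N) P)"
    using coeffs_in_Rats_common_denominator[OF P(1)] by blast
  have "coeffs_in (localize N \<int>) P"
    unfolding coeffs_in_def localize_def
    using coeffs_inD[OF N(2)] by (auto intro!: exI[of _ 1])
  then obtain L where L: "\<And>\<beta> :: complex. algebraic_int \<beta> \<Longrightarrow>
      algebraic_int ((\<beta> ^ n - of_int m) / of_nat N ^ L) \<Longrightarrow> algebraic_int (poly P \<beta>)"
    using algebraic_int_transfer[OF N(1) _ P(3)] by blast
  have \<zeta>int: "algebraic_int \<zeta>"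
    by (rule algebraic_int_root[where p = "monom 1 n" and y = 1])
      (use \<zeta>n n_pos in \<open>auto simp: poly_monom degree_monom_eq\<close>)
  \<comment> \<open>These are the conjugates of \<alpha>. As \<open>\<beta> l ^ n - m = 0\<close>,
    the condition in \<open>L\<close> is trivial and \<open>P\<close> is integral at each of them;
    the sum formed below is a trace.\<close>
  define \<beta> where "\<beta> l = \<zeta> ^ l * \<alpha>" for l
  have \<beta>int: "algebraic_int (\<beta> l)" for l
    unfolding \<beta>_def using \<zeta>int algebraic_int_alpha by (intro algebraic_int_closed)
  have "\<beta> l ^ n = of_int m" for l
    unfolding \<beta>_def power_mult_distrib root
    by (metis \<zeta>n mult.commute mult_1 power_mult power_one)
  then have "algebraic_int (poly P (\<beta> l))" for l
    using L[OF \<beta>int] by simp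
  then have "algebraic_int (\<Sum>l<n. \<beta> l ^ (n - i) * poly P (\<beta> l))"
    using \<beta>int by (intro algebraic_int_closed)
  also have "(\<Sum>l<n. \<beta> l ^ (n - i) * poly P (\<beta> l))
    = (\<Sum>l<n. \<Sum>j<n. coeff P j * \<alpha> ^ (n - i + j) * (\<zeta> ^ l) ^ (n - i + j))"
    unfolding poly_eq_sum_lessThan[OF P(2)] sum_distrib_left \<beta>_def
    by (intro sum.cong refl) (simp add: power_add power_mult_distrib mult_ac)
  also have "\<dots> = (\<Sum>j<n. coeff P j * \<alpha> ^ (n - i + j) * (\<Sum>l<n. (\<zeta> ^ l) ^ (n - i + j)))"
    by (subst sum.swap) (simp add: sum_distrib_left)
  also have "\<dots> = (\<Sum>j<n. if j = i then of_nat n * of_int m * coeff P i else 0)"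
  proof (intro sum.cong refl)
    fix j assume "j \<in> {..<n}"
    then have j: "j < n" by simp
    show "coeff P j * \<alpha> ^ (n - i + j) * (\<Sum>l<n. (\<zeta> ^ l) ^ (n - i + j))
      = (if j = i then of_nat n * of_int m * coeff P i else 0)"
    proof (cases "j = i")
      case True
      have "(\<zeta> ^ l) ^ n = 1" for l by (metis \<zeta>n mult.commute power_mult power_one)
      then show ?thesis using i True root by simp
    next
      case False
      have "(\<Sum>l<n. (\<zeta> ^ l) ^ (n - i + j)) = 0"
        unfolding \<zeta>_def by (rule sum_powers_root_of_unity) (use i j False in auto)
      then show ?thesis using False by simp
    qed
  qed
  also have "\<dots> = of_nat n * of_int m * coeff P i" using i by simp
  finally have *: "algebraic_int (of_nat n * of_int m * coeff P i)" .
  show ?thesis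
    by (rule rational_algebraic_int_is_int[OF *])
      (use coeffs_inD[OF P(1)] in \<open>auto intro!: Rats_mult\<close>)
qed

text \<open>The trace bounds denominators by \<open>n * m\<close>, and
  \<open>dvd_coefficients\<close> removes the factor \<open>m\<close>. For \<open>n = p ^ k\<close>
  only powers of \<open>p\<close> remain.\<close>

lemma denominator_dvd_degree:
  assumes P: "coeffs_in \<rat> P" "degree P < n" "algebraic_int (poly P \<alpha>)"
  shows "coeffs_in \<int> (smult (of_nat n) P)"
proof -
  have "\<exists>c. of_nat n * of_int m * coeff P i = of_int c" if "i < n" for i
    using trace_integral[OF P that] by (auto elim!: Ints_cases)
  then obtain c where c: "\<And>i. i < n \<Longrightarrow> of_nat n * of_int m * coeff P i = of_int (c i)" by metis
  have "(\<Sum>i<n. of_int (c i) * \<alpha> ^ i) / of_int m = of_nat n * poly P \<alpha>"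
    unfolding poly_eq_sum_lessThan[OF P(2)] sum_divide_distrib sum_distrib_left
    by (intro sum.cong refl) (use m_nonzero in \<open>simp flip: c\<close>)
  then have "algebraic_int ((\<Sum>i<n. of_int (c i) * \<alpha> ^ i) / of_int m)"
    using algebraic_int_closed(2)[OF algebraic_int_of_nat P(3)] by simp
  then have dvd: "m dvd c i" if "i < n" for i using dvd_coefficients that by blast
  show ?thesis unfolding coeffs_in_def coeff_smult
  proof
    fix i
    show "of_nat n * coeff P i \<in> \<int>"
    proof (cases "i < n")
      case True
      obtain b where "c i = m * b" using dvd[OF True] ..
      then have "of_int m * (of_nat n * coeff P i) = of_int m * of_int b"
        using c[OF True] by (simp add: mult_ac)
      then have "of_nat n * coeff P i = of_int b" using m_nonzero by simp
      then show ?thesis by simp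
    next
      case False
      then have "coeff P i = 0" using P(2) by (simp add: coeff_eq_0)
      then show ?thesis by simp
    qed
  qed
qed

end

section \<open>Local analysis at a prime\<close>

text \<open>Every mixed binomial term is divisible by \<open>p\<close> and by \<open>y\<close>. The
  factor \<open>y\<close> is kept in the error term because it will be a uniformizer, which makes
  the error smaller than \<open>p\<close>.\<close>

lemma frobenius_mod_prime_basic:
  fixes x y :: complex
  assumes "prime p" "algebraic_int x" "algebraic_int y"
  obtains z where "algebraic_int z" "(x + y) ^ p = x ^ p + y ^ p + of_nat p * y * z"
proof -
  define z where "z = (\<Sum>i\<in>{1..<p}. of_nat ((p choose i) div p) * x ^ (p - i) * y ^ (i - 1))"
  have p: "p > 1" using assms(1) prime_gt_1_nat by blast
  have "algebraic_int z" unfolding z_def using assms by (intro algebraic_int_closed) auto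
  moreover have "(x + y) ^ p = x ^ p + y ^ p + of_nat p * y * z"
  proof -
    have "(x + y) ^ p = (\<Sum>i\<le>p. of_nat (p choose i) * y ^ i * x ^ (p - i))"
      by (subst add.commute) (rule binomial_ring)
    also have "{..p} = insert 0 (insert p {1..<p})" using p by auto
    also have "(\<Sum>i\<in>\<dots>. of_nat (p choose i) * y ^ i * x ^ (p - i))
      = x ^ p + y ^ p + (\<Sum>i\<in>{1..<p}. of_nat (p choose i) * y ^ i * x ^ (p - i))"
      using p by simp
    also have "(\<Sum>i\<in>{1..<p}. of_nat (p choose i) * y ^ i * x ^ (p - i)) = of_nat p * y * z"
      unfolding z_def sum_distrib_left
    proof (intro sum.cong refl)
      fix i assume i: "i \<in> {1..<p}"
      then have "p dvd p choose i" using assms(1) by (intro dvd_choose_prime) auto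
      then have "(p choose i) = p * ((p choose i) div p)" by simp
      then have "of_nat (p choose i) = (of_nat p * of_nat ((p choose i) div p) :: complex)"
        by (metis of_nat_mult)
      moreover have "y ^ i = y * y ^ (i - 1)" using i by (cases i) auto
      ultimately show "of_nat (p choose i) * y ^ i * x ^ (p - i)
        = of_nat p * y * (of_nat ((p choose i) div p) * x ^ (p - i) * y ^ (i - 1))" by simp
    qed
    finally show ?thesis .
  qed
  ultimately show ?thesis using that by blast
qed

lemma frobenius_mod_prime:
  fixes x y :: complex
  assumes p: "prime p" and xy: "algebraic_int x" "algebraic_int y"
  obtains z where "algebraic_int z" "(x + y) ^ (p ^ f) = x ^ (p ^ f) + y ^ (p ^ f) + of_nat p * y * z"
proof -
  have "\<exists>z. algebraic_int z \<and> (x + y) ^ (p ^ f) = x ^ (p ^ f) + y ^ (p ^ f) + of_nat p * y * z"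
  proof (induction f)
    case 0
    show ?case by (intro exI[of _ 0]) auto
  next
    case (Suc f)
    then obtain z where z: "algebraic_int z"
      "(x + y) ^ (p ^ f) = x ^ (p ^ f) + y ^ (p ^ f) + of_nat p * y * z" by blast
    have p0: "p > 0" using p prime_gt_0_nat by blast
    \<comment> \<open>By the choice of \<open>W\<close>, \<open>y * W = Y + p * y * z\<close>
      gathers everything divisible by \<open>y\<close>. The basic congruence is applied to
      \<open>X + y * W\<close>, and then once more to split the power of
      \<open>Y + p * y * z\<close>.\<close>
    define X Y W where "X = x ^ (p ^ f)" and "Y = y ^ (p ^ f)" and "W = y ^ (p ^ f - 1) + of_nat p * z"
    have int: "algebraic_int X" "algebraic_int Y" "algebraic_int W" "algebraic_int (of_nat p * y * z)"
      unfolding X_def Y_def W_def using xy z(1) by (auto intro!: algebraic_int_closed)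
    have yW: "y * W = Y + of_nat p * y * z"
      using p0 by (simp add: W_def Y_def distrib_left power_eq_if[of y "p ^ f"] algebra_simps)
    obtain z2 where z2: "algebraic_int z2" "(X + y * W) ^ p = X ^ p + (y * W) ^ p + of_nat p * (y * W) * z2"
      using frobenius_mod_prime_basic[OF p int(1), of "y * W"] xy int(3) algebraic_int_closed(2) by blast
    obtain z3 where z3: "algebraic_int z3" "(Y + of_nat p * y * z) ^ p
      = Y ^ p + (of_nat p * y * z) ^ p + of_nat p * (of_nat p * y * z) * z3"
      using frobenius_mod_prime_basic[OF p int(2,4)] by blast
    have "(of_nat p * y * z) ^ p = of_nat p * y * (z * (of_nat p * y * z) ^ (p - 1))"
      using p0 by (simp add: power_eq_if[of "of_nat p * y * z" p])
    then have "(Y + of_nat p * y * z) ^ p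
      = Y ^ p + of_nat p * y * (z * (of_nat p * y * z) ^ (p - 1) + of_nat p * z * z3)"
      unfolding z3(2) by (simp add: distrib_left mult.assoc mult.left_commute)
    moreover have "((x + y) ^ (p ^ f)) ^ p = X ^ p + (Y + of_nat p * y * z) ^ p + of_nat p * y * (W * z2)"
      unfolding z(2) X_def[symmetric] Y_def[symmetric] add.assoc yW[symmetric] z2(2)
      by (simp add: mult.assoc)
    ultimately have "((x + y) ^ (p ^ f)) ^ p = X ^ p + Y ^ p
      + of_nat p * y * (z * (of_nat p * y * z) ^ (p - 1) + of_nat p * z * z3 + W * z2)"
      by (simp add: distrib_left)
    moreover have "algebraic_int (z * (of_nat p * y * z) ^ (p - 1) + of_nat p * z * z3 + W * z2)"
      using z(1) int z2(1) z3(1) by (auto intro!: algebraic_int_closed)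
    moreover have "((x + y) ^ (p ^ f)) ^ p = (x + y) ^ (p ^ Suc f)" "X ^ p = x ^ (p ^ Suc f)"
      "Y ^ p = y ^ (p ^ Suc f)"
      by (simp_all add: X_def Y_def mult.commute flip: power_mult)
    ultimately show ?case by metis
  qed
  then show ?thesis using that by blast
qed

text \<open>Algebraic integers that are topologically nilpotent, respectively units, with respect to
  every place above \<open>p\<close>.\<close>
definition top_nil :: "nat \<Rightarrow> complex \<Rightarrow> bool" where
  "top_nil p x \<longleftrightarrow> algebraic_int x \<and> (\<exists>L. algebraic_int (x ^ L / of_nat p))"

definition unit_at :: "nat \<Rightarrow> complex \<Rightarrow> bool" where
  "unit_at p u \<longleftrightarrow> algebraic_int u \<and> (\<exists>v. algebraic_int v \<and> algebraic_int ((u * v - 1) / of_nat p))"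

lemma unit_atE:
  assumes "unit_at p u" "p > 0"
  obtains v z where "algebraic_int v" "algebraic_int z" "u * v = 1 + of_nat p * z"
proof -
  obtain v where v: "algebraic_int v" "algebraic_int ((u * v - 1) / of_nat p)"
    using assms unfolding unit_at_def by auto
  have "u * v = 1 + of_nat p * ((u * v - 1) / of_nat p)" using assms(2) by simp
  with v show ?thesis by (rule that)
qed

lemma unit_at_algebraic_int: "unit_at p u \<Longrightarrow> algebraic_int u"
  and top_nil_algebraic_int: "top_nil p u \<Longrightarrow> algebraic_int u"
  unfolding unit_at_def top_nil_def by auto

lemma top_nil_mult:
  assumes "top_nil p x" "algebraic_int y"
  shows "top_nil p (x * y)"
proof -
  obtain L where L: "algebraic_int (x ^ L / of_nat p)" using assms unfolding top_nil_def by auto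
  have "(x * y) ^ L / of_nat p = x ^ L / of_nat p * y ^ L" by (simp add: power_mult_distrib)
  then have "algebraic_int ((x * y) ^ L / of_nat p)" using L assms(2) by (metis algebraic_int_closed(2,4))
  then show ?thesis using assms unfolding top_nil_def by (auto intro: algebraic_int_closed)
qed

lemma top_nil_p_mult: "p > 0 \<Longrightarrow> algebraic_int y \<Longrightarrow> top_nil p (of_nat p * y)"
  unfolding top_nil_def by (auto intro!: algebraic_int_closed exI[of _ 1])

lemma top_nil_add:
  assumes "top_nil p x" "top_nil p y"
  shows "top_nil p (x + y)"
proof -
  obtain L K where LK: "algebraic_int (x ^ L / of_nat p)" "algebraic_int (y ^ K / of_nat p)"
    using assms unfolding top_nil_def by auto
  have xy: "algebraic_int x" "algebraic_int y" using assms unfolding top_nil_def by auto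
  have "(x + y) ^ (L + K) / of_nat p
    = (\<Sum>i\<le>L + K. of_nat ((L + K) choose i) * (x ^ i * y ^ (L + K - i) / of_nat p))"
    unfolding binomial_ring by (simp add: sum_divide_distrib mult.assoc)
  also have "algebraic_int \<dots>"
  proof (rule algebraic_int_sum, rule algebraic_int_closed(2)[OF algebraic_int_of_nat])
    fix i assume "i \<in> {..L + K}"
    show "algebraic_int (x ^ i * y ^ (L + K - i) / of_nat p)"
    proof (cases "i \<ge> L")
      case True
      then have "x ^ i * y ^ (L + K - i) / of_nat p = (x ^ L / of_nat p) * (x ^ (i - L) * y ^ (L + K - i))"
        by (simp flip: power_add)
      also have "algebraic_int \<dots>" using LK xy by (intro algebraic_int_closed)
      finally show ?thesis .
    next
      case False
      then have "L + K - i = K + (L - i)" by simp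
      then have "y ^ (L + K - i) = y ^ K * y ^ (L - i)" by (simp only: power_add)
      then have "x ^ i * y ^ (L + K - i) / of_nat p = (y ^ K / of_nat p) * (x ^ i * y ^ (L - i))"
        by simp
      also have "algebraic_int \<dots>" using LK xy by (intro algebraic_int_closed)
      finally show ?thesis .
    qed
  qed
  finally show ?thesis using xy unfolding top_nil_def by (auto intro: algebraic_int_closed)
qed

lemma top_nil_if_power: "top_nil p (x ^ N) \<Longrightarrow> algebraic_int x \<Longrightarrow> top_nil p x"
  unfolding top_nil_def by (auto simp flip: power_mult)

lemma unit_at_of_unit_mult:
  assumes "unit_at p (u * w)" "algebraic_int u" "algebraic_int w"
  shows "unit_at p u"
proof -
  obtain v where "algebraic_int v" "algebraic_int ((u * w * v - 1) / of_nat p)"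
    using assms unfolding unit_at_def by auto
  then show ?thesis unfolding unit_at_def using assms
    by (auto intro!: exI[of _ "w * v"] algebraic_int_closed simp: mult.assoc)
qed

text \<open>The geometric series, cut off at the power of \<open>y\<close> that is divisible by
  \<open>p\<close>, inverts \<open>1 + y\<close> modulo \<open>p\<close>.\<close>

lemma unit_at_1_plus_top_nil:
  assumes "top_nil p y"
  shows "unit_at p (1 + y)"
proof -
  obtain L where L: "algebraic_int (y ^ L / of_nat p)" and y: "algebraic_int y"
    using assms unfolding top_nil_def by auto
  have "(1 + y) * (\<Sum>i<L. (- y) ^ i) = 1 - (- y) ^ L"
    using one_diff_power_eq[of "- y" L] by simp
  then have "((1 + y) * (\<Sum>i<L. (- y) ^ i) - 1) / of_nat p = - ((- 1) ^ L * (y ^ L / of_nat p))"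
    by (simp add: power_minus[of y])
  also have "algebraic_int \<dots>" using L by (intro algebraic_int_closed) auto
  finally have "algebraic_int (((1 + y) * (\<Sum>i<L. (- y) ^ i) - 1) / of_nat p)" .
  moreover have "algebraic_int (\<Sum>i<L. (- y) ^ i)" "algebraic_int (1 + y)"
    using y by (auto intro!: algebraic_int_closed)
  ultimately show ?thesis unfolding unit_at_def by blast
qed

lemma unit_at_add_top_nil:
  assumes p: "p > 0" and u: "unit_at p u" and x: "top_nil p x"
  shows "unit_at p (u + x)"
proof -
  obtain v z where v: "algebraic_int v" "algebraic_int z" "u * v = 1 + of_nat p * z"
    using unit_atE[OF u p] .
  have "(u + x) * v = 1 + (of_nat p * z + x * v)"
    using v(3) by (simp add: algebra_simps)
  moreover have "top_nil p (of_nat p * z + x * v)"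
    by (intro top_nil_add top_nil_p_mult p v top_nil_mult x)
  ultimately have "unit_at p ((u + x) * v)" using unit_at_1_plus_top_nil by metis
  moreover have "algebraic_int (u + x)"
    using u x unfolding unit_at_def top_nil_def by (auto intro: algebraic_int_closed)
  ultimately show ?thesis using v unit_at_of_unit_mult by blast
qed

lemma unit_at_minus: "unit_at p u \<Longrightarrow> unit_at p (- u)"
  unfolding unit_at_def by (metis algebraic_int_minus minus_mult_minus)

lemma unit_at_1: "unit_at p 1"
  unfolding unit_at_def by (auto intro!: exI[of _ 1])

lemma unit_at_mult:
  assumes p: "p > 0" and "unit_at p u" "unit_at p w"
  shows "unit_at p (u * w)"
proof -
  obtain v z where v: "algebraic_int v" "algebraic_int z" "u * v = 1 + of_nat p * z"
    using unit_atE[OF assms(2) p] .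
  have ints: "algebraic_int u" "algebraic_int w" using assms unit_at_algebraic_int by auto
  have "u * w * v = w * (u * v)" by simp
  then have "u * w * v = w + of_nat p * (w * z)"
    unfolding v(3) by (simp add: algebra_simps)
  moreover have "unit_at p (w + of_nat p * (w * z))"
    by (intro unit_at_add_top_nil p assms(3) top_nil_p_mult algebraic_int_closed ints v)
  ultimately have "unit_at p (u * w * v)" by simp
  then show ?thesis using unit_at_of_unit_mult v(1) ints algebraic_int_closed(2) by blast
qed

lemma unit_at_power: "p > 0 \<Longrightarrow> unit_at p u \<Longrightarrow> unit_at p (u ^ i)"
  by (induction i) (auto intro: unit_at_1 unit_at_mult)

lemma unit_at_of_int:
  assumes "prime p" "\<not> int p dvd a"
  shows "unit_at p (of_int a)"
proof -
  have "coprime (int p) a" using assms by (simp add: prime_imp_coprime)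
  then have "[a * fst (bezout_coefficients a (int p)) = 1] (mod int p)"
    using bezout_coefficients_fst_snd[of a "int p"]
    by (metis bezout_coefficients coprime_iff_gcd_eq_1 cong_iff_lin coprime_commute mult.commute add.commute)
  then obtain v where "int p dvd a * v - 1" by (auto simp: cong_iff_dvd_diff)
  then obtain z where "a * v - 1 = int p * z" ..
  then have "(of_int a * of_int v - 1 :: complex) = of_nat p * of_int z"
    by (metis of_int_1 of_int_diff of_int_mult of_int_of_nat_eq)
  moreover have "p \<noteq> 0" using assms(1) by auto
  ultimately show ?thesis unfolding unit_at_def by (auto intro!: exI[of _ "of_int v"])
qed

text \<open>From the exponent 2 on, each correction term carries a factor \<delta> or a second
  factor \<open>p\<close>. For exponent 1 the correction is \<open>- p * w\<close>, with nothing
  small besides \<open>p\<close>; since the lemma is applied with \<open>k = p - 1\<close>, the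
  prime 2 has to be treated apart.\<close>

lemma power_add_p_mult_top_nil:
  assumes p: "p > 0" and \<delta>: "top_nil p \<delta>" and w: "algebraic_int w" and k: "k \<ge> 2"
  obtains t where "top_nil p t" "(\<delta> - of_nat p * w) ^ k = \<delta> ^ k + of_nat p * t"
proof -
  have \<delta>i: "algebraic_int \<delta>" using \<delta> by (rule top_nil_algebraic_int)
  have "\<exists>t. top_nil p t \<and> (\<delta> - of_nat p * w) ^ k = \<delta> ^ k + of_nat p * t"
    using k
  proof (induction k rule: dec_induct)
    case base
    have "top_nil p (\<delta> * (- 2 * w) + of_nat p * (w * w))"
      using w by (intro top_nil_add top_nil_mult \<delta> top_nil_p_mult p algebraic_int_closed) auto
    moreover have "(\<delta> - of_nat p * w) ^ 2 = \<delta> ^ 2 + of_nat p * (\<delta> * (- 2 * w) + of_nat p * (w * w))"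
      by (simp add: power2_eq_square algebra_simps)
    ultimately show ?case by blast
  next
    case (step k)
    then obtain t where t: "top_nil p t" "(\<delta> - of_nat p * w) ^ k = \<delta> ^ k + of_nat p * t" by blast
    have "\<delta> ^ k = \<delta> * \<delta> ^ (k - 1)" using step by (simp add: power_eq_if)
    then have "(\<delta> - of_nat p * w) ^ Suc k
      = \<delta> ^ Suc k + of_nat p * (\<delta> * (t - \<delta> ^ (k - 1) * w) + of_nat p * (- t * w))"
      using t(2) by (simp add: algebra_simps)
    moreover have "top_nil p (\<delta> * (t - \<delta> ^ (k - 1) * w) + of_nat p * (- t * w))"
      using w \<delta>i top_nil_algebraic_int[OF t(1)]
      by (intro top_nil_add top_nil_mult \<delta> top_nil_p_mult p algebraic_int_closed)
    ultimately show ?case by blast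
  qed
  then show ?thesis using that by blast
qed

text \<open>The condition \<open>radical\<close> with \<open>N = 1\<close> says that
  \<open>D\<close> has no integral denominators at \<open>p\<close>, and for larger \<open>N\<close>
  that \<open>p\<close> is unramified in \<open>D\<close>: the quotient \<open>D / p D\<close> has
  no nilpotents. So \<open>p\<close> itself serves as the uniformizer of the base ring.\<close>

locale coefficient_ring =
  fixes p :: nat and D :: "complex set"
  assumes prime_p: "prime p" and subring: "is_subring D"
    and integral: "D \<subseteq> {x. algebraic_int x}"
    and radical: "\<And>b N. b \<in> D \<Longrightarrow> algebraic_int (b ^ N / of_nat p) \<Longrightarrow> b / of_nat p \<in> D"
begin

section \<open>Uniformizers and \<open>p\<close>-maximal orders\<close>

lemma p_gt_1: "p > 1" and p_pos: "p > 0"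
  using prime_p prime_gt_1_nat prime_gt_0_nat by auto

lemma integralD: "x \<in> D \<Longrightarrow> algebraic_int x"
  using integral by auto

text \<open>After \<open>isolate_coefficient\<close> the number
  \<open>y = b i * \<pi> ^ (E - 1) / p\<close> is integral, and \<open>y * \<pi> = b i * u\<close>.
  Taking \<open>E\<close>-th powers and inverting \<open>u\<close> modulo \<open>p\<close> shows
  that \<open>p\<close> divides \<open>b i ^ E\<close>; then \<open>radical\<close> divides
  \<open>b i\<close> itself by \<open>p\<close> inside \<open>D\<close>.\<close>

lemma uniformizer_expansion_dvd:
  assumes \<pi>: "algebraic_int \<pi>" "\<pi> ^ E = of_nat p * u" "unit_at p u"
    and b: "\<And>i. i < E \<Longrightarrow> b i \<in> D" and sum: "algebraic_int ((\<Sum>i<E. b i * \<pi> ^ i) / of_nat p)"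
    and "i < E"
  shows "b i / of_nat p \<in> D"
  using \<open>i < E\<close>
proof (induction i rule: less_induct)
  case (less i)
  obtain v z where v: "algebraic_int v" "algebraic_int z" "u * v = 1 + of_nat p * z"
    using unit_atE[OF \<pi>(3) p_pos] .
  define y where "y = b i * \<pi> ^ (E - 1) / of_nat p"
  have u: "algebraic_int u" by (rule unit_at_algebraic_int[OF \<pi>(3)])
  have bi: "algebraic_int (b i)" using b integralD less(2) by blast
  have y: "algebraic_int y"
    unfolding y_def
  proof (rule isolate_coefficient[OF _ \<pi>(1) _ _ sum less(2)])
    show "algebraic_int (\<pi> ^ E / of_nat p)" using \<pi>(2) u p_pos by simp
    show "algebraic_int (b j / of_nat p)" if "j < i" for j
      using less that by (intro integralD) auto
  qed (use b integralD p_pos in auto)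
  have "y * \<pi> = b i * \<pi> ^ E / of_nat p"
    unfolding y_def using less(2) by (simp add: power_eq_if[of \<pi> E])
  then have "y * \<pi> = b i * u" using \<pi>(2) p_pos by simp
  then have "b i * (1 + of_nat p * z) = y * \<pi> * v" by (simp flip: v(3) add: mult.assoc)
  then have "b i ^ E * (1 + of_nat p * z) ^ E = y ^ E * (of_nat p * u) * v ^ E"
    by (metis \<pi>(2) power_mult_distrib)
  moreover obtain z' where z': "algebraic_int z'" "(1 + of_nat p * z) ^ E = 1 + of_nat p * z'"
  proof -
    have "\<exists>z'. algebraic_int z' \<and> (1 + of_nat p * z) ^ E = 1 + of_nat p * z'"
    proof (induction E)
      case 0
      then show ?case by (intro exI[of _ 0]) simp
    next
      case (Suc E)
      then obtain z' where z': "algebraic_int z'" "(1 + of_nat p * z) ^ E = 1 + of_nat p * z'" by blast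
      have "(1 + of_nat p * z) ^ Suc E = 1 + of_nat p * (z + z' + of_nat p * z * z')"
        using z'(2) by (simp add: algebra_simps)
      moreover have "algebraic_int (z + z' + of_nat p * z * z')"
        using z'(1) v(2) by (intro algebraic_int_closed) auto
      ultimately show ?case by blast
    qed
    then show ?thesis using that by blast
  qed
  ultimately have "b i ^ E / of_nat p = y ^ E * u * v ^ E - b i ^ E * z'"
    using p_pos by (simp add: field_simps)
  moreover have "algebraic_int (y ^ E * u * v ^ E - b i ^ E * z')"
    using y u v(1) bi z'(1) by (intro algebraic_int_closed)
  ultimately have "algebraic_int (b i ^ E / of_nat p)" by simp
  then show ?case using radical b less(2) by blast
qed

text \<open>If \<open>E\<close> is the degree of \<beta> over \<open>D\<close>, this is
  \<open>p\<close>-maximality of the order \<open>D[\<beta>]\<close>. It is phrased through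
  polynomials of degree below \<open>E\<close>, so that neither a field nor an index has to be
  formed.\<close>

definition maximal_at :: "complex \<Rightarrow> nat \<Rightarrow> bool" where
  "maximal_at \<beta> E \<longleftrightarrow> (\<forall>R. coeffs_in (localize p D) R \<longrightarrow> degree R < E \<longrightarrow>
     algebraic_int (poly R \<beta>) \<longrightarrow> coeffs_in D R)"

text \<open>Since \<open>c0\<close> lies in \<open>D\<close>, a polynomial can be rewritten in
  powers of \<open>\<pi> = \<beta> - c0\<close> and back without leaving \<open>D\<close>. In powers
  of \<pi> the preceding expansion lemma removes one factor \<open>p\<close> of the denominator at a
  time.\<close>

lemma maximal_at_uniformizer:
  assumes "algebraic_int \<beta>" "c0 \<in> D" "(\<beta> - c0) ^ E = of_nat p * u" "unit_at p u"
  shows "maximal_at \<beta> E"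
  unfolding maximal_at_def
proof (intro allI impI)
  fix R assume R: "coeffs_in (localize p D) R" "degree R < E" "algebraic_int (poly R \<beta>)"
  define \<pi> where "\<pi> = \<beta> - c0"
  have \<pi>: "algebraic_int \<pi>" unfolding \<pi>_def using assms integralD by (auto intro: algebraic_int_closed)
  have shift: "coeffs_in D (pcompose Q [:a, 1:])" if "coeffs_in D Q" "a \<in> D" for Q a
  proof (rule coeffs_in_closed(4)[OF subring that(1)])
    show "coeffs_in D [:a, 1:]"
      using that(2) is_subringD[OF subring] by (auto simp: coeffs_in_def coeff_pCons split: nat.split)
  qed
  obtain l where l: "coeffs_in D (smult (of_nat p ^ l) R)"
    using coeffs_in_localize_common[OF subring R(1)] by blast
  then show "coeffs_in D R"
  proof (induction l)
    case (Suc l)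
    define B where "B = smult (of_nat p ^ Suc l) R"
    define B' where "B' = pcompose B [:c0, 1:]"
    have B': "coeffs_in D B'" unfolding B'_def B_def by (intro shift Suc(2) assms(2))
    have deg: "degree B' < E"
      using degree_pcompose[of B "[:c0, 1:]"] R(2) p_pos by (simp add: B'_def B_def)
    have "poly B' \<pi> = poly B \<beta>" by (simp add: B'_def \<pi>_def poly_pcompose)
    also have "\<dots> / of_nat p = of_nat p ^ l * poly R \<beta>" using p_pos by (simp add: B_def)
    finally have "algebraic_int (poly B' \<pi> / of_nat p)"
      using R(3) by (metis algebraic_int_closed(2) algebraic_int_of_nat of_nat_power)
    then have *: "algebraic_int ((\<Sum>i<E. coeff B' i * \<pi> ^ i) / of_nat p)"
      unfolding poly_eq_sum_lessThan[OF deg] .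
    have "coeff B' i / of_nat p \<in> D" for i
    proof (cases "i < E")
      case True
      show ?thesis
        by (rule uniformizer_expansion_dvd[OF \<pi> _ assms(4) _ * True])
          (use assms(3) coeffs_inD[OF B'] in \<open>auto simp: \<pi>_def\<close>)
    next
      case False
      then show ?thesis using deg is_subringD(1)[OF subring] by (simp add: coeff_eq_0)
    qed
    then have "coeffs_in D (smult (1 / of_nat p) B')" by (simp add: coeffs_in_def)
    then have "coeffs_in D (pcompose (smult (1 / of_nat p) B') [:- c0, 1:])"
      using is_subringD(3)[OF subring assms(2)] by (rule shift)
    moreover have "pcompose (smult (1 / of_nat p) B') [:- c0, 1:] = smult (of_nat p ^ l) R"
    proof -
      have "pcompose B' [:- c0, 1:] = B"
        unfolding B'_def by (simp add: pcompose_assoc[symmetric] pcompose_pCons)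
      then show ?thesis using p_pos by (simp add: pcompose_smult B_def)
    qed
    ultimately show ?case using Suc(1) by simp
  qed simp
qed

text \<open>The centre \<open>\<beta> - p\<close> makes the uniformizer equal to
  \<open>p\<close>.\<close>

lemma maximal_at_center:
  assumes "\<beta> \<in> D"
  shows "maximal_at \<beta> 1"
proof (rule maximal_at_uniformizer)
  show "\<beta> - of_nat p \<in> D" using is_subringD[OF subring] assms by auto
  show "(\<beta> - (\<beta> - of_nat p)) ^ 1 = of_nat p * 1" by simp
qed (use assms integralD unit_at_1 in auto)

text \<open>\<open>X ^ (p ^ f) - c\<close> becomes Eisenstein when translated by \<open>c\<close>:
  with \<open>\<pi> = \<beta> - c\<close> the Frobenius congruence gives
  \<open>\<pi> ^ (p ^ f) = p * (u - \<pi> * z)\<close>. Hence \<pi> is topologically nilpotent and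
  the bracket is a unit.\<close>

lemma maximal_at_root:
  assumes \<beta>: "algebraic_int \<beta>" "\<beta> ^ (p ^ f) = c" and c: "c \<in> D"
    and u: "c - c ^ (p ^ f) = of_nat p * u" "unit_at p u"
  shows "maximal_at \<beta> (p ^ f)"
proof -
  define \<pi> where "\<pi> = \<beta> - c"
  have \<pi>: "algebraic_int \<pi>" unfolding \<pi>_def using \<beta> c integralD by (auto intro: algebraic_int_closed)
  obtain z where z: "algebraic_int z" "(c + \<pi>) ^ (p ^ f) = c ^ (p ^ f) + \<pi> ^ (p ^ f) + of_nat p * \<pi> * z"
    using frobenius_mod_prime[OF prime_p _ \<pi>] c integralD by blast
  have eq: "\<pi> ^ (p ^ f) = of_nat p * (u + \<pi> * (- z))"
  proof -
    have "c + \<pi> = \<beta>" by (simp add: \<pi>_def)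
    then have "\<pi> ^ (p ^ f) = (c - c ^ (p ^ f)) - of_nat p * \<pi> * z"
      using z(2) \<beta>(2) by (simp add: algebra_simps)
    then show ?thesis unfolding u(1) by (simp add: algebra_simps)
  qed
  have "top_nil p (\<pi> ^ (p ^ f))"
    unfolding eq using u(2) \<pi> z(1) unit_at_algebraic_int
    by (intro top_nil_p_mult p_pos algebraic_int_closed)
  then have "top_nil p \<pi>" using \<pi> top_nil_if_power by blast
  then have "unit_at p (u + \<pi> * (- z))"
    using z(1) by (intro unit_at_add_top_nil p_pos u(2) top_nil_mult) auto
  then show ?thesis
    using maximal_at_uniformizer[OF \<beta>(1) c] eq unfolding \<pi>_def by blast
qed

text \<open>The quotient \<open>A / B\<close> is a primitive \<open>p\<close>-th root of unity, and
  this is the homogenised form of \<open>(\<zeta> - 1) ^ (p - 1) = p * unit\<close>. It comes from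
  expanding \<open>A ^ p = (B + \<delta>) ^ p\<close>, cancelling \<open>B ^ p\<close>, and dividing
  by \<delta>, which is nonzero because \<open>A = B\<close> would turn the sum into
  \<open>p * B ^ (p - 1)\<close>.\<close>

lemma cyclotomic_factor_difference:
  fixes A B :: complex
  assumes A: "algebraic_int A" and B: "algebraic_int B" "B \<noteq> 0"
    and eq: "(\<Sum>i<p. A ^ i * B ^ (p - 1 - i)) = 0"
  obtains z where "algebraic_int z" "(A - B) ^ (p - 1) = of_nat p * (- (B ^ (p - 1) + (A - B) * z))"
    "A ^ p = B ^ p"
proof -
  define \<delta> where "\<delta> = A - B"
  have p: "p > 1" by (rule p_gt_1)
  have \<delta>: "algebraic_int \<delta>" unfolding \<delta>_def using A B(1) by (intro algebraic_int_closed)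
  have "\<delta> \<noteq> 0"
  proof
    assume "\<delta> = 0"
    then have "(\<Sum>i<p. B ^ i * B ^ (p - 1 - i)) = 0" using eq by (simp add: \<delta>_def)
    moreover have "B ^ i * B ^ (p - 1 - i) = B ^ (p - 1)" if "i < p" for i
      using that by (simp flip: power_add)
    ultimately show False using B(2) p by simp
  qed
  have "A ^ p - B ^ p = (A - B) * (\<Sum>i<p. B ^ (p - Suc i) * A ^ i)" by (rule power_diff_sumr2)
  also have "\<dots> = 0" using eq by (simp add: mult.commute)
  finally have Ap: "A ^ p = B ^ p" by simp
  define z where "z = (\<Sum>k\<in>{2..<p}. of_nat ((p choose k) div p) * \<delta> ^ (k - 2) * B ^ (p - k))"
  have z: "algebraic_int z" unfolding z_def using \<delta> B(1) by (intro algebraic_int_closed) auto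
  have "A ^ p = (\<Sum>k\<le>p. of_nat (p choose k) * \<delta> ^ k * B ^ (p - k))"
    using binomial_ring[of \<delta> B p] by (simp add: \<delta>_def)
  also have "{..p} = insert 0 (insert 1 (insert p {2..<p}))" using p by auto
  also have "(\<Sum>k\<in>\<dots>. of_nat (p choose k) * \<delta> ^ k * B ^ (p - k))
    = B ^ p + of_nat p * \<delta> * B ^ (p - 1) + \<delta> ^ p
      + (\<Sum>k\<in>{2..<p}. of_nat (p choose k) * \<delta> ^ k * B ^ (p - k))"
    using p by (simp add: add_ac)
  also have "(\<Sum>k\<in>{2..<p}. of_nat (p choose k) * \<delta> ^ k * B ^ (p - k)) = of_nat p * \<delta> * (\<delta> * z)"
    unfolding z_def sum_distrib_left
  proof (intro sum.cong refl)
    fix k assume k: "k \<in> {2..<p}"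
    then have "p dvd p choose k" using prime_p by (intro dvd_choose_prime) auto
    then have "(p choose k) = p * ((p choose k) div p)" by simp
    then have "of_nat (p choose k) = (of_nat p * of_nat ((p choose k) div p) :: complex)"
      by (metis of_nat_mult)
    moreover have "\<delta> ^ k = \<delta> * (\<delta> * \<delta> ^ (k - 2))"
      using k by (metis Suc_diff_le atLeastLessThan_iff diff_Suc_Suc numeral_2_eq_2 power_Suc diff_zero Suc_le_eq le_add_diff_inverse add_2_eq_Suc)
    ultimately show "of_nat (p choose k) * \<delta> ^ k * B ^ (p - k)
      = of_nat p * \<delta> * (\<delta> * (of_nat ((p choose k) div p) * \<delta> ^ (k - 2) * B ^ (p - k)))" by simp
  qed
  finally have "\<delta> * (of_nat p * (B ^ (p - 1) + \<delta> * z) + \<delta> ^ (p - 1)) = 0"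
    using Ap p by (simp add: algebra_simps power_eq_if[of \<delta> p])
  then have "\<delta> ^ (p - 1) = of_nat p * (- (B ^ (p - 1) + \<delta> * z))"
    using \<open>\<delta> \<noteq> 0\<close> by (simp only: mult_eq_0_iff add_eq_0_iff mult_minus_right) simp
  then show ?thesis using that z Ap unfolding \<delta>_def by blast
qed

text \<open>Here \<open>\<beta> - c0\<close> is a uniformizer. For \<open>p = 2\<close> the centre must be compatible with \<open>B\<close> modulo 4.\<close>
lemma maximal_at_cyclotomic_factor:
  assumes \<beta>: "algebraic_int \<beta>" and c0: "c0 \<in> D" and B: "unit_at p B" "B \<noteq> 0"
    and eq: "(\<Sum>i<p. (\<beta> ^ (p ^ g)) ^ i * B ^ (p - 1 - i)) = 0"
    and y0: "c0 ^ (p ^ g) = B + of_nat p * y0" "algebraic_int y0"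
    and two: "p = 2 \<Longrightarrow> unit_at p (B + y0)"
  shows "maximal_at \<beta> (p ^ g * (p - 1))"
proof -
  define A where "A = \<beta> ^ (p ^ g)"
  define \<delta> where "\<delta> = A - B"
  define \<pi> where "\<pi> = \<beta> - c0"
  note Bint = unit_at_algebraic_int[OF B(1)]
  have c0i: "algebraic_int c0" using c0 integralD by blast
  have A: "algebraic_int A" unfolding A_def using \<beta> by (rule algebraic_int_power)
  have \<delta>int: "algebraic_int \<delta>" unfolding \<delta>_def using A Bint by (intro algebraic_int_closed)
  have \<pi>: "algebraic_int \<pi>" unfolding \<pi>_def using \<beta> c0i by (intro algebraic_int_closed)
  obtain z where z: "algebraic_int z" "\<delta> ^ (p - 1) = of_nat p * (- (B ^ (p - 1) + \<delta> * z))"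
    using cyclotomic_factor_difference[OF A Bint B(2)] eq unfolding A_def \<delta>_def by blast
  have "top_nil p (\<delta> ^ (p - 1))"
    unfolding z(2) using \<delta>int Bint z(1) by (intro top_nil_p_mult p_pos algebraic_int_closed)
  then have \<delta>: "top_nil p \<delta>" using \<delta>int top_nil_if_power by blast
  obtain z1 where z1: "algebraic_int z1"
    "(c0 + \<pi>) ^ (p ^ g) = c0 ^ (p ^ g) + \<pi> ^ (p ^ g) + of_nat p * \<pi> * z1"
    using frobenius_mod_prime[OF prime_p c0i \<pi>] by blast
  define w where "w = y0 + \<pi> * z1"
  have w: "algebraic_int w" unfolding w_def using y0(2) \<pi> z1(1) by (intro algebraic_int_closed)
  have \<pi>N: "\<pi> ^ (p ^ g) = \<delta> - of_nat p * w"
    using z1(2) y0(1) by (simp add: \<pi>_def \<delta>_def A_def w_def algebra_simps)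
  have "top_nil p (\<delta> + of_nat p * (- w))"
    using w by (intro top_nil_add \<delta> top_nil_p_mult p_pos algebraic_int_closed)
  then have \<pi>nil: "top_nil p \<pi>" using \<pi> top_nil_if_power[of p \<pi> "p ^ g"] by (simp add: \<pi>N)
  have "\<exists>u. unit_at p u \<and> \<pi> ^ (p ^ g * (p - 1)) = of_nat p * u"
  proof (cases "p = 2")
    \<comment> \<open>Here \<open>\<delta> = - 2 * B\<close> is no larger than 2, so
      \<open>2 * w\<close> may cancel it. The hypothesis \<open>two\<close> prevents this, up to a
      multiple of \<pi>.\<close>
    case True
    have "\<delta> = - 2 * B"
    proof -
      have "B + A = 0" using eq True by (simp add: A_def numeral_2_eq_2)
      then show ?thesis by (simp add: \<delta>_def add_eq_0_iff)
    qed
    then have "\<pi> ^ (p ^ g * (p - 1)) = of_nat p * (- ((B + y0) + \<pi> * z1))"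
      using \<pi>N True by (simp add: w_def algebra_simps)
    moreover have "unit_at p (- ((B + y0) + \<pi> * z1))"
      by (intro unit_at_minus unit_at_add_top_nil p_pos two True top_nil_mult \<pi>nil z1)
    ultimately show ?thesis by blast
  next
    \<comment> \<open>For odd \<open>p\<close> the term \<open>\<delta> ^ (p - 1)\<close> already
      supplies \<open>p\<close> times a unit, and the correction by \<open>p * w\<close> only adds
      \<open>p\<close> times something topologically nilpotent.\<close>
    case False
    then have "p - 1 \<ge> 2" using p_gt_1 by simp
    then obtain t where t: "top_nil p t" "(\<delta> - of_nat p * w) ^ (p - 1) = \<delta> ^ (p - 1) + of_nat p * t"
      using power_add_p_mult_top_nil[OF p_pos \<delta> w] by blast
    have "\<pi> ^ (p ^ g * (p - 1)) = of_nat p * (- (B ^ (p - 1) + \<delta> * z) + t)"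
      unfolding power_mult \<pi>N t(2) z(2) by (simp add: algebra_simps)
    moreover have "unit_at p (- (B ^ (p - 1) + \<delta> * z) + t)"
      by (intro unit_at_minus unit_at_add_top_nil p_pos unit_at_power B top_nil_mult \<delta> z t)
    ultimately show ?thesis by blast
  qed
  then show ?thesis using maximal_at_uniformizer[OF \<beta> c0] unfolding \<pi>_def by blast
qed

text \<open>With \<open>v\<close> inverse to \<open>u\<close> modulo \<open>p\<close> and
  \<open>b = p ^ Suc l * x\<close>, the identity \<open>b / p = p ^ l * (u * x) * v - b * z\<close>
  shows that \<open>b / p\<close> is integral, so the denominator shrinks by one power of
  \<open>p\<close>.\<close>

lemma cancel_unit_at:
  assumes u: "unit_at p u" and x: "x \<in> localize p D" and ux: "algebraic_int (u * x)"
  shows "x \<in> D"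
proof -
  obtain l where "of_nat p ^ l * x \<in> D" using x unfolding localize_def by auto
  then show ?thesis
  proof (induction l)
    case (Suc l)
    obtain v z where v: "algebraic_int v" "algebraic_int z" "u * v = 1 + of_nat p * z"
      using unit_atE[OF u p_pos] .
    define b where "b = of_nat p ^ Suc l * x"
    have bp: "b / of_nat p = of_nat p ^ l * x" using p_pos by (simp add: b_def)
    have "(of_nat p ^ l * (u * x)) * v = of_nat p ^ l * x * (u * v)" by simp
    also have "\<dots> = b / of_nat p + b * z" unfolding v(3) bp by (simp add: b_def algebra_simps)
    finally have "b / of_nat p = (of_nat p ^ l * (u * x)) * v - b * z" by simp
    also have "algebraic_int \<dots>"
      using v ux integralD[OF Suc(2)] unfolding b_def[symmetric]
      by (intro algebraic_int_closed(3) algebraic_int_plus_times(2)[of _ v]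
          algebraic_int_plus_times(2)[of _ "u * x"] algebraic_int_plus_times(2)[of b]) (simp_all add: algebraic_int_power)
    finally have "algebraic_int (b ^ 1 / of_nat p)" by simp
    then have "b / of_nat p \<in> D" using radical Suc(2) unfolding b_def by blast
    then show ?case using Suc(1) p_pos by (simp add: b_def)
  qed simp
qed

end

section \<open>Chains of cyclotomic factors\<close>

text \<open>For \<open>N > 0\<close> this is \<open>(X ^ (N * p) - B ^ p) / (X ^ N - B)\<close>, the
  homogenised \<open>p\<close>-th cyclotomic polynomial in \<open>X ^ N\<close> and
  \<open>B\<close>.\<close>

definition cyclo_poly :: "nat \<Rightarrow> nat \<Rightarrow> complex \<Rightarrow> complex poly" where
  "cyclo_poly p N B = (\<Sum>i<p. monom (B ^ (p - 1 - i)) (N * i))"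

lemma poly_cyclo_poly: "poly (cyclo_poly p N B) x = (\<Sum>i<p. (x ^ N) ^ i * B ^ (p - 1 - i))"
  by (simp add: cyclo_poly_def poly_sum poly_monom mult.commute flip: power_mult)

lemma cyclo_poly_monic:
  assumes "p > 0" "N > 0"
  shows "degree (cyclo_poly p N B) = N * (p - 1)" "lead_coeff (cyclo_poly p N B) = 1"
proof -
  have "coeff (cyclo_poly p N B) (N * (p - 1)) = (\<Sum>i<p. if i = p - 1 then 1 else 0)"
    unfolding cyclo_poly_def coeff_sum
    by (intro sum.cong refl) (use assms in auto)
  also have "\<dots> = 1" using assms by simp
  finally have 1: "coeff (cyclo_poly p N B) (N * (p - 1)) = 1" .
  have "degree (cyclo_poly p N B) \<le> N * (p - 1)"
    unfolding cyclo_poly_def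
  proof (rule degree_sum_le)
    fix i assume "i \<in> {..<p}"
    then have "N * i \<le> N * (p - 1)" by (intro mult_le_mono2) auto
    then show "degree (monom (B ^ (p - 1 - i)) (N * i)) \<le> N * (p - 1)"
      using degree_monom_le order_trans by blast
  qed simp
  moreover have "degree (cyclo_poly p N B) \<ge> N * (p - 1)" using 1 by (intro le_degree) simp
  ultimately show "degree (cyclo_poly p N B) = N * (p - 1)" by simp
  with 1 show "lead_coeff (cyclo_poly p N B) = 1" by simp
qed

text \<open>\<open>X ^ (e * p ^ s) - c ^ p ^ s\<close> is the product of \<open>X ^ e - c\<close>
  and the polynomials \<open>cyclo_poly p (e * p ^ j) (c ^ p ^ j)\<close> for \<open>j < s\<close>.
  The chain holds one root of each: \<open>\<beta> 0\<close> of the first and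
  \<open>\<beta> (Suc j)\<close> of the factor with index \<open>j\<close>. The bounds in
  \<open>max_0\<close> and \<open>max_Suc\<close> are the degrees of these factors.\<close>

locale factor_chain = coefficient_ring +
  fixes c :: complex and e s :: nat and \<beta> :: "nat \<Rightarrow> complex"
  assumes c: "c \<in> D" "unit_at p c" and e: "e > 0"
    and \<beta>_int: "\<And>j. j \<le> s \<Longrightarrow> algebraic_int (\<beta> j)"
    and \<beta>_0: "\<beta> 0 ^ e = c"
    and \<beta>_Suc: "\<And>j. j < s \<Longrightarrow> poly (cyclo_poly p (e * p ^ j) (c ^ p ^ j)) (\<beta> (Suc j)) = 0"
    and max_0: "maximal_at (\<beta> 0) e"
    and max_Suc: "\<And>j. j < s \<Longrightarrow> maximal_at (\<beta> (Suc j)) (e * p ^ j * (p - 1))"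
begin

lemma \<beta>_power: "j \<le> s \<Longrightarrow> j \<le> i \<Longrightarrow> \<beta> j ^ (e * p ^ i) = c ^ p ^ i"
proof -
  assume j: "j \<le> s" "j \<le> i"
  have *: "\<beta> j ^ (e * p ^ j) = c ^ p ^ j"
  proof (cases j)
    case 0
    then show ?thesis using \<beta>_0 by simp
  next
    case (Suc l)
    define A B where "A = \<beta> j ^ (e * p ^ l)" and "B = c ^ p ^ l"
    have "(\<Sum>i<p. A ^ i * B ^ (p - 1 - i)) = 0"
      using \<beta>_Suc[of l] Suc j(1) by (simp add: poly_cyclo_poly A_def B_def)
    then have "A ^ p - B ^ p = 0"
      by (simp add: power_diff_sumr2[of A p B] mult.commute)
    then show ?thesis by (simp add: A_def B_def Suc mult_ac flip: power_mult)
  qed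
  have "\<beta> j ^ (e * p ^ i) = (\<beta> j ^ (e * p ^ j)) ^ (p ^ (i - j))"
    using j(2) by (simp add: mult.assoc flip: power_mult power_add)
  also have "\<dots> = c ^ p ^ i"
    unfolding * using j(2) by (simp flip: power_mult power_add)
  finally show ?thesis .
qed

text \<open>For \<open>t < J\<close> the condition on \<open>d\<close> says that \<open>d\<close> is
  smaller than the total degree of the top \<open>t + 1\<close> factors, so at most \<open>t\<close>
  of them can be divided off. In the induction the remainder modulo the top factor \<open>G\<close>
  lies in \<open>D\<close> by maximality at the top root, where \<open>P\<close> and the remainder
  agree. At the lower roots \<open>G\<close> equals \<open>p\<close> times a unit, so
  \<open>p\<close> times the quotient satisfies the hypotheses for \<open>J\<close> and
  \<open>t - 1\<close>.\<close>

lemma leading_coefficient_bound: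
  assumes "J \<le> s" and P: "coeffs_in (localize p D) P" "degree P \<le> d" and d: "d < e * p ^ J"
    and int: "\<And>j. j \<le> J \<Longrightarrow> algebraic_int (poly P (\<beta> j))"
    and t: "t \<le> J" "t = J \<or> d + e * p ^ (J - t - 1) < e * p ^ J"
  shows "of_nat p ^ t * coeff P d \<in> D"
  using assms
proof (induction J arbitrary: P d t)
  case 0
  then have "coeffs_in D P" using max_0 unfolding maximal_at_def by auto
  then show ?case using 0 by (simp add: coeffs_inD)
next
  case (Suc J)
  define B where "B = c ^ p ^ J"
  define G where "G = cyclo_poly p (e * p ^ J) B"
  have degG: "degree G = e * p ^ J * (p - 1)" and monicG: "lead_coeff G = 1"
    unfolding G_def using cyclo_poly_monic[where N = "e * p ^ J" and B = B, OF p_pos] e p_pos by auto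
  have split_deg: "e * p ^ Suc J = degree G + e * p ^ J"
    unfolding degG using p_pos by (cases p) (auto simp: algebra_simps)
  note max = max_Suc[of J, folded degG, unfolded maximal_at_def, rule_format]
  have JJ: "J < s" using Suc.prems(1) by simp
  show ?case
  proof (cases "d < degree G")
    case True
    then have "coeffs_in D P" using max[OF JJ Suc.prems(2)] Suc.prems(5)[of "Suc J"] Suc.prems(3) True by simp
    moreover have "of_nat (p ^ t) \<in> D" by (rule is_subringD(9)[OF subring])
    ultimately show ?thesis using is_subringD(5)[OF subring] coeffs_inD by (metis of_nat_power)
  next
    case False
    have degG0: "degree G > 0" unfolding degG using e p_gt_1 by simp
    have L: "is_subring (localize p D)" by (rule is_subring_localize[OF subring])
    have DL: "D \<subseteq> localize p D" by (rule subset_localize)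
    have "coeffs_in D G" unfolding G_def cyclo_poly_def B_def
      by (intro coeffs_in_sum coeffs_in_closed subring is_subringD(7) c)
    then have GL: "coeffs_in (localize p D) G" using DL coeffs_in_mono by blast
    obtain Q R where QR: "coeffs_in (localize p D) Q" "coeffs_in (localize p D) R" "P = Q * G + R"
      "degree R < degree G"
      using coeffs_in_division[OF L GL monicG degG0 Suc.prems(2)] .
    have "poly G (\<beta> (Suc J)) = 0" unfolding G_def B_def by (rule \<beta>_Suc[OF JJ])
    then have "poly R (\<beta> (Suc J)) = poly P (\<beta> (Suc J))" by (simp add: QR(3))
    then have RD: "coeffs_in D R" using max[OF JJ QR(2,4)] Suc.prems(5) by simp
    \<comment> \<open>The value \<open>t = 0\<close> would force \<open>d\<close> below
      \<open>degree G\<close>, which has been dealt with.\<close>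
    obtain t' where t': "t = Suc t'"
    proof (cases t)
      case 0
      then have "d + e * p ^ J < e * p ^ Suc J" using Suc.prems(7) by simp
      then show ?thesis using False split_deg by simp
    qed
    define d' where "d' = d - degree G"
    have dd: "d = d' + degree G" unfolding d'_def using False by simp
    have degQ: "degree Q \<le> d'"
    proof (cases "Q = 0")
      case nz: False
      have "Q * G = P - R" using QR(3) by simp
      then have "degree (Q * G) \<le> d"
        using degree_diff_le[of P d R] Suc.prems(3) QR(4) False by simp
      moreover have "degree (Q * G) = degree Q + degree G"
        using nz monicG by (intro degree_mult_eq) auto
      ultimately show ?thesis using dd by simp
    qed simp
    have coeff: "coeff P d = coeff Q d'"
    proof -
      have "coeff R d = 0" using QR(4) False by (intro coeff_eq_0) simp
      moreover have "coeff (Q * G) d = coeff Q d'"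
      proof (cases "degree Q = d'")
        case True
        then show ?thesis using coeff_mult_degree_sum[of Q G] monicG dd by simp
      next
        case neq: False
        then have "degree (Q * G) < d" using degree_mult_le[of Q G] degQ dd by simp
        then show ?thesis using neq degQ by (simp add: coeff_eq_0)
      qed
      ultimately show ?thesis by (simp add: QR(3))
    qed
    \<comment> \<open>\<open>p * M\<close> is the common value of \<open>G\<close> at all lower
      roots, because \<open>\<beta> j ^ (e * p ^ J)\<close> equals \<open>B\<close> there and the
      \<open>p\<close> summands coincide.\<close>
    define M where "M = c ^ (p ^ J * (p - 1))"
    have M: "M \<in> D" "unit_at p M"
      unfolding M_def using c by (auto intro: is_subringD(7)[OF subring] unit_at_power p_pos)
    define P' where "P' = smult (of_nat p * M) Q"
    have P': "coeffs_in (localize p D) P'"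
      unfolding P'_def
      using M(1) is_subringD(9)[OF subring] DL is_subringD(5)[OF subring]
      by (intro coeffs_in_closed(7)[OF L] QR(1)) auto
    have "of_nat p ^ t' * coeff P' d' \<in> D"
    proof (rule Suc.IH)
      show "J \<le> s" "coeffs_in (localize p D) P'" using JJ P' by auto
      show "degree P' \<le> d'" unfolding P'_def using degQ degree_smult_le le_trans by blast
      show "d' < e * p ^ J" using Suc.prems(4) split_deg dd by simp
      show "t' \<le> J" using Suc.prems(6) t' by simp
      show "t' = J \<or> d' + e * p ^ (J - t' - 1) < e * p ^ J"
        using Suc.prems(7) t' split_deg dd by auto
      fix j assume j: "j \<le> J"
      have "poly G (\<beta> j) = (\<Sum>i<p. B ^ i * B ^ (p - 1 - i))"
        unfolding G_def poly_cyclo_poly B_def using \<beta>_power[of j J] j JJ by simp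
      also have "\<dots> = (\<Sum>i<p. B ^ (p - 1))"
        by (intro sum.cong refl) (simp flip: power_add)
      also have "\<dots> = of_nat p * M" unfolding M_def B_def by (simp flip: power_mult)
      finally have "poly P' (\<beta> j) = poly P (\<beta> j) - poly R (\<beta> j)"
        by (simp add: QR(3) P'_def mult.commute)
      moreover have "algebraic_int (poly R (\<beta> j))"
        using RD integral \<beta>_int[of j] j JJ by (intro algebraic_int_poly) auto
      ultimately show "algebraic_int (poly P' (\<beta> j))"
        using Suc.prems(5)[of j] j by (auto intro: algebraic_int_closed)
    qed
    then have *: "algebraic_int (M * (of_nat p ^ t * coeff P d))"
      using integralD by (simp add: P'_def coeff t' mult_ac)
    have "of_nat p ^ t * coeff P d \<in> localize p D"
      using Suc.prems(2) is_subringD[OF L] coeffs_inD by meson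
    then show ?thesis using cancel_unit_at[OF M(2) _ *] by blast
  qed
qed

end

section \<open>Existence of chains, and the coefficient rings\<close>

lemma algebraic_int_nth_root:
  fixes x :: complex
  assumes "n > 0" "algebraic_int (x ^ n)"
  shows "algebraic_int x"
  by (rule algebraic_int_root[where p = "monom 1 n" and y = "x ^ n"])
    (use assms in \<open>auto simp: poly_monom degree_monom_eq\<close>)

lemma unit_at_nonzero:
  assumes "p > 1" "unit_at p u"
  shows "u \<noteq> 0"
proof
  assume "u = 0"
  then have "algebraic_int (of_int (- 1) / of_int (int p) :: complex)"
    using assms unfolding unit_at_def by simp
  then have "int p dvd - 1" using assms(1) of_int_div_algebraic_int(2)[of "- 1" "int p"] by simp
  then show False using assms(1) by simp
qed

context coefficient_ring
begin

text \<open>This leaves only congruences for \<open>c\<close> to be checked. Roots exist over the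
  complex numbers; \<open>base\<close> makes \<open>X ^ (p ^ f) - c\<close> Eisenstein after
  translation, unless it is linear, and \<open>step\<close> provides the \<open>y0\<close> required
  for the centre \<open>c\<close> and \<open>B = c ^ p ^ j\<close> in the cyclotomic
  factors.\<close>

lemma factor_chain_exists:
  assumes c: "c \<in> D" "unit_at p c"
    and base: "f = 0 \<or> (\<exists>u. c - c ^ (p ^ f) = of_nat p * u \<and> unit_at p u)"
    and step: "\<And>j. j < s \<Longrightarrow> \<exists>y. algebraic_int y \<and> c ^ (p ^ (f + j)) = c ^ (p ^ j) + of_nat p * y
      \<and> (p = 2 \<longrightarrow> unit_at p (c ^ (p ^ j) + y))"
  obtains \<beta> where "factor_chain p D c (p ^ f) s \<beta>"
proof -
  have ci: "algebraic_int c" using c integralD by blast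
  have c0: "c \<noteq> 0" using unit_at_nonzero[OF p_gt_1 c(2)] .
  have "\<exists>x. poly (monom 1 (p ^ f) - [:c:]) x = 0"
  proof (rule fundamental_theorem_of_algebra)
    have "coeff (monom 1 (p ^ f) - [:c:]) (p ^ f) \<noteq> 0"
      using p_pos by (simp add: coeff_pCons split: nat.split)
    then have "degree (monom 1 (p ^ f) - [:c:]) \<ge> p ^ f" by (rule le_degree)
    moreover have "p ^ f > 0" using p_pos by simp
    ultimately show "\<not> constant (poly (monom 1 (p ^ f) - [:c:]))"
      unfolding constant_degree by linarith
  qed
  then obtain b0 where b0: "b0 ^ (p ^ f) = c" by (auto simp: poly_monom)
  have "\<exists>x. poly (cyclo_poly p (p ^ f * p ^ j) (c ^ p ^ j)) x = 0" for j
  proof (rule fundamental_theorem_of_algebra)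
    show "\<not> constant (poly (cyclo_poly p (p ^ f * p ^ j) (c ^ p ^ j)))"
      using cyclo_poly_monic(1)[OF p_pos, of "p ^ f * p ^ j"] p_pos p_gt_1
      by (simp add: constant_degree)
  qed
  then obtain b where b: "\<And>j. poly (cyclo_poly p (p ^ f * p ^ j) (c ^ p ^ j)) (b j) = 0" by metis
  define \<beta> where "\<beta> j = (case j of 0 \<Rightarrow> b0 | Suc l \<Rightarrow> b l)" for j
  have b0_int: "algebraic_int b0"
    by (rule algebraic_int_nth_root[of "p ^ f"]) (simp_all add: p_pos b0 ci)
  have eq: "(\<Sum>i<p. (b j ^ (p ^ (f + j))) ^ i * (c ^ p ^ j) ^ (p - 1 - i)) = 0" for j
    using b[of j] by (simp add: poly_cyclo_poly power_add)
  have b_int: "algebraic_int (b j)" for j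
  proof -
    define A B where "A = b j ^ (p ^ (f + j))" and "B = c ^ p ^ j"
    have "(\<Sum>i<p. A ^ i * B ^ (p - 1 - i)) = 0" using eq[of j] by (simp add: A_def B_def)
    then have "A ^ p - B ^ p = 0" by (simp add: power_diff_sumr2[of A p B] mult.commute)
    then have "b j ^ (p ^ (f + j) * p) = c ^ (p ^ j * p)" by (simp add: A_def B_def power_mult)
    then show ?thesis
      using algebraic_int_nth_root[of "p ^ (f + j) * p" "b j"] algebraic_int_power[OF ci] p_pos by simp
  qed
  show ?thesis
  proof (rule that[of \<beta>], unfold_locales)
    show "c \<in> D" "unit_at p c" "p ^ f > 0" "\<beta> 0 ^ (p ^ f) = c"
      using c p_pos b0 by (auto simp: \<beta>_def)
    show "algebraic_int (\<beta> j)" for j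
      unfolding \<beta>_def using b0_int b_int by (auto split: nat.split)
    show "poly (cyclo_poly p (p ^ f * p ^ j) (c ^ p ^ j)) (\<beta> (Suc j)) = 0" for j
      unfolding \<beta>_def using b by simp
    show "maximal_at (\<beta> 0) (p ^ f)"
    proof (cases "f = 0")
      case True
      then show ?thesis using b0 c(1) maximal_at_center[of c] by (simp add: \<beta>_def)
    next
      case False
      then obtain u where u: "c - c ^ (p ^ f) = of_nat p * u" "unit_at p u" using base by blast
      show ?thesis
        using maximal_at_root[OF b0_int b0 c(1) u] by (simp add: \<beta>_def)
    qed
    show "maximal_at (\<beta> (Suc j)) (p ^ f * p ^ j * (p - 1))" if j: "j < s" for j
    proof -
      obtain y where y: "algebraic_int y" "c ^ (p ^ (f + j)) = c ^ (p ^ j) + of_nat p * y"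
        "p = 2 \<longrightarrow> unit_at p (c ^ (p ^ j) + y)" using step[OF j] by blast
      have "maximal_at (b j) (p ^ (f + j) * (p - 1))"
        by (rule maximal_at_cyclotomic_factor[OF b_int c(1) _ _ eq y(2,1)])
          (use y(3) c0 unit_at_power[OF p_pos c(2)] in simp_all)
      then show ?thesis by (simp add: \<beta>_def power_add)
    qed
  qed
qed

end

lemma coefficient_ring_Ints:
  assumes "prime p"
  shows "coefficient_ring p \<int>"
proof
  show "\<int> \<subseteq> {x :: complex. algebraic_int x}" by (rule Ints_subset_algebraic_int)
  fix b :: complex and N
  assume "b \<in> \<int>" and *: "algebraic_int (b ^ N / of_nat p)"
  then obtain a where a: "b = of_int a" by (elim Ints_cases)
  have "int p dvd a ^ N"
    using of_int_div_algebraic_int(2)[of "a ^ N" "int p"] * a assms by (auto simp: prime_gt_0_nat)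
  then have "int p dvd a" using assms prime_dvd_power[of "int p" a N] by simp
  then obtain q where "a = int p * q" ..
  then show "b / of_nat p \<in> \<int>" using a assms by auto
qed (use assms is_subring_Ints in auto)

text \<open>A global model of the unramified quadratic extension of the 2-adic integers.\<close>
lemma coefficient_ring_quadratic:
  fixes w :: complex and t :: int
  assumes w: "w ^ 2 = w + of_int t" and t: "odd t"
  defines "D \<equiv> {of_int x + of_int y * w | x y. True}"
  shows "coefficient_ring 2 D"
proof
  show "prime (2 :: nat)" by simp
  have memI: "of_int x + of_int y * w \<in> D" for x y unfolding D_def by blast
  have w_int: "algebraic_int w"
  proof (rule algebraic_int_root[where p = "[:0, - 1, 1:]" and y = "of_int t"])
    show "poly [:0, - 1, 1:] w = of_int t" using w by (simp add: power2_eq_square algebra_simps)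
  qed (auto simp: coeff_pCons split: nat.split)
  show "is_subring D"
    unfolding is_subring_def
  proof (intro conjI ballI)
    show "0 \<in> D" "1 \<in> D" using memI[of 0 0] memI[of 1 0] by auto
  next
    fix a assume "a \<in> D"
    then obtain x y where "a = of_int x + of_int y * w" unfolding D_def by blast
    then show "- a \<in> D" using memI[of "- x" "- y"] by simp
  next
    fix a b assume "a \<in> D" "b \<in> D"
    then obtain x y x' y' where ab: "a = of_int x + of_int y * w" "b = of_int x' + of_int y' * w"
      unfolding D_def by blast
    show "a + b \<in> D" using memI[of "x + x'" "y + y'"] ab by (simp add: algebra_simps)
    have "a * b = of_int (x * x') + of_int (x * y' + y * x') * w + of_int (y * y') * w ^ 2"
      unfolding ab by (simp add: algebra_simps power2_eq_square)
    also have "\<dots> = of_int (x * x' + t * y * y') + of_int (x * y' + y * x' + y * y') * w"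
      unfolding w by (simp add: algebra_simps)
    finally show "a * b \<in> D" using memI by (simp only:)
  qed
  show D_int: "D \<subseteq> {x. algebraic_int x}"
    unfolding D_def using w_int by (auto intro!: algebraic_int_closed)
  fix b N assume "b \<in> D" and int: "algebraic_int (b ^ N / of_nat 2)"
  then obtain x y where b: "b = of_int x + of_int y * w" unfolding D_def by blast
  \<comment> \<open>The conjugate of \<open>b\<close>: the other root of
    \<open>X ^ 2 - X - t\<close> is \<open>1 - w\<close>.\<close>
  define b' where "b' = of_int (x + y) - of_int y * w"
  have "algebraic_int b'" unfolding b'_def using w_int
    by (intro algebraic_int_closed algebraic_int_of_int)
  then have "algebraic_int (b ^ N / of_nat 2 * b' ^ N)" using int by (intro algebraic_int_closed)
  moreover have "b * b' = of_int (x * x + x * y - t * y * y)"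
  proof -
    have "b * b' = of_int (x * x + x * y) + of_int (y * y) * w - of_int (y * y) * w ^ 2"
      unfolding b b'_def by (simp add: algebra_simps power2_eq_square)
    then show ?thesis unfolding w by (simp add: algebra_simps)
  qed
  then have "b ^ N / of_nat 2 * b' ^ N = of_int ((x * x + x * y - t * y * y) ^ N) / of_int 2"
    by (simp flip: power_mult_distrib)
  ultimately have "even ((x * x + x * y - t * y * y) ^ N)"
    using of_int_div_algebraic_int(2)[of "(x * x + x * y - t * y * y) ^ N" 2] by simp
  then have "even (x * x + x * y - t * y * y)" by (metis even_power)
  \<comment> \<open>For odd \<open>t\<close> the norm form is \<open>x ^ 2 + x * y + y ^ 2\<close>
    modulo 2, which is even only if both variables are.\<close>
  then have "even x" "even y" using t by auto
  then obtain x2 y2 where "x = 2 * x2" "y = 2 * y2" by (elim evenE)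
  then show "b / of_nat 2 \<in> D" using memI[of x2 y2] by (simp add: b add_divide_distrib)
qed

lemma dvd_diff_power_of_primitive_root:
  fixes g a :: nat
  assumes g: "\<forall>i>0. residue_primroot (p ^ i) g" and p: "prime p" and q: "q > 0"
  shows "int (p ^ q) dvd int g ^ a - 1 \<longleftrightarrow> p ^ (q - 1) * (p - 1) dvd a"
proof -
  have "int (p ^ q) dvd int g ^ a - 1 \<longleftrightarrow> [int (g ^ a) = int 1] (mod int (p ^ q))"
    by (simp add: cong_iff_dvd_diff)
  also have "\<dots> \<longleftrightarrow> [g ^ a = 1] (mod p ^ q)" by (rule cong_int_iff)
  also have "\<dots> \<longleftrightarrow> ord (p ^ q) g dvd a" by (rule ord_divides)
  also have "ord (p ^ q) g = totient (p ^ Suc (q - 1))"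
    using g q by (simp add: residue_primroot_def)
  also have "\<dots> = p ^ (q - 1) * (p - 1)" by (rule totient_prime_power_Suc[OF p])
  finally show ?thesis .
qed

section \<open>Approximate roots of the radicand\<close>

text \<open>Used to write \<open>c ^ p ^ f\<close> as \<open>c\<close> times a power of
  \<open>c ^ (p - 1)\<close>, which is 1 modulo \<open>p\<close>.\<close>

lemma prime_power_eq_1_plus:
  fixes p :: nat
  assumes "p > 0"
  obtains h where "p ^ f = 1 + (p - 1) * h"
proof -
  have "\<exists>h. p ^ f = 1 + (p - 1) * h"
  proof (induction f)
    case (Suc f)
    then obtain h where h: "p ^ f = 1 + (p - 1) * h" by blast
    obtain q where q: "p = Suc q" using assms by (cases p) auto
    have "p ^ Suc f = p * (1 + (p - 1) * h)" by (simp add: h)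
    also have "\<dots> = 1 + (p - 1) * (p * h + 1)" unfolding q by (simp add: algebra_simps)
    finally have "p ^ Suc f = 1 + (p - 1) * (p * h + 1)" .
    then show ?case by blast
  qed simp
  then show ?thesis using that by blast
qed

lemma algebraic_int_of_dvd:
  fixes a b :: int
  assumes "b dvd a"
  shows "algebraic_int (of_int a / of_int b :: complex)"
  using assms by (cases "b = 0") auto

lemma dvd_power_prime_minus_self_iff:
  fixes m :: int
  assumes "prime p" "\<not> int p dvd m"
  shows "int p ^ q dvd m ^ p - m \<longleftrightarrow> int p ^ q dvd m ^ (p - 1) - 1"
proof -
  have "p > 0" using assms(1) prime_gt_0_nat by blast
  then have "m ^ p - m = m * (m ^ (p - 1) - 1)" by (simp add: power_eq_if[of m p] right_diff_distrib)
  moreover have "coprime (int p ^ q) m" using assms by (simp add: prime_imp_coprime)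
  ultimately show ?thesis by (simp add: coprime_dvd_mult_right_iff)
qed

text \<open>Once \<open>m\<close> is a power of \<open>g\<close> modulo \<open>p ^ M\<close>,
  extracting a root amounts to dividing the exponent.\<close>

lemma power_of_primitive_root_exists:
  fixes m :: int and g :: nat
  assumes g: "\<forall>i>0. residue_primroot (p ^ i) g" and p: "prime p" and m: "\<not> int p dvd m" and M: "M > 0"
  obtains a where "int p ^ M dvd int g ^ a - m"
proof -
  define x where "x = nat (m mod int p ^ M)"
  have pM: "p ^ M > 1" using p M prime_gt_1_nat one_less_power by blast
  have x: "int x = m mod int p ^ M"
    unfolding x_def using p prime_gt_0_nat[OF p] by simp
  have "coprime (int x) (int p ^ M)"
  proof -
    have "int p dvd int p ^ M" using M by (simp add: dvd_power)
    then have "\<not> int p dvd int x" unfolding x using m by (simp add: dvd_mod_iff)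
    then have "coprime (int p) (int x)" using p by (simp add: prime_imp_coprime)
    then show ?thesis by (simp add: coprime_commute)
  qed
  then have cop: "coprime x (p ^ M)" by (simp flip: coprime_int_iff)
  have "x \<in> totatives (p ^ M)"
  proof -
    have "x \<noteq> 0" using cop pM by (cases "x = 0") auto
    moreover have "int x < int (p ^ M)" unfolding x using prime_gt_0_nat[OF p] by simp
    ultimately show ?thesis using cop unfolding totatives_def by auto
  qed
  then obtain a where "x = g ^ a mod p ^ M"
    using residue_primroot_is_generator[OF pM] g M unfolding bij_betw_def by blast
  then have "int g ^ a mod int p ^ M = m mod int p ^ M"
    using x by (simp add: of_nat_mod)
  then show ?thesis using that[of a] by (simp add: mod_eq_dvd_iff)
qed

lemma dvd_cong_power:
  fixes m :: int
  assumes "q dvd x - m" shows "q dvd x ^ i - m ^ i"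
  unfolding power_diff_sumr2 by (rule dvd_mult2[OF assms])

text \<open>With \<open>m\<close> congruent to \<open>g ^ a\<close>, the order of \<open>g\<close>
  translates the two conditions on \<open>m ^ p - m\<close> into \<open>v_p(a) = s\<close>. So
  \<open>p ^ s'\<close> divides \<open>a\<close>, and the root is the integer
  \<open>g ^ (a / p ^ s')\<close>; the ring \<open>D\<close> can be the integers.\<close>

lemma factor_chain_odd:
  fixes m :: int
  assumes p: "prime p" "odd p" and m: "\<not> int p dvd m"
    and s: "int p ^ (s + 1) dvd m ^ p - m" "\<not> int p ^ (s + 2) dvd m ^ p - m"
    and s': "s' = min s k"
  shows "\<exists>D c \<beta>. factor_chain p D c (p ^ (k - s')) s' \<beta>
    \<and> algebraic_int ((c ^ (p ^ s') - of_int m) / of_nat p ^ M)"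
proof -
  have p1: "p > 1" using p prime_gt_1_nat by blast
  obtain g where g: "\<forall>i>0. residue_primroot (p ^ i) g"
    using residue_primroot_odd_prime_power_exists[OF p] .
  \<comment> \<open>At least \<open>s + 2\<close>, so that the congruence with \<open>g ^ a\<close>
    also sees the non-divisibility.\<close>
  define M' where "M' = max M (s + 2)"
  obtain a where a: "int p ^ M' dvd int g ^ a - m"
    by (rule power_of_primitive_root_exists[OF g p(1) m, of M']) (simp add: M'_def)
  have iff: "int p ^ q dvd m ^ p - m \<longleftrightarrow> p ^ (q - 1) dvd a" if q: "q > 0" "q \<le> M'" for q
  proof -
    have "int p ^ q dvd int g ^ a - m" using a q(2) le_imp_power_dvd dvd_trans by blast
    then have "int p ^ q dvd (int g ^ a) ^ (p - 1) - m ^ (p - 1)" by (rule dvd_cong_power)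
    then have "int p ^ q dvd m ^ (p - 1) - 1 \<longleftrightarrow> int p ^ q dvd (int g ^ a) ^ (p - 1) - 1"
      using dvd_add_right_iff[of "int p ^ q" "(int g ^ a) ^ (p - 1) - m ^ (p - 1)" "m ^ (p - 1) - 1"]
      by simp
    also have "\<dots> \<longleftrightarrow> int (p ^ q) dvd int g ^ (a * (p - 1)) - 1" by (simp add: power_mult)
    also have "\<dots> \<longleftrightarrow> p ^ (q - 1) * (p - 1) dvd a * (p - 1)"
      by (rule dvd_diff_power_of_primitive_root[OF g p(1) q(1)])
    also have "\<dots> \<longleftrightarrow> p ^ (q - 1) dvd a" using p1 by simp
    finally show ?thesis using dvd_power_prime_minus_self_iff[OF p(1) m] by simp
  qed
  have "p ^ s dvd a" using iff[of "s + 1"] s(1) unfolding M'_def by simp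
  then have "p ^ s' dvd a" using s' le_imp_power_dvd[of s' s p] dvd_trans by auto
  then obtain a' where a': "a = p ^ s' * a'" ..
  have nsa: "\<not> p ^ Suc s dvd a" using iff[of "s + 2"] s(2) unfolding M'_def by simp
  define c where "c = int g ^ a'"
  have g_cop: "\<not> int p dvd int g"
  proof -
    have "coprime p g" using g[rule_format, of 1] by (simp add: residue_primroot_def)
    then have "\<not> p dvd g" using p1 by (auto simp: coprime_absorb_left)
    then show ?thesis by simp
  qed
  then have c_cop: "\<not> int p dvd c" unfolding c_def using p(1) prime_dvd_power[of "int p" "int g" a'] by simp blast
  then have c_unit: "unit_at p (of_int c)" using unit_at_of_int p(1) by blast
  define f where "f = k - s'"
  obtain h where h: "p ^ f = 1 + (p - 1) * h" using prime_power_eq_1_plus[of p f] p1 by auto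
  interpret coefficient_ring p \<int> by (rule coefficient_ring_Ints[OF p(1)])
  obtain \<beta> where \<beta>: "factor_chain p \<int> (of_int c) (p ^ f) s' \<beta>"
  proof (rule factor_chain_exists)
    show "of_int c \<in> (\<int> :: complex set)" by simp
    show "unit_at p (of_int c)" by (rule c_unit)
    show "f = 0 \<or> (\<exists>u. of_int c - of_int c ^ p ^ f = of_nat p * u \<and> unit_at p u)"
    proof (cases "f = 0")
      case f: False
      then have "s' = s" unfolding f_def s' by auto
      then have na': "\<not> p dvd a'" using nsa unfolding a' by auto
      have eq: "c - c ^ p ^ f = - c * (int g ^ (a' * ((p - 1) * h)) - 1)"
        unfolding h c_def by (simp add: power_add power_mult algebra_simps flip: power_mult)
      have "int p dvd int g ^ (a' * ((p - 1) * h)) - 1"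
        using dvd_diff_power_of_primitive_root[OF g p(1), of 1] by simp
      then obtain u where u: "int g ^ (a' * ((p - 1) * h)) - 1 = int p * u" ..
      have "\<not> int p dvd u"
      proof
        assume "int p dvd u"
        then have "int (p ^ 2) dvd int g ^ (a' * ((p - 1) * h)) - 1"
          unfolding u by (simp add: power2_eq_square)
        \<comment> \<open>\<open>p * (p - 1)\<close> is the order of \<open>g\<close> modulo
          \<open>p ^ 2\<close>. Since \<open>p\<close> divides
          \<open>p ^ f = 1 + (p - 1) * h\<close>, it cannot divide
          \<open>(p - 1) * h\<close>.\<close>
        then have "p * (p - 1) dvd a' * ((p - 1) * h)"
          using dvd_diff_power_of_primitive_root[OF g p(1), of 2] by simp
        then have "p dvd a' * ((p - 1) * h)" by (rule dvd_mult_left)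
        then have "p dvd (p - 1) * h" using na' p(1) by (simp add: prime_dvd_mult_iff)
        moreover have "p dvd 1 + (p - 1) * h" using h f by (metis dvd_power neq0_conv)
        ultimately have "p dvd 1" by (metis dvd_add_left_iff)
        then show False using p1 by simp
      qed
      then have "\<not> int p dvd - c * u" using c_cop p(1) by (simp add: prime_dvd_mult_iff)
      then have "unit_at p (of_int (- c * u))" using unit_at_of_int[OF p(1)] by blast
      moreover have "c - c ^ p ^ f = int p * (- c * u)" unfolding eq u by simp
      then have "of_int c - of_int c ^ p ^ f = of_nat p * (of_int (- c * u) :: complex)"
        by (metis of_int_diff of_int_mult of_int_of_nat_eq of_int_power)
      ultimately show ?thesis by blast
    qed simp
    show "\<exists>y. algebraic_int y \<and> of_int c ^ p ^ (f + j) = of_int c ^ p ^ j + of_nat p * y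
        \<and> (p = 2 \<longrightarrow> unit_at p (of_int c ^ p ^ j + y))" for j
    proof -
      have "int p dvd int g ^ (a' * (p - 1) * h * p ^ j) - 1"
        using dvd_diff_power_of_primitive_root[OF g p(1), of 1] by simp
      then obtain u where u: "int g ^ (a' * (p - 1) * h * p ^ j) - 1 = int p * u" ..
      have "c ^ p ^ (f + j) = c ^ p ^ j * int g ^ (a' * (p - 1) * h * p ^ j)"
        unfolding power_add h c_def by (simp add: algebra_simps flip: power_mult power_add)
      also have "\<dots> = c ^ p ^ j + int p * (c ^ p ^ j * u)"
        using u by (simp add: algebra_simps diff_eq_eq)
      finally have "of_int c ^ p ^ (f + j) = (of_int c ^ p ^ j + of_nat p * of_int (c ^ p ^ j * u) :: complex)"
        by (metis of_int_add of_int_mult of_int_of_nat_eq of_int_power)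
      moreover have "p \<noteq> 2" using p(2) by auto
      ultimately show ?thesis using algebraic_int_of_int by blast
    qed
  qed
  have "int p ^ M dvd int p ^ M'" unfolding M'_def by (rule le_imp_power_dvd) simp
  then have "int p ^ M dvd c ^ p ^ s' - m"
    using dvd_trans[OF _ a] unfolding c_def a' by (simp add: mult.commute flip: power_mult)
  then have "algebraic_int (of_int (c ^ p ^ s' - m) / of_int (int p ^ M) :: complex)"
    by (rule algebraic_int_of_dvd)
  then show ?thesis using \<beta> unfolding f_def by (intro exI[of _ \<int>] exI[of _ "of_int c"] exI[of _ \<beta>]) simp
qed

section \<open>Approximate roots at the prime 2\<close>

lemma power_of_5_exists:
  fixes m :: int
  assumes M: "M \<ge> 3" and m: "m mod 4 = 1"
  obtains a where "2 ^ M dvd 5 ^ a - m"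
proof -
  \<comment> \<open>The residues 1 modulo 4 below \<open>2 ^ M\<close>. Their number is the order of
    5 modulo \<open>2 ^ M\<close>, so the powers of 5 exhaust them.\<close>
  define S :: "nat set" where "S = (\<lambda>i. 4 * i + 1) ` {..<2 ^ (M - 2)}"
  have cardS: "card S = 2 ^ (M - 2)" unfolding S_def by (subst card_image) (auto simp: inj_on_def)
  have M4: "(2 :: nat) ^ M = 4 * 2 ^ (M - 2)" 
  proof -
    have "(2 :: nat) ^ (2 + (M - 2)) = 2 ^ 2 * 2 ^ (M - 2)" by (rule power_add)
    moreover have "2 + (M - 2) = M" using M by simp
    ultimately have "(2 :: nat) ^ M = 2 ^ 2 * 2 ^ (M - 2)" by (simp only:)
    then show ?thesis by simp
  qed
  have S: "x \<in> S" if "x < 2 ^ M" "x mod 4 = 1" for x :: nat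
  proof -
    have "x = 4 * (x div 4) + 1" using that(2) by (metis mult_div_mod_eq)
    moreover have "x div 4 < 2 ^ (M - 2)" using that(1) unfolding M4 by (simp add: less_mult_imp_div_less mult.commute)
    ultimately show ?thesis unfolding S_def by blast
  qed
  have ord: "ord (2 ^ M) (5 :: nat) = 2 ^ (M - 2)" using ord_twopow_3_5[OF M, of 5] by simp
  have "inj_on (\<lambda>i. (5 :: nat) ^ i mod 2 ^ M) {..<2 ^ (M - 2)}"
    using inj_power_mod[of "2 ^ M" 5] ord by simp
  then have "card ((\<lambda>i. (5 :: nat) ^ i mod 2 ^ M) ` {..<2 ^ (M - 2)}) = card S"
    using cardS by (simp add: card_image)
  moreover have "(\<lambda>i. (5 :: nat) ^ i mod 2 ^ M) ` {..<2 ^ (M - 2)} \<subseteq> S"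
  proof safe
    fix i
    have "(5 :: nat) ^ i mod 2 ^ M mod 4 = 5 ^ i mod 4" by (rule mod_mod_cancel) (simp add: M4)
    also have "\<dots> = (5 mod 4) ^ i mod 4" by (rule power_mod[symmetric])
    also have "\<dots> = 1" by simp
    finally show "(5 :: nat) ^ i mod 2 ^ M \<in> S" by (intro S) simp_all
  qed
  moreover have "finite S" unfolding S_def by simp
  ultimately have img: "(\<lambda>i. (5 :: nat) ^ i mod 2 ^ M) ` {..<2 ^ (M - 2)} = S"
    using card_subset_eq by blast
  define x where "x = nat (m mod 2 ^ M)"
  have x: "int x = m mod 2 ^ M" unfolding x_def by simp
  have "int x mod 4 = 1"
  proof -
    have "(4 :: int) dvd 2 ^ M" using le_imp_power_dvd[of 2 M "2 :: int"] M by simp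
    then show ?thesis unfolding x using m by (simp add: mod_mod_cancel)
  qed
  then have "int (x mod 4) = int 1" by (simp add: of_nat_mod)
  then have "x mod 4 = 1" by (simp only: of_nat_eq_iff)
  moreover have "int x < int (2 ^ M)" unfolding x by simp
  ultimately have "x \<in> S" using S by simp
  then obtain a where "x = 5 ^ a mod 2 ^ M" using img by auto
  then have "int (5 ^ a mod 2 ^ M) = m mod 2 ^ M" using x by simp
  then have "(5 ^ a :: int) mod 2 ^ M = m mod 2 ^ M" by (simp add: of_nat_mod)
  then show ?thesis using that[of a] by (simp add: mod_eq_dvd_iff)
qed

lemma dvd_power_of_5_minus_1:
  fixes a q :: nat
  assumes "q \<ge> 3"
  shows "(2 :: int) ^ q dvd 5 ^ a - 1 \<longleftrightarrow> 2 ^ (q - 2) dvd a"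
proof -
  have "(2 :: int) ^ q dvd 5 ^ a - 1 \<longleftrightarrow> [int (5 ^ a) = int 1] (mod int (2 ^ q))"
    by (simp add: cong_iff_dvd_diff)
  also have "\<dots> \<longleftrightarrow> [5 ^ a = (1 :: nat)] (mod 2 ^ q)" by (rule cong_int_iff)
  also have "\<dots> \<longleftrightarrow> ord (2 ^ q) (5 :: nat) dvd a" by (rule ord_divides)
  also have "ord (2 ^ q) (5 :: nat) = 2 ^ (q - 2)" using ord_twopow_3_5[OF assms, of 5] by simp
  finally show ?thesis .
qed

lemma four_dvd_odd_power_minus_1:
  fixes x :: int
  assumes "odd x" "i > 0"
  shows "4 dvd x ^ 2 ^ i - 1"
proof -
  obtain y where "x = 2 * y + 1" using assms(1) by (elim oddE)
  then have "x ^ 2 - 1 = 4 * (y * y + y)" by (simp add: power2_eq_square algebra_simps)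
  then have "4 dvd (x ^ 2) ^ 2 ^ (i - 1) - 1 ^ 2 ^ (i - 1)" by (intro dvd_cong_power) simp
  moreover have "(2 :: nat) ^ i = 2 * 2 ^ (i - 1)" using assms(2) by (simp add: power_eq_if)
  ultimately show ?thesis by (simp add: power_mult)
qed

text \<open>If \<open>v\<^sub>2(m - 1) = s + 1\<close> with \<open>1 \<le> s \<le> k\<close>, then \<open>m\<close> is a \<open>2 ^ (s - 1)\<close>-th but not
  a \<open>2 ^ s\<close>-th power 2-adically; the missing square root lies in the unramified quadratic extension.\<close>
lemma factor_chain_two_unramified:
  fixes m :: int
  assumes s: "2 ^ (s + 1) dvd m - 1" "\<not> 2 ^ (s + 2) dvd m - 1" and s1: "1 \<le> s"
  shows "\<exists>D c \<beta>. factor_chain 2 D c (2 ^ f) s \<beta>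
    \<and> algebraic_int ((c ^ (2 ^ s) - of_int m) / of_nat 2 ^ M)"
proof -
  define M' where "M' = max M (s + 2)"
  have "4 dvd m - 1" using s(1) s1 le_imp_power_dvd[of 2 "s + 1" "2 :: int"] dvd_trans by auto
  then have m4: "m mod 4 = 1" by presburger
  have M'3: "M' \<ge> 3" unfolding M'_def using s1 by simp
  obtain a where a: "2 ^ M' dvd 5 ^ a - m" using power_of_5_exists[OF M'3 m4] .
  have iff: "2 ^ q dvd m - 1 \<longleftrightarrow> 2 ^ (q - 2) dvd a" if q: "q \<ge> 3" "q \<le> M'" for q
  proof -
    have "2 ^ q dvd 5 ^ a - m" using a q(2) le_imp_power_dvd dvd_trans by blast
    then have "2 ^ q dvd m - 1 \<longleftrightarrow> (2 :: int) ^ q dvd 5 ^ a - 1"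
      using dvd_add_right_iff[of "2 ^ q" "5 ^ a - m" "m - 1"] by simp
    then show ?thesis using dvd_power_of_5_minus_1[OF q(1)] by simp
  qed
  have "2 ^ (s - 1) dvd a"
  proof (cases "s = 1")
    case False
    then show ?thesis using iff[of "s + 1"] s(1) s1 unfolding M'_def by simp
  qed simp
  then obtain a' where a': "a = 2 ^ (s - 1) * a'" ..
  have "\<not> 2 ^ s dvd a" using iff[of "s + 2"] s(2) s1 unfolding M'_def by simp
  moreover have "(2 :: nat) ^ s = 2 ^ (s - 1) * 2" using s1 by (simp add: power_eq_if)
  ultimately have "odd a'" unfolding a' by auto
  then obtain b where b: "a' = 2 * b + 1" by (elim oddE)
  define c0 where "c0 = (5 :: int) ^ a'"
  \<comment> \<open>As \<open>a'\<close> is odd, \<open>c0 = 5 * 25 ^ b\<close> is 5 modulo 8, which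
    makes the \<open>t\<close> in \<open>c0 = 1 + 4 * t\<close> odd.\<close>
  have "8 dvd (25 :: int) ^ b - 1 ^ b" by (rule dvd_cong_power) simp
  then obtain h where "(25 :: int) ^ b = 1 + 8 * h" by (auto simp: dvd_def algebra_simps)
  then have "c0 = 1 + 4 * (1 + 10 * h)" unfolding c0_def b by (simp add: power_mult)
  then obtain t where t: "c0 = 1 + 4 * t" "odd t" by (metis dvd_add_right_iff even_mult_iff even_numeral odd_add odd_one even_add)
  \<comment> \<open>\<gamma> is the missing square root, and \<open>w\<close> generates the
    unramified ring that contains it: \<open>w ^ 2 - w = t\<close> with \<open>t\<close>
    odd.\<close>
  define \<gamma> w where "\<gamma> = csqrt (of_int c0)" and "w = (1 + \<gamma>) / 2"
  have \<gamma>2: "\<gamma> ^ 2 = of_int c0" unfolding \<gamma>_def by simp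
  have \<gamma>w: "\<gamma> = 2 * w - 1" unfolding w_def by (simp add: add_divide_distrib)
  have w2: "w ^ 2 = w + of_int t"
  proof -
    have "4 * w ^ 2 = 1 + 2 * \<gamma> + \<gamma> ^ 2" unfolding w_def by (simp add: power2_eq_square algebra_simps)
    also have "\<dots> = 4 * (w + of_int t)" unfolding \<gamma>2 t(1) w_def by simp
    finally have "4 * w ^ 2 = 4 * (w + of_int t)" .
    then show ?thesis by (subst (asm) mult_cancel_left) simp
  qed
  define D where "D = {of_int x + of_int y * w | x y. True}"
  interpret coefficient_ring 2 D
    unfolding D_def by (rule coefficient_ring_quadratic[OF w2 t(2)])
  have two: "of_nat 2 = (2 :: complex)" by simp
  have w_int: "algebraic_int w"
  proof (rule integralD)
    have "of_int 0 + of_int 1 * w \<in> D" unfolding D_def by blast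
    then show "w \<in> D" by simp
  qed
  have w1_int: "algebraic_int (w - 1)" using w_int by (intro algebraic_int_closed) auto
  have \<gamma>D: "\<gamma> \<in> D"
  proof -
    have "of_int (- 1) + of_int 2 * w \<in> D" unfolding D_def by blast
    then show ?thesis by (simp add: \<gamma>w)
  qed
  have "unit_at 2 (of_int c0)" by (rule unit_at_of_int) (use t(1) in auto)
  then have \<gamma>_unit: "unit_at 2 \<gamma>"
    using unit_at_of_unit_mult[of 2 \<gamma> \<gamma>] integralD[OF \<gamma>D] \<gamma>2 by (simp add: power2_eq_square)
  have "unit_at 2 (of_int t)" by (rule unit_at_of_int) (use t(2) in auto)
  \<comment> \<open>The product is the odd number \<open>t\<close>, so both factors are units. They
    are what remains after halving: \<open>w - 1\<close> in the base condition and \<open>w\<close>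
    in the step for \<open>j = 0\<close>.\<close>
  then have "unit_at 2 (w * (w - 1))" using w2 by (simp add: power2_eq_square algebra_simps)
  then have w_unit: "unit_at 2 w" "unit_at 2 (w - 1)"
    using unit_at_of_unit_mult[of 2 w "w - 1"] unit_at_of_unit_mult[of 2 "w - 1" w] w_int w1_int
    by (simp_all add: mult.commute)
  have even_power: "\<exists>v. \<gamma> ^ 2 ^ i = 1 + 4 * of_int v" if "i > 0" for i
  proof -
    have "(2 :: nat) ^ i = 2 * 2 ^ (i - 1)" using that by (simp add: power_eq_if)
    then have *: "\<gamma> ^ 2 ^ i = of_int (c0 ^ 2 ^ (i - 1))" using \<gamma>2 by (simp add: power_mult)
    have "4 dvd c0 ^ 2 ^ (i - 1) - 1 ^ 2 ^ (i - 1)" by (rule dvd_cong_power) (simp add: t(1))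
    then obtain v where "c0 ^ 2 ^ (i - 1) = 1 + 4 * v" by (auto simp: dvd_def algebra_simps)
    then show ?thesis unfolding * by (intro exI[of _ v]) simp
  qed
  have plus_even: "unit_at 2 (u + 2 * of_int v)" if "unit_at 2 u" for u v
    using unit_at_add_top_nil[OF _ that top_nil_p_mult[of 2 "of_int v"]] by simp
  obtain \<beta> where \<beta>: "factor_chain 2 D \<gamma> (2 ^ f) s \<beta>"
  proof (rule factor_chain_exists[OF \<gamma>D \<gamma>_unit])
    show "f = 0 \<or> (\<exists>u. \<gamma> - \<gamma> ^ 2 ^ f = of_nat 2 * u \<and> unit_at 2 u)"
    proof (cases "f = 0")
      case False
      then obtain v where v: "\<gamma> ^ 2 ^ f = 1 + 4 * of_int v" using even_power[of f] by auto
      have "\<gamma> - \<gamma> ^ 2 ^ f = of_nat 2 * ((w - 1) + 2 * of_int (- v))" unfolding v by (simp add: \<gamma>w)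
      then show ?thesis using plus_even[OF w_unit(2)] by blast
    qed simp
    fix j
    show "\<exists>y. algebraic_int y \<and> \<gamma> ^ 2 ^ (f + j) = \<gamma> ^ 2 ^ j + of_nat 2 * y
        \<and> (2 = 2 \<longrightarrow> unit_at 2 (\<gamma> ^ 2 ^ j + y))"
    proof (cases "f = 0")
      case True
      then show ?thesis using \<gamma>_unit by (intro exI[of _ 0]) (simp add: unit_at_power)
    next
      case False
      then obtain v where v: "\<gamma> ^ 2 ^ (f + j) = 1 + 4 * of_int v" using even_power[of "f + j"] by auto
      \<comment> \<open>For \<open>j = 0\<close> the power of \<gamma> is \<open>2 * w - 1\<close>
        and the resulting unit is \<open>w\<close> modulo 2. For \<open>j > 0\<close> both powers
        are integers congruent to 1 modulo 4, and the unit is 1 modulo 2.\<close>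
      show ?thesis
      proof (cases "j = 0")
        case True
        define y where "y = - (w - 1) + 2 * of_int v"
        have "algebraic_int y"
          unfolding y_def using algebraic_int_minus[OF w1_int] algebraic_int_of_int[of "2 * v"]
          by (intro algebraic_int_plus_times(1)) simp_all
        moreover have "\<gamma> ^ 2 ^ (f + j) = \<gamma> ^ 2 ^ j + of_nat 2 * y"
          unfolding v using True by (simp add: y_def \<gamma>w)
        moreover have "\<gamma> ^ 2 ^ j + y = w + 2 * of_int v" using True by (simp add: y_def \<gamma>w)
        ultimately show ?thesis using plus_even[OF w_unit(1)] by metis
      next
        case False
        then obtain v' where v': "\<gamma> ^ 2 ^ j = 1 + 4 * of_int v'" using even_power[of j] by auto
        define y :: complex where "y = 2 * of_int (v - v')"
        have "algebraic_int y" unfolding y_def using algebraic_int_of_int[of "2 * (v - v')"] by simp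
        moreover have "\<gamma> ^ 2 ^ (f + j) = \<gamma> ^ 2 ^ j + of_nat 2 * y"
          unfolding v v' by (simp add: y_def)
        moreover have "\<gamma> ^ 2 ^ j + y = 1 + 2 * of_int (v + v')" unfolding v' by (simp add: y_def)
        ultimately show ?thesis using plus_even[OF unit_at_1] by metis
      qed
    qed
  qed
  have "\<gamma> ^ 2 ^ s = of_int (5 ^ a)"
  proof -
    have "(2 :: nat) ^ s = 2 * 2 ^ (s - 1)" using s1 by (simp add: power_eq_if)
    then have "\<gamma> ^ 2 ^ s = of_int (c0 ^ 2 ^ (s - 1))" using \<gamma>2 by (simp add: power_mult)
    then show ?thesis unfolding c0_def a' by (simp add: mult.commute flip: power_mult)
  qed
  moreover have "2 ^ M dvd 5 ^ a - m"
    using a le_imp_power_dvd[of M M' "2 :: int"] dvd_trans unfolding M'_def by auto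
  then have "algebraic_int (of_int (5 ^ a - m) / of_int (2 ^ M) :: complex)"
    by (rule algebraic_int_of_dvd)
  ultimately have "algebraic_int ((\<gamma> ^ 2 ^ s - of_int m) / of_nat 2 ^ M)" by simp
  with \<beta> show ?thesis by blast
qed

text \<open>For \<open>i > 0\<close> an odd \<open>m\<close> is 2-adically a \<open>2 ^ i\<close>-th
  power of some power of 5 only if \<open>2 ^ (i + 2)\<close> divides \<open>m - 1\<close>. For
  \<open>s > k\<close> this holds with \<open>i = k\<close> and an integer root suffices; for
  \<open>s = 0\<close> no root is extracted and \<open>c = m\<close>; between them one square root
  is missing.\<close>

lemma factor_chain_two:
  fixes m :: int
  assumes m: "odd m" and s: "2 ^ (s + 1) dvd m ^ 2 - m" "\<not> 2 ^ (s + 2) dvd m ^ 2 - m"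
    and s': "s' = min s k" and k: "k > 0"
  shows "\<exists>D c \<beta>. factor_chain 2 D c (2 ^ (k - s')) s' \<beta>
    \<and> algebraic_int ((c ^ (2 ^ s') - of_int m) / of_nat 2 ^ M)"
proof -
  have s: "2 ^ (s + 1) dvd m - 1" "\<not> 2 ^ (s + 2) dvd m - 1"
    using s dvd_power_prime_minus_self_iff[of 2 m "s + 1"]
      dvd_power_prime_minus_self_iff[of 2 m "s + 2"] m by simp_all
  interpret Z: coefficient_ring 2 \<int> by (rule coefficient_ring_Ints) simp
  consider "s = 0" | "1 \<le> s" "s \<le> k" | "s \<ge> k + 1" by linarith
  then show ?thesis
  proof cases
    case 1
    have m_unit: "unit_at 2 (of_int m)" by (rule unit_at_of_int) (use m in auto)
    obtain \<beta> where "factor_chain 2 \<int> (of_int m) (2 ^ k) 0 \<beta>"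
    proof (rule Z.factor_chain_exists[OF _ m_unit])
      \<comment> \<open>Here \<open>m\<close> is 3 and \<open>m ^ 2 ^ k\<close> is 1 modulo 4, so
        their difference is twice an odd number.\<close>
      have "4 dvd m ^ 2 ^ k - 1" by (rule four_dvd_odd_power_minus_1[OF m k])
      moreover have "\<not> 4 dvd m - 1" "2 dvd m - 1" using s 1 by simp_all
      moreover define y where "y = m ^ 2 ^ k"
      ultimately have "even (m - y)" "\<not> 4 dvd m - y" by presburger+
      then obtain u where "m - y = 2 * u" by (elim evenE)
      moreover from this \<open>\<not> 4 dvd m - y\<close> have "odd u" by presburger
      ultimately have u: "m - m ^ 2 ^ k = 2 * u" "odd u" unfolding y_def by auto
      then have "of_int m - of_int m ^ 2 ^ k = (of_nat 2 * of_int u :: complex)"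
        by (metis of_int_diff of_int_mult of_int_numeral of_int_power of_nat_numeral)
      moreover have "unit_at 2 (of_int u)" by (rule unit_at_of_int) (use u(2) in auto)
      ultimately show "k = 0 \<or> (\<exists>u. of_int m - of_int m ^ 2 ^ k = of_nat 2 * u \<and> unit_at 2 u)" by blast
    qed auto
    then show ?thesis using 1 s' by (intro exI[of _ \<int>] exI[of _ "of_int m"] exI[of _ \<beta>]) simp
  next
    case 2
    then show ?thesis using factor_chain_two_unramified[OF s] s' by simp
  next
    case 3
    define M' where "M' = max M (s + 2)"
    have "4 dvd m - 1" using s(1) 3 le_imp_power_dvd[of 2 "s + 1" "2 :: int"] dvd_trans by auto
    then have m4: "m mod 4 = 1" by presburger
    have M'3: "M' \<ge> 3" unfolding M'_def using 3 by simp
    obtain a where a: "2 ^ M' dvd 5 ^ a - m" using power_of_5_exists[OF M'3 m4] .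
    have "2 ^ (s + 1) dvd 5 ^ a - m"
      using a le_imp_power_dvd[of "s + 1" M' "2 :: int"] dvd_trans unfolding M'_def by auto
    then have "2 ^ (s + 1) dvd (5 ^ a - m) + (m - 1)" using s(1) by (rule dvd_add)
    then have "2 ^ (s - 1) dvd a" using dvd_power_of_5_minus_1[of "s + 1" a] 3 k by simp
    then have "2 ^ k dvd a" using 3 le_imp_power_dvd[of k "s - 1" "2 :: nat"] dvd_trans by auto
    then obtain a' where a': "a = 2 ^ k * a'" ..
    define c where "c = (5 :: int) ^ a'"
    have c_unit: "unit_at 2 (of_int c)" by (rule unit_at_of_int) (auto simp: c_def)
    obtain \<beta> where "factor_chain 2 \<int> (of_int c) (2 ^ 0) k \<beta>"
    proof (rule Z.factor_chain_exists[OF _ c_unit])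
      show "\<exists>y. algebraic_int y \<and> of_int c ^ 2 ^ (0 + j) = of_int c ^ 2 ^ j + of_nat 2 * y
        \<and> (2 = 2 \<longrightarrow> unit_at 2 (of_int c ^ 2 ^ j + y))" for j
        using c_unit by (intro exI[of _ 0]) (simp add: unit_at_power)
    qed auto
    moreover have "2 ^ M dvd c ^ 2 ^ k - m"
      using a le_imp_power_dvd[of M M' "2 :: int"] dvd_trans
      unfolding M'_def c_def a' by (auto simp: mult.commute simp flip: power_mult)
    then have "algebraic_int (of_int (c ^ 2 ^ k - m) / of_int (2 ^ M) :: complex)"
      by (rule algebraic_int_of_dvd)
    ultimately show ?thesis using 3 s' by (intro exI[of _ \<int>] exI[of _ "of_int c"] exI[of _ \<beta>]) simp
  qed
qed

context radical_root
begin

lemma leading_coefficient_bound_at_prime: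
  assumes n: "n = p ^ k" and k: "k > 0" and p: "prime p" and pm: "\<not> int p dvd m"
    and s: "s = multiplicity (int p) (m ^ p - m) - 1" and s': "s' = min s k"
    and P: "coeffs_in \<rat> P" "degree P \<le> d" "algebraic_int (poly P \<alpha>)" and d: "d < n"
    and t: "t \<le> s'" "t = s' \<or> d + p ^ (k - t - 1) < p ^ k"
  shows "of_nat (p ^ t) * coeff P d \<in> \<int>"
proof -
  have p1: "p > 1" using p prime_gt_1_nat by blast
  have nz: "m ^ p - m \<noteq> 0"
  proof
    assume "m ^ p - m = 0"
    then have "m * m ^ (p - 1) = m * 1" using p1 by (simp add: power_eq_if)
    then have "m ^ (p - 1) = 1" using m_nonzero by (simp only: mult_cancel_left) simp
    then have "is_unit m" using p1 by (metis dvd_power is_unit_power_iff zero_less_diff dvd_refl)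
    then show False using m_neq by (auto simp: zdvd1_eq)
  qed
  \<comment> \<open>By Fermat the multiplicity is positive, so the truncated subtraction in
    \<open>s\<close> is exact and the multiplicity equals \<open>s + 1\<close>.\<close>
  have "int p dvd m ^ p - m"
  proof -
    have "[m ^ (p - 1) = 1] (mod int p)"
    proof -
      have "coprime (nat (m mod int p)) p"
      proof -
        have "\<not> int p dvd m mod int p" using pm by (simp add: dvd_mod_iff)
        then have "coprime (int p) (m mod int p)" using p by (simp add: prime_imp_coprime)
        moreover have "int (nat (m mod int p)) = m mod int p" using p1 by simp
        ultimately have "coprime (int p) (int (nat (m mod int p)))" by simp
        then show ?thesis by (simp only: coprime_int_iff coprime_commute)
      qed
      then have "[nat (m mod int p) ^ totient p = 1] (mod p)" by (rule euler_theorem)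
      then have "[int (nat (m mod int p) ^ (p - 1)) = int 1] (mod int p)"
        using p by (simp only: cong_int_iff totient_prime)
      then have "[(m mod int p) ^ (p - 1) = 1] (mod int p)" using p1 by simp
      then show ?thesis by (simp add: cong_def power_mod)
    qed
    then have "int p ^ 1 dvd m ^ (p - 1) - 1" by (simp add: cong_iff_dvd_diff)
    then have "int p ^ 1 dvd m ^ p - m" using dvd_power_prime_minus_self_iff[OF p pm] by blast
    then show ?thesis by simp
  qed
  moreover have dvd_iff: "int p ^ q dvd m ^ p - m \<longleftrightarrow> q \<le> multiplicity (int p) (m ^ p - m)" for q
    using p p1 nz by (intro power_dvd_iff_le_multiplicity) auto
  ultimately have "multiplicity (int p) (m ^ p - m) = s + 1"
    using s dvd_iff[of 1] by simp
  then have s_dvd: "int p ^ (s + 1) dvd m ^ p - m" "\<not> int p ^ (s + 2) dvd m ^ p - m"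
    unfolding dvd_iff by simp_all
  have chain: "\<exists>D c \<beta>. factor_chain p D c (p ^ (k - s')) s' \<beta>
    \<and> algebraic_int ((c ^ (p ^ s') - of_int m) / of_nat p ^ M)" for M
  proof (cases "p = 2")
    case True
    then show ?thesis using factor_chain_two[of m s s' k M] pm s_dvd s' k by simp
  next
    case False
    then have "odd p" using p prime_odd_nat p1 by auto
    then show ?thesis using factor_chain_odd[OF p _ pm s_dvd s'] by blast
  qed
  have "coeffs_in \<int> (smult (of_nat n) P)"
    using denominator_dvd_degree[OF P(1) _ P(3)] P(2) d by simp
  then have PL: "coeffs_in (localize p \<int>) P"
    unfolding coeffs_in_def localize_def n by (auto intro!: exI[of _ k])
  \<comment> \<open>The required precision \<open>l\<close> is known only now that \<open>P\<close>
    is given, and the chain is chosen for it.\<close>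
  obtain l where l: "\<And>\<beta> :: complex. algebraic_int \<beta> \<Longrightarrow>
      algebraic_int ((\<beta> ^ n - of_int m) / of_nat p ^ l) \<Longrightarrow> algebraic_int (poly P \<beta>)"
    using algebraic_int_transfer[OF _ PL P(3)] p1 by auto
  obtain D c \<beta> where fc: "factor_chain p D c (p ^ (k - s')) s' \<beta>"
    and approx: "algebraic_int ((c ^ (p ^ s') - of_int m) / of_nat p ^ l)"
    using chain[of l] by blast
  interpret factor_chain p D c "p ^ (k - s')" s' \<beta> by (rule fc)
  have deg: "p ^ (k - s') * p ^ s' = n" unfolding n s' by (simp flip: power_add)
  have "\<int> \<subseteq> D" using is_subringD(10)[OF subring] by (auto elim!: Ints_cases)
  then have "coeffs_in (localize p D) P" using PL unfolding coeffs_in_def localize_def by blast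
  then have "of_nat p ^ t * coeff P d \<in> D"
  proof (rule leading_coefficient_bound[OF order.refl _ P(2)])
    show "d < p ^ (k - s') * p ^ s'" using d deg by simp
    show "t \<le> s'" by (rule t(1))
    show "t = s' \<or> d + p ^ (k - s') * p ^ (s' - t - 1) < p ^ (k - s') * p ^ s'"
    proof (cases "t = s'")
      case False
      moreover have "s' \<le> k" using s' by simp
      ultimately have "k - t - 1 = (k - s') + (s' - t - 1)" using t(1) by simp
      then show ?thesis using t(2) False deg n by (simp add: power_add)
    qed simp
    fix j assume j: "j \<le> s'"
    have "\<beta> j ^ n = c ^ p ^ s'" using \<beta>_power[OF j j] deg by simp
    then show "algebraic_int (poly P (\<beta> j))" using l[OF \<beta>_int[OF j]] approx by simp
  qed
  then have "algebraic_int (of_nat (p ^ t) * coeff P d)" using integralD by simp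
  moreover have "of_nat (p ^ t) * coeff P d \<in> \<rat>" using coeffs_inD[OF P(1)] by (intro Rats_mult Rats_of_nat)
  ultimately show ?thesis using rational_algebraic_int_is_int by blast
qed

section \<open>Integral bases from polynomials of distinct degrees\<close>

lemma simple_ext_eq: "simple_ext \<alpha> = {poly P \<alpha> | P. coeffs_in \<rat> P}"
proof (intro equalityI subsetI)
  fix x assume "x \<in> simple_ext \<alpha>"
  then obtain q where "x = poly (map_poly of_rat q) \<alpha>" unfolding simple_ext_def by blast
  moreover have "coeffs_in \<rat> (map_poly of_rat q)" by (simp add: coeffs_in_def coeff_map_poly)
  ultimately show "x \<in> {poly P \<alpha> | P. coeffs_in \<rat> P}" by blast
next
  fix x assume "x \<in> {poly P \<alpha> | P. coeffs_in \<rat> P}"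
  then obtain P where P: "coeffs_in \<rat> P" "x = poly P \<alpha>" by blast
  have "\<forall>y :: complex. \<exists>q. y \<in> \<rat> \<longrightarrow> y = of_rat q" by (auto elim!: Rats_cases)
  then obtain f :: "complex \<Rightarrow> rat" where f: "\<And>y. y \<in> \<rat> \<Longrightarrow> y = of_rat (f y)" by metis
  have f0: "f 0 = 0" using f[of 0] by simp
  have "map_poly of_rat (map_poly f P) = P"
    by (rule poly_eqI) (use f[symmetric] P(1) f0 in \<open>simp add: coeff_map_poly coeffs_in_def\<close>)
  then show "x \<in> simple_ext \<alpha>" unfolding simple_ext_def P(2) by (metis (mono_tags, lifting) mem_Collect_eq)
qed

text \<open>By \<open>lead\<close> the leading coefficient of an integral
  \<open>poly P \<alpha>\<close> is an integer multiple of that of the \<open>T i\<close> of the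
  same degree; subtracting this multiple lowers the degree, which gives existence. In a relation
  with nonzero coefficients the term of highest degree cannot cancel, since the degrees are distinct
  and at most \<open>n - 1\<close>.\<close>

lemma integral_basis_triangular:
  fixes T :: "'i \<Rightarrow> complex poly" and b :: "'i \<Rightarrow> complex"
  assumes fin: "finite I" and T: "\<And>i. i \<in> I \<Longrightarrow> coeffs_in \<rat> (T i)" "\<And>i. i \<in> I \<Longrightarrow> T i \<noteq> 0"
    and b: "\<And>i. i \<in> I \<Longrightarrow> b i = poly (T i) \<alpha>" "\<And>i. i \<in> I \<Longrightarrow> algebraic_int (b i)"
    and bij: "bij_betw (\<lambda>i. degree (T i)) I {..<n}"
    and lead: "\<And>P i. coeffs_in \<rat> P \<Longrightarrow> i \<in> I \<Longrightarrow> degree P \<le> degree (T i) \<Longrightarrow>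
      algebraic_int (poly P \<alpha>) \<Longrightarrow> coeff P (degree (T i)) / lead_coeff (T i) \<in> \<int>"
  shows "integral_basis (simple_ext \<alpha>) b I"
proof -
  have deg: "degree (T i) < n" if "i \<in> I" for i using bij_betw_apply[OF bij that] by simp
  have exist: "\<exists>c :: 'i \<Rightarrow> int. (\<forall>i. i \<notin> I \<longrightarrow> c i = 0) \<and> poly P \<alpha> = (\<Sum>i\<in>I. of_int (c i) * b i)"
    if "d \<le> n" "coeffs_in \<rat> P" "\<forall>e\<ge>d. coeff P e = 0" "algebraic_int (poly P \<alpha>)" for d P
    using that
  proof (induction d arbitrary: P)
    case 0
    then have "P = 0" by (auto intro: poly_eqI)
    then show ?case by (intro exI[of _ "\<lambda>_. 0"]) simp
  next
    case (Suc d)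
    obtain i where i: "i \<in> I" "degree (T i) = d"
      using bij_betw_imp_surj_on[OF bij] Suc.prems(1) by (metis Suc_le_eq imageE lessThan_iff)
    have degP: "degree P \<le> d" by (rule degree_le) (use Suc.prems(3) in auto)
    then obtain z where z: "coeff P d / lead_coeff (T i) = of_int z"
      using lead[OF Suc.prems(2) i(1)] i(2) Suc.prems(4) by (auto elim!: Ints_cases)
    define P' where "P' = P - smult (of_int z) (T i)"
    have "\<exists>c :: 'i \<Rightarrow> int. (\<forall>i. i \<notin> I \<longrightarrow> c i = 0) \<and> poly P' \<alpha> = (\<Sum>i\<in>I. of_int (c i) * b i)"
    proof (rule Suc.IH)
      show "d \<le> n" using Suc.prems(1) by simp
      show "coeffs_in \<rat> P'"
        unfolding P'_def using Suc.prems(2) T(1)[OF i(1)]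
        by (intro coeffs_in_closed[OF is_subring_Rats]) auto
      have "coeff (T i) d \<noteq> 0" using T(2)[OF i(1)] i(2) by auto
      then have "coeff P' d = 0"
        using z i(2) by (simp add: P'_def field_simps)
      moreover have "coeff P' e = 0" if "e > d" for e
        using that Suc.prems(3) i(2) by (simp add: P'_def coeff_eq_0)
      ultimately show "\<forall>e\<ge>d. coeff P' e = 0" by (metis le_neq_implies_less)
      have "poly P' \<alpha> = poly P \<alpha> - of_int z * b i" using b(1)[OF i(1)] by (simp add: P'_def)
      also have "algebraic_int \<dots>"
        using Suc.prems(4) b(2)[OF i(1)] by (intro algebraic_int_closed) auto
      finally show "algebraic_int (poly P' \<alpha>)" .
    qed
    then obtain c where c: "\<forall>i. i \<notin> I \<longrightarrow> c i = 0" "poly P' \<alpha> = (\<Sum>i\<in>I. of_int (c i) * b i)" by blast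
    define c' where "c' = c(i := c i + z)"
    have "(\<Sum>j\<in>I. of_int (c' j) * b j) = (\<Sum>j\<in>I. of_int (c j) * b j + (if j = i then of_int z * b i else 0))"
      by (intro sum.cong refl) (auto simp: c'_def algebra_simps)
    also have "\<dots> = poly P' \<alpha> + of_int z * b i" using c(2) i(1) fin by (simp add: sum.distrib)
    also have "\<dots> = poly P \<alpha>" using b(1)[OF i(1)] by (simp add: P'_def)
    finally show ?case using c(1) i(1) by (intro exI[of _ c']) (auto simp: c'_def)
  qed
  have unique: "c i = 0" if zero: "(\<Sum>i\<in>I. of_int (c i) * b i) = 0" and "i \<in> I" for c :: "'i \<Rightarrow> int" and i
  proof (rule ccontr)
    assume "c i \<noteq> 0"
    define S where "S = {i\<in>I. c i \<noteq> 0}"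
    have S: "finite S" "S \<noteq> {}" unfolding S_def using fin \<open>i \<in> I\<close> \<open>c i \<noteq> 0\<close> by auto
    obtain j where j: "j \<in> S" "\<And>l. l \<in> S \<Longrightarrow> degree (T l) \<le> degree (T j)"
    proof -
      have "Max ((\<lambda>l. degree (T l)) ` S) \<in> (\<lambda>l. degree (T l)) ` S" using S by (intro Max_in) auto
      then obtain j where "j \<in> S" "degree (T j) = Max ((\<lambda>l. degree (T l)) ` S)" by auto
      then show ?thesis using that[of j] S by simp
    qed
    define Q where "Q = (\<Sum>i\<in>I. smult (of_int (c i)) (T i))"
    have "coeffs_in \<rat> Q"
      unfolding Q_def using T(1) by (intro coeffs_in_sum coeffs_in_closed is_subring_Rats) auto
    moreover have "degree Q < n"
      unfolding Q_def
    proof (rule degree_sum_less)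
      show "degree (smult (of_int (c i)) (T i)) < n" if "i \<in> I" for i
        using deg[OF that] degree_smult_le order.strict_trans1 by blast
    qed (rule n_pos)
    moreover have "poly Q \<alpha> = 0"
      using zero b(1) by (simp add: Q_def poly_sum)
    ultimately have Q0: "Q = 0" by (rule poly_alpha_eq_0)
    have jI: "j \<in> I" "c j \<noteq> 0" using j(1) unfolding S_def by auto
    have "coeff Q (degree (T j)) = (\<Sum>l\<in>I. of_int (c l) * coeff (T l) (degree (T j)))"
      by (simp add: Q_def coeff_sum)
    also have "\<dots> = (\<Sum>l\<in>I. if l = j then of_int (c j) * lead_coeff (T j) else 0)"
    proof (intro sum.cong refl)
      fix l assume l: "l \<in> I"
      show "of_int (c l) * coeff (T l) (degree (T j)) = (if l = j then of_int (c j) * lead_coeff (T j) else 0)"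
      proof (cases "l = j \<or> c l = 0")
        case False
        then have "degree (T l) \<le> degree (T j)" using j(2) l unfolding S_def by auto
        moreover have "degree (T l) \<noteq> degree (T j)"
          using False bij_betw_imp_inj_on[OF bij] l jI(1) by (auto simp: inj_on_def)
        ultimately show ?thesis using False by (simp add: coeff_eq_0)
      qed (use jI in auto)
    qed
    also have "\<dots> = of_int (c j) * lead_coeff (T j)" using fin jI(1) by simp
    finally show False using Q0 jI T(2) by simp
  qed
  have in_ext: "b i \<in> ring_of_integers (simple_ext \<alpha>)" if "i \<in> I" for i
    unfolding ring_of_integers_def simple_ext_eq using b T(1) that by auto
  show ?thesis
    unfolding integral_basis_def
  proof (intro conjI ballI fin in_ext)
    fix x assume x: "x \<in> ring_of_integers (simple_ext \<alpha>)"
    then obtain P where P: "coeffs_in \<rat> P" "x = poly P \<alpha>" and xi: "algebraic_int x"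
      unfolding ring_of_integers_def simple_ext_eq by auto
    define G where "G = (monom 1 n - [:of_int m:] :: complex poly)"
    have GQ: "coeffs_in \<rat> G"
      unfolding G_def by (intro coeffs_in_closed is_subring_Rats) auto
    have degG: "degree G = n" and leadG: "lead_coeff G = 1"
      unfolding G_def degree_radical_poly by (rule refl lead_coeff_radical_poly)+
    obtain Q R where QR: "coeffs_in \<rat> Q" "coeffs_in \<rat> R" "P = Q * G + R" "degree R < degree G"
      by (rule coeffs_in_division[OF is_subring_Rats GQ leadG _ P(1)]) (use degG n_pos in auto)
    have "poly G \<alpha> = 0" by (simp add: G_def poly_monom root)
    then have xR: "x = poly R \<alpha>" using P(2) QR(3) by simp
    obtain c :: "'i \<Rightarrow> int" where c: "\<forall>i. i \<notin> I \<longrightarrow> c i = 0" "x = (\<Sum>i\<in>I. of_int (c i) * b i)"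
      using exist[of n R] QR(2,4) degG xi xR by (auto simp: coeff_eq_0)
    show "\<exists>!c :: 'i \<Rightarrow> int. (\<forall>i. i \<notin> I \<longrightarrow> c i = 0) \<and> x = (\<Sum>i\<in>I. of_int (c i) * b i)"
    proof (rule ex1I[of _ c])
      fix c' :: "'i \<Rightarrow> int"
      assume c': "(\<forall>i. i \<notin> I \<longrightarrow> c' i = 0) \<and> x = (\<Sum>i\<in>I. of_int (c' i) * b i)"
      then have "(\<Sum>i\<in>I. of_int (c' i - c i) * b i) = 0"
        using c(2) by (simp add: left_diff_distrib sum_subtractf)
      then have "c' i - c i = 0" if "i \<in> I" for i using unique[of "\<lambda>i. c' i - c i"] that by blast
      then show "c' = c" using c(1) c' by (metis eq_iff_diff_eq_0 ext)
    qed (use c in blast)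
  qed
qed

end

section \<open>The integral basis\<close>

lemma algebraic_int_monic_relation:
  fixes x :: complex
  assumes "x ^ N = (\<Sum>i<N. of_int (a i) * x ^ i)" "N > 0"
  shows "algebraic_int x"
proof (rule algebraic_int_if_int_span_closed[where v = "\<lambda>l. x ^ l" and N = N])
  fix i assume i: "i < N"
  show "x * x ^ i \<in> int_span N (\<lambda>l. x ^ l)"
  proof (cases "Suc i = N")
    case True
    then show ?thesis using assms(1) unfolding int_span_def by auto
  next
    case False
    then show ?thesis using int_span_base[of "Suc i" N "\<lambda>l. x ^ l"] i by simp
  qed
qed (use assms(2) in auto)

text \<open>From \<open>j * (p ^ t choose j) = p ^ t * (p ^ t - 1 choose j - 1)\<close> the binomial
  coefficient lacks at most \<open>v_p(j)\<close> factors \<open>p\<close>, and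
  \<open>v_p(j) \<le> j - 1\<close>.\<close>

lemma prime_power_dvd_choose_mult_power:
  fixes p :: nat
  assumes p: "prime p" and j: "j > 0" "j \<le> p ^ t"
  shows "p ^ t dvd (p ^ t choose j) * p ^ (j - 1)"
proof -
  define v where "v = multiplicity p j"
  have p1: "p > 1" using p prime_gt_1_nat by blast
  obtain j' where j': "j = p ^ v * j'" "\<not> p dvd j'"
    using multiplicity_decompose'[of j p] j p1 unfolding v_def by auto
  have "v < 2 ^ v" by simp
  also have "(2 :: nat) ^ v \<le> p ^ v" using p1 by (intro power_mono) auto
  also have "p ^ v \<le> j" using j'(1) j(1) by (cases j') auto
  finally have v: "v \<le> j - 1" by simp
  define C where "C = (p ^ t choose j)"
  have "j * C = p ^ t * ((p ^ t - 1) choose (j - 1))"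
    unfolding C_def by (rule times_binomial_minus1_eq[OF j(1)])
  then have "p ^ t dvd j * C" by simp
  then have "p ^ t dvd j' * (p ^ v * C)" by (subst (asm) j'(1)) (simp add: mult_ac)
  moreover have "coprime (p ^ t) j'" using p j'(2) by (simp add: prime_imp_coprime)
  ultimately have "p ^ t dvd p ^ v * C" by (simp add: coprime_dvd_mult_right_iff)
  also have "\<dots> dvd p ^ (j - 1) * C"
    using v by (intro mult_dvd_mono le_imp_power_dvd) auto
  finally show ?thesis unfolding C_def by (simp add: mult.commute)
qed

text \<open>Let \<open>h\<close> be the sum, \<open>\<delta> = \<gamma> - r\<close> and
  \<open>c = m - r ^ N\<close>, so \<open>h * \<delta> = c\<close>. Multiplying the binomial
  expansion of \<open>(r + \<delta>) ^ N - r ^ N = c\<close> by \<open>h ^ N\<close> and cancelling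
  \<open>c\<close> gives a monic equation for \<open>h\<close>. Its coefficient at
  \<open>h ^ i\<close> is divisible by \<open>p ^ (t * (N - i))\<close>, so dividing by
  \<open>p ^ (t * N)\<close> leaves a monic integral equation for \<open>h / p ^ t\<close>.\<close>

lemma algebraic_int_divided_difference:
  fixes \<gamma> :: complex and r m :: int
  assumes p: "prime p" and N: "N = p ^ t" and \<gamma>: "algebraic_int \<gamma>" "\<gamma> ^ N = of_int m"
    and dvd: "int p ^ (t + 1) dvd m - r ^ N"
  shows "algebraic_int ((\<Sum>i<N. of_int r ^ i * \<gamma> ^ (N - 1 - i)) / of_nat N)"
proof -
  define h where "h = (\<Sum>i<N. of_int r ^ i * \<gamma> ^ (N - 1 - i))"
  define \<delta> where "\<delta> = \<gamma> - of_int r"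
  have N0: "N > 0" using N p prime_gt_0_nat by simp
  have h\<delta>: "h * \<delta> = of_int (m - r ^ N)"
  proof -
    have "of_int r ^ N - \<gamma> ^ N = (of_int r - \<gamma>) * h"
      unfolding h_def by (subst power_diff_sumr2) (simp add: mult.commute)
    then show ?thesis using \<gamma>(2) by (simp add: \<delta>_def algebra_simps)
  qed
  show ?thesis
  \<comment> \<open>In these cases \<open>c = 0\<close> and could not be cancelled.\<close>
  proof (cases "h = 0 \<or> \<delta> = 0")
    case True
    then show ?thesis
    proof
      assume "h = 0"
      then show ?thesis unfolding h_def[symmetric] by simp
    next
      assume "\<delta> = 0"
      then have "\<gamma> = of_int r" by (simp add: \<delta>_def)
      then have "h = (\<Sum>i<N. of_int r ^ (N - 1))"
        unfolding h_def by (intro sum.cong refl) (simp flip: power_add)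
      then show ?thesis unfolding h_def[symmetric] using N0 by (simp add: algebraic_int_power)
    qed
  next
    case False
    then have h0: "h \<noteq> 0" and \<delta>0: "\<delta> \<noteq> 0" by auto
    obtain q where q: "m - r ^ N = int p ^ (t + 1) * q" using dvd ..
    define c where "c = m - r ^ N"
    have c0: "c \<noteq> 0" using h\<delta> h0 \<delta>0 unfolding c_def[symmetric] by auto
    have rel: "(\<Sum>i<N. of_nat (N choose i) * of_int r ^ i * \<delta> ^ (N - i)) = of_int c"
    proof -
      have "of_int m = (\<Sum>i\<le>N. of_nat (N choose i) * of_int r ^ i * \<delta> ^ (N - i))"
        using binomial_ring[of "of_int r" \<delta> N] \<gamma>(2) by (simp add: \<delta>_def)
      also have "\<dots> = (\<Sum>i<N. of_nat (N choose i) * of_int r ^ i * \<delta> ^ (N - i)) + of_int r ^ N"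
        by (simp add: lessThan_Suc_atMost[symmetric])
      finally show ?thesis by (simp add: c_def)
    qed
    define A where "A i = int (N choose i) * c ^ (N - i - 1)" for i
    have "\<exists>b. A i = int p ^ (t * (N - i)) * b" if i: "i < N" for i
    proof -
      define j where "j = N - i"
      have j: "j > 0" "j \<le> N" "N - j = i" using i unfolding j_def by auto
      have "p ^ t dvd (p ^ t choose j) * p ^ (j - 1)"
        using prime_power_dvd_choose_mult_power[OF p] j N by simp
      then obtain b where b: "(N choose j) * p ^ (j - 1) = p ^ t * b" unfolding N by (elim dvdE)
      have sym: "N choose i = N choose j" using j binomial_symmetric[of j N] by simp
      \<comment> \<open>Of the \<open>t + 1\<close> factors \<open>p\<close> in each
        \<open>c\<close>, one per copy completes the binomial coefficient to a multiple of
        \<open>p ^ t\<close>; the others give \<open>p ^ (t * (j - 1))\<close>.\<close>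
      have "c ^ (j - 1) = int p ^ (j - 1) * (int p ^ (t * (j - 1)) * q ^ (j - 1))"
        unfolding c_def q by (simp add: power_mult_distrib power_add power_mult)
      then have "A i = int ((N choose j) * p ^ (j - 1)) * (int p ^ (t * (j - 1)) * q ^ (j - 1))"
        unfolding A_def sym j_def[symmetric] by simp
      also have "\<dots> = int p ^ t * int p ^ (t * (j - 1)) * (int b * q ^ (j - 1))" unfolding b by simp
      also have "int p ^ t * int p ^ (t * (j - 1)) = int p ^ (t * j)"
        using j(1) by (cases j) (simp_all add: power_add)
      finally show ?thesis unfolding j_def by blast
    qed
    then obtain B where B: "\<And>i. i < N \<Longrightarrow> A i = int p ^ (t * (N - i)) * B i" by metis
    define w where "w = h / of_nat N"
    have hw: "h = of_nat p ^ t * w" using N0 by (simp add: w_def N)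
    have "of_int c * h ^ N = (\<Sum>i<N. of_nat (N choose i) * of_int r ^ i * \<delta> ^ (N - i)) * h ^ N"
      using rel by simp
    also have "\<dots> = (\<Sum>i<N. of_int c * (of_int (A i) * of_int r ^ i * h ^ i))"
      unfolding sum_distrib_right
    proof (intro sum.cong refl)
      fix i assume "i \<in> {..<N}"
      then have i: "i < N" by simp
      then have "h ^ N = h ^ (N - i) * h ^ i" by (simp flip: power_add)
      moreover have "\<delta> ^ (N - i) * h ^ (N - i) = of_int c ^ (N - i)"
        using h\<delta> unfolding c_def by (metis mult.commute power_mult_distrib)
      moreover have "(of_int c :: complex) ^ (N - i) = of_int c * of_int c ^ (N - i - 1)"
        using i by (simp add: power_eq_if)
      ultimately show "of_nat (N choose i) * of_int r ^ i * \<delta> ^ (N - i) * h ^ N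
        = of_int c * (of_int (A i) * of_int r ^ i * h ^ i)"
        unfolding A_def by simp
    qed
    also have "\<dots> = of_int c * (\<Sum>i<N. of_int (A i) * of_int r ^ i * h ^ i)"
      by (simp add: sum_distrib_left)
    finally have "h ^ N = (\<Sum>i<N. of_int (A i) * of_int r ^ i * h ^ i)"
      using c0 by simp
    also have "\<dots> = of_nat p ^ (t * N) * (\<Sum>i<N. of_int (B i * r ^ i) * w ^ i)"
      unfolding sum_distrib_left
    proof (intro sum.cong refl)
      fix i assume "i \<in> {..<N}"
      then have i: "i < N" by simp
      have "t * N = t * (N - i) + t * i" using i by (simp flip: distrib_left)
      then have "(of_nat p :: complex) ^ (t * N) = of_nat p ^ (t * (N - i)) * (of_nat p ^ t) ^ i"
        by (simp only: power_add power_mult)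
      then show "of_int (A i) * of_int r ^ i * h ^ i
        = of_nat p ^ (t * N) * (of_int (B i * r ^ i) * w ^ i)"
        unfolding B[OF i] hw by (simp add: power_mult_distrib)
    qed
    also have "h ^ N = of_nat p ^ (t * N) * w ^ N" unfolding hw by (simp add: power_mult_distrib power_mult)
    finally have "w ^ N = (\<Sum>i<N. of_int (B i * r ^ i) * w ^ i)"
      using p by (simp add: prime_gt_0_nat)
    then have "algebraic_int w" by (rule algebraic_int_monic_relation[OF _ N0])
    then show ?thesis unfolding w_def h_def .
  qed
qed

text \<open>In this form \<open>hpoly\<close> is the divided difference treated above, at
  \<open>\<gamma> = x ^ (p ^ (k - t))\<close> and \<open>N = p ^ t\<close>.\<close>

lemma hpoly_eq:
  assumes "t \<le> k" "p > 0"
  shows "hpoly r p k t x = (\<Sum>i<p ^ t. of_int r ^ i * (x ^ (p ^ (k - t))) ^ (p ^ t - 1 - i))"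
  unfolding hpoly_def
proof (intro sum.cong refl)
  fix i assume "i \<in> {..<p ^ t}"
  have "p ^ k = p ^ t * p ^ (k - t)" using assms(1) by (simp flip: power_add)
  then have "p ^ k - (i + 1) * p ^ (k - t) = p ^ (k - t) * (p ^ t - 1 - i)"
    by (simp add: diff_mult_distrib2 algebra_simps)
  then show "of_int r ^ i * x ^ (p ^ k - (i + 1) * p ^ (k - t))
    = of_int r ^ i * (x ^ p ^ (k - t)) ^ (p ^ t - 1 - i)" by (simp add: power_mult)
qed

lemma dvd_minus_prime_power_of_residue:
  fixes m :: int
  assumes p: "prime p" and m: "int p ^ (t + 1) dvd m ^ p - m"
  shows "int p ^ (t + 1) dvd m - m ^ p ^ i"
proof (induction i)
  case (Suc i)
  have "int p ^ (t + 1) dvd (m ^ p) ^ p ^ i - m ^ p ^ i" using m by (rule dvd_cong_power)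
  then have "int p ^ (t + 1) dvd (m - m ^ p ^ i) - ((m ^ p) ^ p ^ i - m ^ p ^ i)"
    using Suc by (rule dvd_diff[rotated])
  then show ?case by (simp add: power_mult)
qed simp

text \<open>Block \<open>t < s\<close> fills the degrees from \<open>p ^ k - p ^ (k - t)\<close> up
  to just below the start of block \<open>t + 1\<close>, and the last block runs up to
  \<open>p ^ k\<close>. The block of a degree \<open>d\<close> is the last one that starts at or
  below \<open>d\<close>.\<close>

lemma bij_betw_degrees:
  fixes p k s :: nat
  assumes p: "p > 1" and s: "s \<le> k"
  defines "I \<equiv> {(t, j). t < s \<and> j < p ^ (k - t) - p ^ (k - t - 1)} \<union> {(t, j). t = s \<and> j < p ^ (k - s)}"
  shows "bij_betw (\<lambda>(t, j). p ^ k - p ^ (k - t) + j) I {..<p ^ k}"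
proof -
  define a where "a t = p ^ k - p ^ (k - t)" for t
  have mono: "a t \<le> a t'" if "t \<le> t'" for t t'
    unfolding a_def using that p by (intro diff_le_mono2 power_increasing) auto
  have step: "a t + j < a (Suc t)" if "t < s" "j < p ^ (k - t) - p ^ (k - t - 1)" for t j
  proof -
    have "p ^ (k - t) \<le> p ^ k" using p by (intro power_increasing) auto
    then show ?thesis unfolding a_def using that by simp
  qed
  have last: "a s + j < p ^ k" if "j < p ^ (k - s)" for j
  proof -
    have "p ^ (k - s) \<le> p ^ k" using p by (intro power_increasing) auto
    then show ?thesis unfolding a_def using that by simp
  qed
  have a_le: "a t \<le> p ^ k" for t unfolding a_def by simp
  have lt: "a t + j < a t' + j'" if "(t, j) \<in> I" "(t', j') \<in> I" "t < t'" for t j t' j'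
  proof -
    have "t < s" using that unfolding I_def by auto
    then have "a t + j < a (Suc t)" using that(1) step unfolding I_def by auto
    also have "\<dots> \<le> a t'" using that(3) by (intro mono) simp
    finally show ?thesis by simp
  qed
  show ?thesis
    unfolding bij_betw_def a_def[symmetric]
  proof
    show "inj_on (\<lambda>(t, j). a t + j) I"
    proof (rule inj_onI, safe)
      fix t j t' j' assume *: "(t, j) \<in> I" "(t', j') \<in> I" "a t + j = a t' + j'"
      show "t = t'" using lt[OF *(1,2)] lt[OF *(2,1)] *(3) by (metis less_irrefl linorder_neqE_nat)
      then show "j = j'" using *(3) by simp
    qed
    show "(\<lambda>(t, j). a t + j) ` I = {..<p ^ k}"
    proof (intro equalityI subsetI)
      fix d assume "d \<in> (\<lambda>(t, j). a t + j) ` I"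
      then obtain t j where d: "d = a t + j" "(t, j) \<in> I" by auto
      then consider "t < s" "j < p ^ (k - t) - p ^ (k - t - 1)" | "t = s" "j < p ^ (k - s)"
        unfolding I_def by auto
      then show "d \<in> {..<p ^ k}"
      proof cases
        case 1
        then show ?thesis using step[OF 1] a_le[of "Suc t"] d by simp
      next
        case 2
        then show ?thesis using last d by simp
      qed
    next
      fix d assume "d \<in> {..<p ^ k}"
      then have d: "d < p ^ k" by simp
      define S where "S = {t. t \<le> s \<and> a t \<le> d}"
      define t where "t = Max S"
      have fin: "finite S" unfolding S_def by simp
      have "0 \<in> S" by (simp add: S_def a_def)
      then have "S \<noteq> {}" by blast
      then have "t \<in> S" unfolding t_def by (rule Max_in[OF fin])
      then have t: "t \<le> s" "a t \<le> d" unfolding S_def by auto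
      have tmax: "d < a (Suc t)" if "t < s"
      proof (rule ccontr)
        assume "\<not> d < a (Suc t)"
        then have "Suc t \<in> S" using that by (simp add: S_def)
        then have "Suc t \<le> t" unfolding t_def using fin by (rule Max_ge[rotated])
        then show False by simp
      qed
      have le: "p ^ (k - t) \<le> p ^ k" "p ^ (k - t - 1) \<le> p ^ (k - t)"
        using p by (auto intro!: power_increasing)
      have "(t, d - a t) \<in> I"
      proof (cases "t = s")
        case True
        have "d - a s < p ^ (k - s)" using d t(2) le(1) unfolding True a_def by simp
        then show ?thesis unfolding I_def using True by simp
      next
        case False
        then have "d < p ^ k - p ^ (k - t - 1)" using tmax t(1) by (simp add: a_def)
        moreover have "d - (X - y) < y - z" if "d < X - z" "X - y \<le> d" "y \<le> X" for X y z
          using that by arith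
        ultimately have "d - a t < p ^ (k - t) - p ^ (k - t - 1)" using t(2) le(1) unfolding a_def by blast
        then show ?thesis unfolding I_def using False t(1) by simp
      qed
      moreover have "d = a t + (d - a t)" using t(2) by simp
      ultimately show "d \<in> (\<lambda>(t, j). a t + j) ` I" by (intro image_eqI[of _ _ "(t, d - a t)"]) auto
    qed
  qed
qed

lemma integral_basis_hpoly:
  fixes m :: int and k p :: nat and \<alpha> :: complex
  assumes m: "squarefree m" "m \<noteq> 1" "m \<noteq> -1"
    and k: "k > 0" and p: "prime p" and pm: "\<not> int p dvd m"
    and root: "\<alpha> ^ (p ^ k) = of_int m"
    and r: "r = m mod int (p ^ (k + 1))"
    and s: "s = multiplicity (int p) (m ^ p - m) - 1" and s': "s' = min s k"
  shows "integral_basis (simple_ext \<alpha>) (\<lambda>(t, j). \<alpha> ^ j * hpoly r p k t \<alpha> / of_nat (p ^ t))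
    ({(t, j). t < s' \<and> j < p ^ (k - t) - p ^ (k - t - 1)} \<union> {(t, j). t = s' \<and> j < p ^ (k - s')})"
    (is "integral_basis _ ?b ?I")
proof -
  have p1: "p > 1" using p prime_gt_1_nat by blast
  interpret radical_root m "p ^ k" \<alpha>
    by unfold_locales (use m root p1 in auto)
  have s'k: "s' \<le> k" using s' by simp
  define T :: "nat \<times> nat \<Rightarrow> complex poly" where "T = (\<lambda>(t, j). \<Sum>i<p ^ t.
    monom (of_int r ^ i / of_nat (p ^ t)) (j + (p ^ k - (i + 1) * p ^ (k - t))))"
  define I where "I = ?I"
  have I_t: "t \<le> s'" "t \<le> k" if "(t, j) \<in> I" for t j using that s'k unfolding I_def by auto
  have degree_T: "degree (T (t, j)) = p ^ k - p ^ (k - t) + j"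
    and lead_T: "lead_coeff (T (t, j)) = 1 / of_nat (p ^ t)" if "t \<le> k" for t j
  proof -
    define d where "d = p ^ k - p ^ (k - t) + j"
    define e where "e i = j + (p ^ k - (i + 1) * p ^ (k - t))" for i
    have e0: "e 0 = d" unfolding e_def d_def by simp
    have pt: "p ^ k = p ^ t * p ^ (k - t)" using that by (simp flip: power_add)
    have e_lt: "e i < d" if i: "i < p ^ t" "i > 0" for i
    proof -
      define x where "x = (i + 1) * p ^ (k - t)"
      have "1 * p ^ (k - t) < x" unfolding x_def using i p1 by (intro mult_strict_right_mono) auto
      moreover have "x \<le> p ^ k" unfolding pt x_def using i by (intro mult_right_mono) auto
      ultimately show ?thesis unfolding e_def d_def x_def[symmetric] by linarith
    qed
    have T: "T (t, j) = (\<Sum>i<p ^ t. monom (of_int r ^ i / of_nat (p ^ t)) (e i))"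
      unfolding T_def e_def by simp
    have "coeff (T (t, j)) d = (\<Sum>i<p ^ t. if i = 0 then 1 / of_nat (p ^ t) else 0)"
      unfolding T coeff_sum
    proof (intro sum.cong refl)
      fix i assume i: "i \<in> {..<p ^ t}"
      show "coeff (monom (of_int r ^ i / of_nat (p ^ t)) (e i)) d = (if i = 0 then 1 / of_nat (p ^ t) else (0 :: complex))"
        using e_lt[of i] e0 i by (cases "i = 0") auto
    qed
    also have "\<dots> = 1 / of_nat (p ^ t)" using p1 by simp
    finally have coeff: "coeff (T (t, j)) d = 1 / of_nat (p ^ t)" .
    have "degree (T (t, j)) \<le> d"
      unfolding T
    proof (rule degree_sum_le)
      fix i assume i: "i \<in> {..<p ^ t}"
      then have "e i \<le> d" using e_lt[of i] e0 by (cases "i = 0") auto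
      then show "degree (monom (of_int r ^ i / of_nat (p ^ t) :: complex) (e i)) \<le> d"
        using degree_monom_le order_trans by blast
    qed simp
    moreover have "degree (T (t, j)) \<ge> d" using coeff p1 by (intro le_degree) simp
    ultimately show deg: "degree (T (t, j)) = p ^ k - p ^ (k - t) + j" unfolding d_def by simp
    show "lead_coeff (T (t, j)) = 1 / of_nat (p ^ t)" using coeff unfolding deg d_def .
  qed
  have bij: "bij_betw (\<lambda>(t, j). p ^ k - p ^ (k - t) + j) I {..<p ^ k}"
    unfolding I_def by (rule bij_betw_degrees[OF p1 s'k])
  have h_int: "algebraic_int (hpoly r p k t \<alpha> / of_nat (p ^ t))" if t: "t \<le> s'" for t
  proof -
    have tk: "t \<le> k" using t s'k by simp
    have "int p ^ (t + 1) dvd m - r ^ p ^ t"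
    \<comment> \<open>For \<open>t > 0\<close>, \<open>t \<le> s\<close> forces the truncated
      difference \<open>s\<close> to be positive, so the multiplicity is at least
      \<open>t + 1\<close>. At \<open>t = 0\<close> this inference fails, but \<open>r\<close> is
      congruent to \<open>m\<close> anyway.\<close>
    proof (cases "t = 0")
      case True
      have "int p ^ 1 dvd int p ^ (k + 1)" by (intro le_imp_power_dvd) simp
      moreover have "int p ^ (k + 1) dvd m - r" unfolding r by (simp add: minus_mod_eq_mult_div)
      ultimately have "int p ^ 1 dvd m - r" by (rule dvd_trans)
      then show ?thesis using True by simp
    next
      case False
      moreover have "t \<le> s" using t s' by simp
      ultimately have "t + 1 \<le> multiplicity (int p) (m ^ p - m)" unfolding s by linarith
      then have "int p ^ (t + 1) dvd m ^ p - m" by (rule multiplicity_dvd')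
      then have "int p ^ (t + 1) dvd m - m ^ p ^ t" by (rule dvd_minus_prime_power_of_residue[OF p])
      moreover have "int p ^ (t + 1) dvd m ^ p ^ t - r ^ p ^ t"
      proof (rule dvd_cong_power)
        have "int p ^ (t + 1) dvd int p ^ (k + 1)" using tk by (intro le_imp_power_dvd) simp
        moreover have "int p ^ (k + 1) dvd m - r" unfolding r by (simp add: minus_mod_eq_mult_div)
        ultimately show "int p ^ (t + 1) dvd m - r" by (rule dvd_trans)
      qed
      ultimately have "int p ^ (t + 1) dvd (m - m ^ p ^ t) + (m ^ p ^ t - r ^ p ^ t)" by (rule dvd_add)
      then show ?thesis by simp
    qed
    moreover have "(\<alpha> ^ p ^ (k - t)) ^ p ^ t = of_int m"
      using tk root by (simp flip: power_mult power_add)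
    ultimately have "algebraic_int ((\<Sum>i<p ^ t. of_int r ^ i * (\<alpha> ^ p ^ (k - t)) ^ (p ^ t - 1 - i)) / of_nat (p ^ t))"
      using algebraic_int_divided_difference[OF p refl] algebraic_int_alpha algebraic_int_power by blast
    then show ?thesis using hpoly_eq[OF tk] p1 by simp
  qed
  have "integral_basis (simple_ext \<alpha>) ?b I"
  proof (rule integral_basis_triangular[where T = T])
    show "finite I" using bij bij_betw_finite by blast
    have deg_bij: "bij_betw (\<lambda>i. degree (T i)) I {..<p ^ k} \<longleftrightarrow> bij_betw (\<lambda>(t, j). p ^ k - p ^ (k - t) + j) I {..<p ^ k}"
      by (rule bij_betw_cong) (use degree_T I_t in auto)
    then show "bij_betw (\<lambda>i. degree (T i)) I {..<p ^ k}" using bij by blast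
    fix i assume i: "i \<in> I"
    obtain t j where tj: "i = (t, j)" by (cases i)
    note t = I_t[OF i[unfolded tj]]
    have "coeffs_in \<rat> (\<Sum>i<p ^ t. monom (of_int r ^ i / of_nat (p ^ t)) (j + (p ^ k - (i + 1) * p ^ (k - t))))"
      by (intro coeffs_in_sum coeffs_in_closed is_subring_Rats Rats_divide Rats_power) auto
    then show "coeffs_in \<rat> (T i)" unfolding tj T_def by simp
    show "T i \<noteq> 0" using lead_T[OF t(2), of j] p1 unfolding tj by auto
    show "?b i = poly (T i) \<alpha>"
      unfolding tj T_def hpoly_def
      by (simp add: poly_sum poly_monom power_add sum_distrib_left sum_divide_distrib algebra_simps)
    have "algebraic_int (\<alpha> ^ j * (hpoly r p k t \<alpha> / of_nat (p ^ t)))"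
      using algebraic_int_alpha h_int[OF t(1)] by (intro algebraic_int_closed)
    then show "algebraic_int (?b i)" unfolding tj by simp
    fix P assume P: "coeffs_in \<rat> P" "degree P \<le> degree (T i)" "algebraic_int (poly P \<alpha>)"
    define d where "d = degree (T i)"
    have dd: "d = p ^ k - p ^ (k - t) + j" unfolding d_def tj by (rule degree_T[OF t(2)])
    have "of_nat (p ^ t) * coeff P d \<in> \<int>"
    proof (rule leading_coefficient_bound_at_prime[OF refl k p pm s s' P(1) _ P(3) _ t(1)])
      show "degree P \<le> d" using P(2) unfolding d_def .
      have "(case i of (t, j) \<Rightarrow> p ^ k - p ^ (k - t) + j) \<in> {..<p ^ k}"
        using bij_betw_apply[OF bij i] by simp
      then show "d < p ^ k" unfolding dd tj by simp
      \<comment> \<open>The upper bound on \<open>j\<close> in a block below the last is exactly the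
        degree condition of the leading coefficient bound.\<close>
      show "t = s' \<or> d + p ^ (k - t - 1) < p ^ k"
      proof (cases "t = s'")
        case False
        then have "j < p ^ (k - t) - p ^ (k - t - 1)" using i unfolding tj I_def by auto
        moreover have "p ^ (k - t) \<le> p ^ k" using p1 by (intro power_increasing) auto
        moreover have "X - y + j + z < X" if "j < y - z" "y \<le> X" for X y z :: nat
          using that by arith
        ultimately show ?thesis unfolding dd by blast
      qed simp
    qed
    then show "coeff P (degree (T i)) / lead_coeff (T i) \<in> \<int>"
      using lead_T[OF t(2), of j] unfolding d_def tj by (simp add: mult.commute)
  qed
  then show ?thesis unfolding I_def .
qed

theorem theorem3p7:
  fixes m :: int and k p :: nat and \<alpha> :: complex
  assumes "squarefree m" and "m \<noteq> 1" and "m \<noteq> -1"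
    and "k > 0" and "prime p" and "\<not> int p dvd m"
    and "\<alpha> ^ (p ^ k) = of_int m"
  defines "r \<equiv> m mod int (p ^ (k + 1))"
    and "s \<equiv> multiplicity (int p) (m ^ p - m) - 1"
  shows
    "(s < k \<longrightarrow>
       integral_basis (simple_ext \<alpha>)
         (\<lambda>(t, j). \<alpha> ^ j * hpoly r p k t \<alpha> / of_nat (p ^ t))
         ({(t, j). t < s \<and> j < p ^ (k - t) - p ^ (k - t - 1)} \<union>
          {(t, j). t = s \<and> j < p ^ (k - s)}))
   \<and> (s \<ge> k \<longrightarrow>
       integral_basis (simple_ext \<alpha>)
         (\<lambda>(t, j). \<alpha> ^ j * hpoly r p k t \<alpha> / of_nat (p ^ t))
         ({(t, j). t < k \<and> j < p ^ (k - t) - p ^ (k - t - 1)} \<union> {(k, 0)}))"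
proof -
  note basis = integral_basis_hpoly[OF assms(1-7) r_def[THEN meta_eq_to_obj_eq] s_def[THEN meta_eq_to_obj_eq] refl]
  have "integral_basis (simple_ext \<alpha>) (\<lambda>(t, j). \<alpha> ^ j * hpoly r p k t \<alpha> / of_nat (p ^ t))
    ({(t, j). t < k \<and> j < p ^ (k - t) - p ^ (k - t - 1)} \<union> {(k, 0)})" if "k \<le> s"
  proof -
    \<comment> \<open>For \<open>s \<ge> k\<close> the last block has length
      \<open>p ^ 0 = 1\<close>.\<close>
    have top: "{(t, j). t = k \<and> j < p ^ (k - k)} = {(k, 0)}" by auto
    show ?thesis using basis unfolding min_absorb2[OF that] top .
  qed
  moreover have "integral_basis (simple_ext \<alpha>) (\<lambda>(t, j). \<alpha> ^ j * hpoly r p k t \<alpha> / of_nat (p ^ t))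
    ({(t, j). t < s \<and> j < p ^ (k - t) - p ^ (k - t - 1)} \<union> {(t, j). t = s \<and> j < p ^ (k - s)})"
    if "s < k"
    using basis unfolding min_absorb1[OF less_imp_le[OF that]] .
  ultimately show ?thesis by blast
qed

end
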